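(* Let $\pi$ be an anti-invariant submersion from a nearly Kaehler manifold $(M,\varphi,g)$ onto a Riemannian manifold $(N,g_n)$. Also, let $h:J\subset\mathbb{R}\to M$ be a regular curve, and let $U(s)$ and $X(s)$ be the vertical and horizontal parts of the tangent vector field $\dot h(s)=W$ of $h(s)$. Then $\pi$ is a Clairaut submersion with $r=e^f$ if and only if along $h$ $$g(\mathrm{grad}f,X)\,g(U,U)=g\left(\mathcal{H}\nabla_{\dot h}\beta X+A_X\alpha X+T_U\alpha X+P_{\dot h(s)}U,\ \varphi U\right).$$
   Context: An almost Hermitian manifold $(M,\varphi,g)$ is a smooth manifold with a $(1,1)$-tensor field $\varphi$, $\varphi^2=-I$, and a Riemannian metric $g$ with $g(\varphi E,\varphi F)=g(E,F)$. It is nearly Kaehler if $(\nabla_E\varphi)F+(\nabla_F\varphi)E=0$ for all vector fields $E,F$, where $\nabla$ is the Levi-Civita connection of $g$. A Riemannian submersion $\pi:(M,g)\to(N,g_n)$ (with $\dim M>\dim N$) is a smooth surjective map of maximal rank whose differential $\pi_*$ preserves lengths of horizontal vectors; vertical vectors are those in $\ker\pi_*$ (tangent to the fibres), horizontal vectors are those in $(\ker\pi_* )^\perp$. $\mathcal{V}$ and $\mathcal{H}$ denote the orthogonal projections onto $\ker\pi_*$ and $(\ker\pi_* )^\perp$. The submersion is anti-invariant if $\varphi(\ker\pi_* )\subseteq(\ker\pi_* )^\perp$. Then $(\ker\pi_* )^\perp=\varphi\ker\pi_*\oplus\mu$, where $\mu$ is the complementary distribution to $\varphi\ker\pi_*$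 in $(\ker\pi_* )^\perp$ and $\varphi\mu\subset\mu$. For horizontal $X$ write $\varphi X=\alpha X+\beta X$ with $\alpha X\in\Gamma(\ker\pi_* )$ and $\beta X\in\Gamma(\mu)$. O'Neill's tensors are, for vector fields $E,F$ on $M$, $$T_EF=\mathcal{H}\nabla_{\mathcal{V}E}\mathcal{V}F+\mathcal{V}\nabla_{\mathcal{V}E}\mathcal{H}F,\qquad A_EF=\mathcal{H}\nabla_{\mathcal{H}E}\mathcal{V}F+\mathcal{V}\nabla_{\mathcal{H}E}\mathcal{H}F.$$ $P_EF$ denotes the horizontal part of $(\nabla_E\varphi)F$. $\nabla_{\dot h}$ is covariant differentiation along $h$. $\mathrm{grad}f$ is the gradient of the function $f$ on $M$ with respect to $g$. The Riemannian submersion $\pi$ is a Clairaut submersion if there exists a positive function $r$ on $M$ such that for any geodesic $\gamma$ on $M$ the function $(r\circ\gamma)\sin\theta$ is constant, where, for any $t$, $\theta(t)$ is the angle between $\dot\gamma(t)$ and the horizontal space at $\gamma(t)$; it is Clairaut with $r=e^f$ if this holds for that function $r$.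
   Formalization: Adds the assumption that grad f is horizontal; without it the "if" part fails (flat R², π(x,y)=x, f=y). Being Clairaut with r=e^f forces this anyway. The identity is required along every regular curve h, and f is smooth. *)

theory Defs
  imports "HOL-Analysis.Analysis"
begin

section \<open>Smooth maps between open subsets of Euclidean spaces\<close>

fun Ck_on :: "nat \<Rightarrow> 'a::euclidean_space set \<Rightarrow> ('a \<Rightarrow> 'b::real_normed_vector) \<Rightarrow> bool" where
  "Ck_on 0 S f \<longleftrightarrow> continuous_on S f"
| "Ck_on (Suc n) S f \<longleftrightarrow>
     (\<forall>x\<in>S. f differentiable (at x)) \<and>
     (\<forall>v. Ck_on n S (\<lambda>x. frechet_derivative f (at x) v))"

text \<open>Only meant for open \<open>S\<close>: the derivatives are two-sided.\<close>

definition smooth_on :: "'a::euclidean_space set \<Rightarrow> ('a \<Rightarrow> 'b::real_normed_vector) \<Rightarrow> bool" where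
  "smooth_on S f \<longleftrightarrow> (\<forall>n. Ck_on n S f)"


section \<open>Smooth manifolds and tangent vectors\<close>

text \<open>
  The points of a manifold form a Hausdorff, second countable topological space \<open>'m\<close>; the model
  space is the Euclidean space \<open>'a\<close>, so the dimension is \<open>DIM('a)\<close>. A chart is its domain together
  with its coordinate map; values of the coordinate map off the domain are irrelevant.

  Every point \<open>p\<close> carries a preferred chart \<open>chart_at M p\<close>, and a tangent vector at \<open>p\<close> is
  represented by its components in that chart. Thus every tangent space is a copy of \<open>'a\<close>, and the
  components in any other chart are obtained by applying the Jacobian of the transition map
  (\<open>comps\<close>, with inverse \<open>of_comps\<close>). A vector field assigns to each point such a vector; it is
  not smooth as a map into \<open>'a\<close>, because the preferred chart may jump from point to point.
\<close>

type_synonym ('m, 'a) chart = "'m set \<times> ('m \<Rightarrow> 'a)"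

abbreviation cdom :: "('m, 'a) chart \<Rightarrow> 'm set" where
  "cdom c \<equiv> fst c"

abbreviation cmap :: "('m, 'a) chart \<Rightarrow> 'm \<Rightarrow> 'a" where
  "cmap c \<equiv> snd c"

abbreviation cinv :: "('m, 'a) chart \<Rightarrow> 'a \<Rightarrow> 'm" where
  "cinv c \<equiv> inv_into (cdom c) (cmap c)"

record ('m, 'a) manifold =
  atlas :: "('m, 'a) chart set"
  chart_at :: "'m \<Rightarrow> ('m, 'a) chart"
  metric :: "'m \<Rightarrow> 'a \<Rightarrow> 'a \<Rightarrow> real"

definition smooth_manifold ::
  "('m::{t2_space,second_countable_topology}, 'a::euclidean_space) manifold \<Rightarrow> bool" where
  "smooth_manifold M \<longleftrightarrow>
     (\<forall>p. chart_at M p \<in> atlas M \<and> p \<in> cdom (chart_at M p)) \<and>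
     (\<forall>c\<in>atlas M. open (cdom c) \<and> open (cmap c ` cdom c) \<and>
        homeomorphism (cdom c) (cmap c ` cdom c) (cmap c) (cinv c)) \<and>
     (\<forall>c\<in>atlas M. \<forall>d\<in>atlas M. smooth_on (cmap c ` (cdom c \<inter> cdom d)) (cmap d \<circ> cinv c))"

definition comps ::
  "('m, 'a::euclidean_space) manifold \<Rightarrow> ('m, 'a) chart \<Rightarrow> 'm \<Rightarrow> 'a \<Rightarrow> 'a" where
  "comps M c p =
     frechet_derivative (cmap c \<circ> cinv (chart_at M p)) (at (cmap (chart_at M p) p))"

definition of_comps ::
  "('m, 'a::euclidean_space) manifold \<Rightarrow> ('m, 'a) chart \<Rightarrow> 'm \<Rightarrow> 'a \<Rightarrow> 'a" where
  "of_comps M c p = frechet_derivative (cmap (chart_at M p) \<circ> cinv c) (at (cmap c p))"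

definition smooth_fun ::
  "('m, 'a::euclidean_space) manifold \<Rightarrow> ('m \<Rightarrow> real) \<Rightarrow> bool" where
  "smooth_fun M f \<longleftrightarrow> (\<forall>c\<in>atlas M. smooth_on (cmap c ` cdom c) (f \<circ> cinv c))"

definition smooth_map ::
  "('m::topological_space, 'a::euclidean_space) manifold \<Rightarrow>
   ('n::topological_space, 'b::euclidean_space) manifold \<Rightarrow> ('m \<Rightarrow> 'n) \<Rightarrow> bool" where
  "smooth_map M N F \<longleftrightarrow> continuous_on UNIV F \<and>
     (\<forall>c\<in>atlas M. \<forall>d\<in>atlas N.
        smooth_on (cmap c ` (cdom c \<inter> F -` cdom d)) (cmap d \<circ> F \<circ> cinv c))"

definition differential ::
  "('m, 'a::euclidean_space) manifold \<Rightarrow> ('n, 'b::euclidean_space) manifold \<Rightarrow>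
   ('m \<Rightarrow> 'n) \<Rightarrow> 'm \<Rightarrow> 'a \<Rightarrow> 'b" where
  "differential M N F p =
     frechet_derivative (cmap (chart_at N (F p)) \<circ> F \<circ> cinv (chart_at M p))
       (at (cmap (chart_at M p) p))"

definition smooth_vector_field ::
  "('m, 'a::euclidean_space) manifold \<Rightarrow> ('m \<Rightarrow> 'a) \<Rightarrow> bool" where
  "smooth_vector_field M E \<longleftrightarrow>
     (\<forall>c\<in>atlas M. smooth_on (cmap c ` cdom c) (\<lambda>x. comps M c (cinv c x) (E (cinv c x))))"

definition smooth_tensor11 ::
  "('m, 'a::euclidean_space) manifold \<Rightarrow> ('m \<Rightarrow> 'a \<Rightarrow> 'a) \<Rightarrow> bool" where
  "smooth_tensor11 M \<phi> \<longleftrightarrow> (\<forall>p. linear (\<phi> p)) \<and>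
     (\<forall>c\<in>atlas M. \<forall>v. smooth_on (cmap c ` cdom c)
        (\<lambda>x. comps M c (cinv c x) (\<phi> (cinv c x) (of_comps M c (cinv c x) v))))"


section \<open>Riemannian metrics and the Levi-Civita connection\<close>

definition metric_comps ::
  "('m, 'a::euclidean_space) manifold \<Rightarrow> ('m, 'a) chart \<Rightarrow> 'a \<Rightarrow> 'a \<Rightarrow> 'a \<Rightarrow> real" where
  "metric_comps M c x v w =
     metric M (cinv c x) (of_comps M c (cinv c x) v) (of_comps M c (cinv c x) w)"

definition riemannian_manifold ::
  "('m::{t2_space,second_countable_topology}, 'a::euclidean_space) manifold \<Rightarrow> bool" where
  "riemannian_manifold M \<longleftrightarrow> smooth_manifold M \<and>
     (\<forall>p. bilinear (metric M p) \<and> (\<forall>v w. metric M p v w = metric M p w v) \<and>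
          (\<forall>v. v \<noteq> 0 \<longrightarrow> metric M p v v > 0)) \<and>
     (\<forall>c\<in>atlas M. \<forall>v w. smooth_on (cmap c ` cdom c) (\<lambda>x. metric_comps M c x v w))"

definition gnorm :: "('m, 'a::euclidean_space) manifold \<Rightarrow> 'm \<Rightarrow> 'a \<Rightarrow> real" where
  "gnorm M p v = sqrt (metric M p v v)"

text \<open>
  The Levi-Civita connection is the unique torsion-free metric connection. In a chart, a
  connection is \<open>\<nabla>\<^sub>v F = DF(v) + \<Gamma>(v, F)\<close> with \<open>\<Gamma>\<close> bilinear at each point; it is torsion-free
  iff \<open>\<Gamma>\<close> is symmetric, and metric iff
  \<open>D\<^sub>u (g(v, w)) = g(\<Gamma>(u, v), w) + g(v, \<Gamma>(u, w))\<close> for constant \<open>v\<close>, \<open>w\<close>.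
\<close>

definition christoffel ::
  "('m, 'a::euclidean_space) manifold \<Rightarrow> ('m, 'a) chart \<Rightarrow> 'a \<Rightarrow> 'a \<Rightarrow> 'a \<Rightarrow> 'a" where
  "christoffel M c x = (THE \<Gamma>. bilinear \<Gamma> \<and> (\<forall>v w. \<Gamma> v w = \<Gamma> w v) \<and>
     (\<forall>u v w. frechet_derivative (\<lambda>y. metric_comps M c y v w) (at x) u =
        metric_comps M c x (\<Gamma> u v) w + metric_comps M c x v (\<Gamma> u w)))"

text \<open>
  The value at \<open>p\<close> of the covariant derivative of the vector field \<open>F\<close> in the direction of the
  tangent vector \<open>v\<close> at \<open>p\<close>. The components of \<open>v\<close> and \<open>F p\<close> in \<open>chart_at M p\<close> are \<open>v\<close> and
  \<open>F p\<close> themselves.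
\<close>

definition nabla ::
  "('m, 'a::euclidean_space) manifold \<Rightarrow> 'm \<Rightarrow> 'a \<Rightarrow> ('m \<Rightarrow> 'a) \<Rightarrow> 'a" where
  "nabla M p v F = (let c = chart_at M p in
     frechet_derivative (\<lambda>x. comps M c (cinv c x) (F (cinv c x))) (at (cmap c p)) v
     + christoffel M c (cmap c p) v (F p))"

text \<open>\<open>(\<nabla>\<^sub>v \<phi>) F\<close> at \<open>p\<close>\<close>

definition nabla_tensor ::
  "('m, 'a::euclidean_space) manifold \<Rightarrow> ('m \<Rightarrow> 'a \<Rightarrow> 'a) \<Rightarrow> 'm \<Rightarrow> 'a \<Rightarrow> ('m \<Rightarrow> 'a) \<Rightarrow> 'a" where
  "nabla_tensor M \<phi> p v F = nabla M p v (\<lambda>q. \<phi> q (F q)) - \<phi> p (nabla M p v F)"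

definition grad :: "('m, 'a::euclidean_space) manifold \<Rightarrow> ('m \<Rightarrow> real) \<Rightarrow> 'm \<Rightarrow> 'a" where
  "grad M f p = (THE v. \<forall>w. metric M p v w =
     frechet_derivative (f \<circ> cinv (chart_at M p)) (at (cmap (chart_at M p) p)) w)"

text \<open>
  A local vector field with value \<open>w\<close> at \<open>p\<close>: constant components in the preferred chart of \<open>p\<close>.
  Used to evaluate tensors, defined through covariant derivatives of vector fields, on single
  tangent vectors; by tensoriality any other extension gives the same value.
\<close>

definition extend ::
  "('m, 'a::euclidean_space) manifold \<Rightarrow> 'm \<Rightarrow> 'a \<Rightarrow> 'm \<Rightarrow> 'a" where
  "extend M p w q =
     (if q \<in> cdom (chart_at M p) then of_comps M (chart_at M p) q w else 0)"


section \<open>Curves\<close>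

definition smooth_curve ::
  "('m::topological_space, 'a::euclidean_space) manifold \<Rightarrow> real set \<Rightarrow> (real \<Rightarrow> 'm) \<Rightarrow> bool" where
  "smooth_curve M J \<gamma> \<longleftrightarrow> open J \<and> is_interval J \<and> J \<noteq> {} \<and> continuous_on J \<gamma> \<and>
     (\<forall>c\<in>atlas M. smooth_on (J \<inter> \<gamma> -` cdom c) (cmap c \<circ> \<gamma>))"

definition velocity ::
  "('m, 'a::euclidean_space) manifold \<Rightarrow> (real \<Rightarrow> 'm) \<Rightarrow> real \<Rightarrow> 'a" where
  "velocity M \<gamma> t = vector_derivative (cmap (chart_at M (\<gamma> t)) \<circ> \<gamma>) (at t)"

definition regular_curve ::
  "('m::topological_space, 'a::euclidean_space) manifold \<Rightarrow> real set \<Rightarrow> (real \<Rightarrow> 'm) \<Rightarrow> bool" where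
  "regular_curve M J \<gamma> \<longleftrightarrow> smooth_curve M J \<gamma> \<and> (\<forall>t\<in>J. velocity M \<gamma> t \<noteq> 0)"

text \<open>Covariant derivative, along \<open>\<gamma>\<close>, of a vector field \<open>Y\<close> along \<open>\<gamma>\<close>\<close>

definition nabla_along ::
  "('m, 'a::euclidean_space) manifold \<Rightarrow> (real \<Rightarrow> 'm) \<Rightarrow> (real \<Rightarrow> 'a) \<Rightarrow> real \<Rightarrow> 'a" where
  "nabla_along M \<gamma> Y t = (let c = chart_at M (\<gamma> t) in
     vector_derivative (\<lambda>s. comps M c (\<gamma> s) (Y s)) (at t)
     + christoffel M c (cmap c (\<gamma> t)) (velocity M \<gamma> t) (Y t))"

definition geodesic ::
  "('m::topological_space, 'a::euclidean_space) manifold \<Rightarrow> real set \<Rightarrow> (real \<Rightarrow> 'm) \<Rightarrow> bool" where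
  "geodesic M J \<gamma> \<longleftrightarrow> smooth_curve M J \<gamma> \<and>
     (\<forall>t\<in>J. nabla_along M \<gamma> (velocity M \<gamma>) t = 0)"


section \<open>Nearly Kaehler manifolds\<close>

definition almost_hermitian ::
  "('m::{t2_space,second_countable_topology}, 'a::euclidean_space) manifold \<Rightarrow>
   ('m \<Rightarrow> 'a \<Rightarrow> 'a) \<Rightarrow> bool" where
  "almost_hermitian M \<phi> \<longleftrightarrow> riemannian_manifold M \<and> smooth_tensor11 M \<phi> \<and>
     (\<forall>p v. \<phi> p (\<phi> p v) = - v) \<and>
     (\<forall>p v w. metric M p (\<phi> p v) (\<phi> p w) = metric M p v w)"

definition nearly_kaehler ::
  "('m::{t2_space,second_countable_topology}, 'a::euclidean_space) manifold \<Rightarrow>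
   ('m \<Rightarrow> 'a \<Rightarrow> 'a) \<Rightarrow> bool" where
  "nearly_kaehler M \<phi> \<longleftrightarrow> almost_hermitian M \<phi> \<and>
     (\<forall>E F. smooth_vector_field M E \<longrightarrow> smooth_vector_field M F \<longrightarrow>
        (\<forall>p. nabla_tensor M \<phi> p (E p) F + nabla_tensor M \<phi> p (F p) E = 0))"


section \<open>Anti-invariant Riemannian submersions\<close>

definition vertical_space ::
  "('m, 'a::euclidean_space) manifold \<Rightarrow> ('n, 'b::euclidean_space) manifold \<Rightarrow>
   ('m \<Rightarrow> 'n) \<Rightarrow> 'm \<Rightarrow> 'a set" where
  "vertical_space M N \<pi> p = {v. differential M N \<pi> p v = 0}"

definition horizontal_space ::
  "('m, 'a::euclidean_space) manifold \<Rightarrow> ('n, 'b::euclidean_space) manifold \<Rightarrow>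
   ('m \<Rightarrow> 'n) \<Rightarrow> 'm \<Rightarrow> 'a set" where
  "horizontal_space M N \<pi> p = {x. \<forall>u\<in>vertical_space M N \<pi> p. metric M p x u = 0}"

definition ver ::
  "('m, 'a::euclidean_space) manifold \<Rightarrow> ('n, 'b::euclidean_space) manifold \<Rightarrow>
   ('m \<Rightarrow> 'n) \<Rightarrow> 'm \<Rightarrow> 'a \<Rightarrow> 'a" where
  "ver M N \<pi> p w =
     (THE u. u \<in> vertical_space M N \<pi> p \<and> w - u \<in> horizontal_space M N \<pi> p)"

definition hor ::
  "('m, 'a::euclidean_space) manifold \<Rightarrow> ('n, 'b::euclidean_space) manifold \<Rightarrow>
   ('m \<Rightarrow> 'n) \<Rightarrow> 'm \<Rightarrow> 'a \<Rightarrow> 'a" where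
  "hor M N \<pi> p w =
     (THE x. x \<in> horizontal_space M N \<pi> p \<and> w - x \<in> vertical_space M N \<pi> p)"

definition riemannian_submersion ::
  "('m::{t2_space,second_countable_topology}, 'a::euclidean_space) manifold \<Rightarrow>
   ('n::{t2_space,second_countable_topology}, 'b::euclidean_space) manifold \<Rightarrow>
   ('m \<Rightarrow> 'n) \<Rightarrow> bool" where
  "riemannian_submersion M N \<pi> \<longleftrightarrow>
     riemannian_manifold M \<and> riemannian_manifold N \<and> DIM('a) > DIM('b) \<and>
     smooth_map M N \<pi> \<and> surj \<pi> \<and> (\<forall>p. surj (differential M N \<pi> p)) \<and>
     (\<forall>p. \<forall>x\<in>horizontal_space M N \<pi> p.
        gnorm N (\<pi> p) (differential M N \<pi> p x) = gnorm M p x)"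

definition anti_invariant_submersion ::
  "('m::{t2_space,second_countable_topology}, 'a::euclidean_space) manifold \<Rightarrow>
   ('m \<Rightarrow> 'a \<Rightarrow> 'a) \<Rightarrow>
   ('n::{t2_space,second_countable_topology}, 'b::euclidean_space) manifold \<Rightarrow>
   ('m \<Rightarrow> 'n) \<Rightarrow> bool" where
  "anti_invariant_submersion M \<phi> N \<pi> \<longleftrightarrow> riemannian_submersion M N \<pi> \<and>
     (\<forall>p. \<phi> p ` vertical_space M N \<pi> p \<subseteq> horizontal_space M N \<pi> p)"

text \<open>The orthogonal complement of \<open>\<phi> ker \<pi>\<^sub>*\<close> in \<open>(ker \<pi>\<^sub>*)\<^sup>\<bottom>\<close>\<close>

definition mu_space ::
  "('m, 'a::euclidean_space) manifold \<Rightarrow> ('m \<Rightarrow> 'a \<Rightarrow> 'a) \<Rightarrow>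
   ('n, 'b::euclidean_space) manifold \<Rightarrow> ('m \<Rightarrow> 'n) \<Rightarrow> 'm \<Rightarrow> 'a set" where
  "mu_space M \<phi> N \<pi> p =
     {x \<in> horizontal_space M N \<pi> p. \<forall>u\<in>vertical_space M N \<pi> p. metric M p x (\<phi> p u) = 0}"

definition alpha ::
  "('m, 'a::euclidean_space) manifold \<Rightarrow> ('m \<Rightarrow> 'a \<Rightarrow> 'a) \<Rightarrow>
   ('n, 'b::euclidean_space) manifold \<Rightarrow> ('m \<Rightarrow> 'n) \<Rightarrow> 'm \<Rightarrow> 'a \<Rightarrow> 'a" where
  "alpha M \<phi> N \<pi> p x =
     (THE a. a \<in> vertical_space M N \<pi> p \<and> \<phi> p x - a \<in> mu_space M \<phi> N \<pi> p)"

definition beta ::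
  "('m, 'a::euclidean_space) manifold \<Rightarrow> ('m \<Rightarrow> 'a \<Rightarrow> 'a) \<Rightarrow>
   ('n, 'b::euclidean_space) manifold \<Rightarrow> ('m \<Rightarrow> 'n) \<Rightarrow> 'm \<Rightarrow> 'a \<Rightarrow> 'a" where
  "beta M \<phi> N \<pi> p x =
     (THE b. b \<in> mu_space M \<phi> N \<pi> p \<and> \<phi> p x - b \<in> vertical_space M N \<pi> p)"

definition oneill_T ::
  "('m, 'a::euclidean_space) manifold \<Rightarrow> ('n, 'b::euclidean_space) manifold \<Rightarrow>
   ('m \<Rightarrow> 'n) \<Rightarrow> ('m \<Rightarrow> 'a) \<Rightarrow> ('m \<Rightarrow> 'a) \<Rightarrow> 'm \<Rightarrow> 'a" where
  "oneill_T M N \<pi> E F p =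
     hor M N \<pi> p (nabla M p (ver M N \<pi> p (E p)) (\<lambda>q. ver M N \<pi> q (F q)))
     + ver M N \<pi> p (nabla M p (ver M N \<pi> p (E p)) (\<lambda>q. hor M N \<pi> q (F q)))"

definition oneill_A ::
  "('m, 'a::euclidean_space) manifold \<Rightarrow> ('n, 'b::euclidean_space) manifold \<Rightarrow>
   ('m \<Rightarrow> 'n) \<Rightarrow> ('m \<Rightarrow> 'a) \<Rightarrow> ('m \<Rightarrow> 'a) \<Rightarrow> 'm \<Rightarrow> 'a" where
  "oneill_A M N \<pi> E F p =
     hor M N \<pi> p (nabla M p (hor M N \<pi> p (E p)) (\<lambda>q. ver M N \<pi> q (F q)))
     + ver M N \<pi> p (nabla M p (hor M N \<pi> p (E p)) (\<lambda>q. hor M N \<pi> q (F q)))"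

definition P_field ::
  "('m, 'a::euclidean_space) manifold \<Rightarrow> ('m \<Rightarrow> 'a \<Rightarrow> 'a) \<Rightarrow>
   ('n, 'b::euclidean_space) manifold \<Rightarrow> ('m \<Rightarrow> 'n) \<Rightarrow> ('m \<Rightarrow> 'a) \<Rightarrow> ('m \<Rightarrow> 'a) \<Rightarrow> 'm \<Rightarrow> 'a" where
  "P_field M \<phi> N \<pi> E F p = hor M N \<pi> p (nabla_tensor M \<phi> p (E p) F)"

text \<open>The tensors \<open>T\<close>, \<open>A\<close>, \<open>P\<close> evaluated on tangent vectors at \<open>p\<close>\<close>

definition T_at ::
  "('m, 'a::euclidean_space) manifold \<Rightarrow> ('n, 'b::euclidean_space) manifold \<Rightarrow>
   ('m \<Rightarrow> 'n) \<Rightarrow> 'm \<Rightarrow> 'a \<Rightarrow> 'a \<Rightarrow> 'a" where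
  "T_at M N \<pi> p v w = oneill_T M N \<pi> (extend M p v) (extend M p w) p"

definition A_at ::
  "('m, 'a::euclidean_space) manifold \<Rightarrow> ('n, 'b::euclidean_space) manifold \<Rightarrow>
   ('m \<Rightarrow> 'n) \<Rightarrow> 'm \<Rightarrow> 'a \<Rightarrow> 'a \<Rightarrow> 'a" where
  "A_at M N \<pi> p v w = oneill_A M N \<pi> (extend M p v) (extend M p w) p"

definition P_at ::
  "('m, 'a::euclidean_space) manifold \<Rightarrow> ('m \<Rightarrow> 'a \<Rightarrow> 'a) \<Rightarrow>
   ('n, 'b::euclidean_space) manifold \<Rightarrow> ('m \<Rightarrow> 'n) \<Rightarrow> 'm \<Rightarrow> 'a \<Rightarrow> 'a \<Rightarrow> 'a" where
  "P_at M \<phi> N \<pi> p v w = P_field M \<phi> N \<pi> (extend M p v) (extend M p w) p"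


section \<open>Clairaut submersions\<close>

text \<open>
  The angle between a vector and a subspace is the angle between the vector and its orthogonal
  projection; with \<open>x / 0 = 0\<close> it is \<open>pi / 2\<close> for a vertical vector, as it should be. The velocity
  of a constant geodesic has no angle, but its arbitrary value here is harmless: \<open>(r \<circ> \<gamma>) sin \<theta>\<close>
  is constant anyway.
\<close>

definition angle_to_horizontal ::
  "('m, 'a::euclidean_space) manifold \<Rightarrow> ('n, 'b::euclidean_space) manifold \<Rightarrow>
   ('m \<Rightarrow> 'n) \<Rightarrow> 'm \<Rightarrow> 'a \<Rightarrow> real" where
  "angle_to_horizontal M N \<pi> p w =
     arccos (metric M p w (hor M N \<pi> p w) / (gnorm M p w * gnorm M p (hor M N \<pi> p w)))"

definition clairaut_with ::
  "('m::{t2_space,second_countable_topology}, 'a::euclidean_space) manifold \<Rightarrow>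
   ('n::{t2_space,second_countable_topology}, 'b::euclidean_space) manifold \<Rightarrow>
   ('m \<Rightarrow> 'n) \<Rightarrow> ('m \<Rightarrow> real) \<Rightarrow> bool" where
  "clairaut_with M N \<pi> r \<longleftrightarrow> riemannian_submersion M N \<pi> \<and> (\<forall>p. r p > 0) \<and>
     (\<forall>J \<gamma>. geodesic M J \<gamma> \<longrightarrow>
        (\<lambda>t. r (\<gamma> t) * sin (angle_to_horizontal M N \<pi> (\<gamma> t) (velocity M \<gamma> t))) constant_on J)"

end

theory Submission
  imports Defs
begin

text \<open>
  Write \<open>W = U + X\<close> for the velocity of a curve. Pairing the right-hand side of the criterion with
  \<open>\<phi>U\<close>, the terms in \<open>\<alpha>X\<close> and \<open>\<beta>X\<close> combine to \<open>g(\<nabla>\<^sub>W \<phi>X, \<phi>U)\<close>; adding the \<open>P\<^sub>W U\<close> term and using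
  \<open>(\<nabla>\<^sub>W \<phi>)W = 0\<close> leaves \<open>g(\<nabla>\<^sub>W X, U)\<close>. If \<open>H\<close> denotes the field of horizontal projections, then
  \<open>\<nabla>\<^sub>W X\<close> is \<open>(\<nabla>\<^sub>W H)W\<close> up to a horizontal vector, so \<open>g(\<nabla>\<^sub>W X, U)\<close> is a function
  of \<open>W\<close> alone. Along a geodesic the speed is constant, \<open>sin \<theta> = |U| / |W|\<close>, and
  \<open>(e\<^sup>2\<^sup>f g(U, U))' = 2 e\<^sup>2\<^sup>f (g(grad f, X) g(U, U) - g(\<nabla>\<^sub>W X, U))\<close>, where \<open>g(grad f, U) = 0\<close> is used.
  Since every tangent vector is the velocity of a geodesic, the Clairaut condition for geodesics is the
  identity for all curves.
\<close>

section \<open>Calculus of smooth maps\<close>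

text \<open>The geometry is carried by first-order data at one point \<open>p\<close>, read in the
  preferred chart of \<open>p\<close>: the Christoffel form and the derivatives of the component
  matrices of the horizontal projection and of \<phi>. The velocity of a curve is not the
  restriction of a given vector field, and its representation may jump with the preferred chart, so
  derivatives along a curve are taken in the chart fixed at the instant considered. Neither the
  Christoffel symbols nor the projection come with an explicit formula; both are determined by
  pairing with all vectors, \<open>G x (y x) w = \<beta> x w\<close>, and this is why smooth
  dependence of solutions of such systems is proved in general. Two further needs shape the
  analysis: \<open>nearly_kaehler\<close> speaks of global vector fields, so a tangent vector has to
  be extended by a cut-off; and a geodesic is constructed in one chart, whereas
  \<open>geodesic\<close> tests it at each instant in the preferred chart there. Comparing the two
  takes a transformation law of the Christoffel symbols, which rests on symmetry of second
  derivatives.\<close>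

lemma Ck_on_SucD:
  assumes "Ck_on (Suc n) S f"
  shows "\<And>x. x \<in> S \<Longrightarrow> (f has_derivative frechet_derivative f (at x)) (at x)"
    and "\<And>v. Ck_on n S (\<lambda>x. frechet_derivative f (at x) v)"
  using assms by (auto simp: frechet_derivative_works)

text \<open>Openness makes a derivative at a point of \<open>S\<close> depend only on values on
  \<open>S\<close>; off \<open>S\<close> the two functions may differ, as chart expressions
  do.\<close>

lemma Ck_on_cong:
  assumes "open S" "\<And>x. x \<in> S \<Longrightarrow> f x = g x" "Ck_on n S f"
  shows "Ck_on n S g"
  using assms(2,3)
proof (induction n arbitrary: f g)
  case 0
  then show ?case using continuous_on_cong[of S S f g] by simp
next
  case (Suc n)
  have *: "(g has_derivative frechet_derivative f (at x)) (at x)" if "x \<in> S" for x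
    using Ck_on_SucD(1)[OF Suc.prems(2) that] has_derivative_transform_within_open[OF _ assms(1) that]
      Suc.prems(1) by blast
  have "Ck_on n S (\<lambda>x. frechet_derivative g (at x) v)" for v
    by (rule Suc.IH[OF _ Ck_on_SucD(2)[OF Suc.prems(2)]]) (use frechet_derivative_at[OF *] in simp)
  with * show ?case by (auto simp: differentiable_def)
qed

text \<open>Entry point for inductions on \<open>n\<close>: an explicit family \<open>F x\<close> of
  derivatives may stand in for \<open>frechet_derivative\<close>, which is a choice operator and
  awkward to compute with.\<close>

lemma Ck_on_SucI:
  assumes "open S" "\<And>x. x \<in> S \<Longrightarrow> (f has_derivative F x) (at x)" "\<And>v. Ck_on n S (\<lambda>x. F x v)"
  shows "Ck_on (Suc n) S f"
proof -
  have "Ck_on n S (\<lambda>x. frechet_derivative f (at x) v)" for v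
    by (rule Ck_on_cong[OF assms(1) _ assms(3)]) (use frechet_derivative_at[OF assms(2)] in simp)
  with assms(2) show ?thesis by (auto simp: differentiable_def)
qed

text \<open>Product and chain rules leave undifferentiated factors in the derivative; these are
  needed at order \<open>n\<close>, while the assumptions give them at order
  \<open>Suc n\<close>.\<close>

lemma Ck_on_Suc_lower: "Ck_on (Suc n) S f \<Longrightarrow> Ck_on n S f"
proof (induction n arbitrary: f)
  case 0
  then show ?case
    by (auto intro!: continuous_at_imp_continuous_on differentiable_imp_continuous_within)
next
  case (Suc n)
  have "Ck_on n S (\<lambda>x. frechet_derivative f (at x) v)" for v
    by (rule Suc.IH[OF Ck_on_SucD(2)[OF Suc.prems]])
  with Suc.prems show ?case unfolding Ck_on.simps(2)[of n] Ck_on.simps(2)[of "Suc n"] by blast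
qed

lemma Ck_on_subset: "Ck_on n S f \<Longrightarrow> T \<subseteq> S \<Longrightarrow> Ck_on n T f"
  by (induction n arbitrary: f) (auto intro: continuous_on_subset)

lemma Ck_on_local:
  assumes "\<And>x. x \<in> S \<Longrightarrow> \<exists>T. open T \<and> x \<in> T \<and> Ck_on n T f"
  shows "Ck_on n S f"
  using assms
proof (induction n arbitrary: f)
  case 0
  have "isCont f x" if "x \<in> S" for x
    using 0[OF that] by (auto simp: continuous_on_eq_continuous_at)
  then show ?case by (simp add: continuous_at_imp_continuous_on)
next
  case (Suc n)
  have "f differentiable (at x)" if "x \<in> S" for x
    using Suc.prems[OF that] by auto
  moreover have "Ck_on n S (\<lambda>x. frechet_derivative f (at x) v)" for v
    by (rule Suc.IH) (metis Ck_on_SucD(2) Suc.prems)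
  ultimately show ?case by simp
qed

lemma Ck_on_const: "Ck_on n S (\<lambda>x. c)"
  by (induction n arbitrary: c) auto

lemma Ck_on_bounded_linear:
  assumes "open S" "bounded_linear L"
  shows "Ck_on n S f \<Longrightarrow> Ck_on n S (\<lambda>x. L (f x))"
proof (induction n arbitrary: f)
  case 0
  then show ?case using assms(2) by (simp add: linear_continuous_on_compose bounded_linear.linear
      continuous_on_compose2[OF linear_continuous_on[of L UNIV]])
next
  case (Suc n)
  show ?case
    by (rule Ck_on_SucI[OF assms(1), where F = "\<lambda>x v. L (frechet_derivative f (at x) v)"])
      (rule Suc.IH[OF Ck_on_SucD(2)[OF Suc.prems]] bounded_linear.has_derivative[OF assms(2)]
        Ck_on_SucD(1)[OF Suc.prems], assumption?)+
qed

lemma Ck_on_add: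
  assumes "open S"
  shows "Ck_on n S f \<Longrightarrow> Ck_on n S g \<Longrightarrow> Ck_on n S (\<lambda>x. f x + g x)"
proof (induction n arbitrary: f g)
  case 0
  then show ?case by (simp add: continuous_on_add)
next
  case (Suc n)
  show ?case
    by (rule Ck_on_SucI[OF assms, where F = "\<lambda>x v. frechet_derivative f (at x) v + frechet_derivative g (at x) v"])
      (use Suc.IH Ck_on_SucD[OF Suc.prems(1)] Ck_on_SucD[OF Suc.prems(2)] in \<open>auto intro: has_derivative_add\<close>)
qed

lemma Ck_on_sum:
  assumes "open S" "\<And>i. i \<in> I \<Longrightarrow> Ck_on n S (f i)"
  shows "Ck_on n S (\<lambda>x. \<Sum>i\<in>I. f i x)"
  using assms(2)
  by (induction I rule: infinite_finite_induct) (auto intro: Ck_on_const Ck_on_add[OF assms(1)])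

lemma Ck_on_bilinear:
  assumes "open S" "bounded_bilinear B"
  shows "Ck_on n S f \<Longrightarrow> Ck_on n S g \<Longrightarrow> Ck_on n S (\<lambda>x. B (f x) (g x))"
proof (induction n arbitrary: f g)
  case 0
  then show ?case using bounded_bilinear.continuous_on[OF assms(2)] by simp
next
  case (Suc n)
  show ?case
  proof (rule Ck_on_SucI[OF assms(1)])
    show "((\<lambda>x. B (f x) (g x)) has_derivative
        (\<lambda>v. B (f x) (frechet_derivative g (at x) v) + B (frechet_derivative f (at x) v) (g x))) (at x)"
      if "x \<in> S" for x
      by (rule bounded_bilinear.FDERIV[OF assms(2)])
        (use that Ck_on_SucD[OF Suc.prems(1)] Ck_on_SucD[OF Suc.prems(2)] in auto)
    show "Ck_on n S (\<lambda>x. B (f x) (frechet_derivative g (at x) v) + B (frechet_derivative f (at x) v) (g x))" for v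
      by (intro Ck_on_add assms(1) Suc.IH Ck_on_SucD(2) Suc.prems Ck_on_Suc_lower)
  qed
qed

lemmas Ck_on_scaleR = Ck_on_bilinear[OF _ bounded_bilinear_scaleR]
lemmas Ck_on_mult = Ck_on_bilinear[OF _ bounded_bilinear_mult]

lemma Ck_on_inner_const: "open S \<Longrightarrow> Ck_on n S f \<Longrightarrow> Ck_on n S (\<lambda>x. f x \<bullet> b)"
  by (rule Ck_on_bounded_linear[OF _ bounded_linear_inner_left])

lemma Ck_on_diff: "open S \<Longrightarrow> Ck_on n S f \<Longrightarrow> Ck_on n S g \<Longrightarrow> Ck_on n S (\<lambda>x. f x - g x)"
  using Ck_on_add[of S n f "\<lambda>x. - g x"] Ck_on_bounded_linear[OF _ bounded_linear_minus[OF bounded_linear_ident], of S n g]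
  by simp

lemma Ck_on_Pair:
  assumes "open S" "Ck_on n S f" "Ck_on n S g"
  shows "Ck_on n S (\<lambda>x. (f x, g x))"
proof -
  have "bounded_linear (\<lambda>y. (y, 0))" "bounded_linear (\<lambda>y. (0, y))"
    by (intro bounded_linear_Pair bounded_linear_ident bounded_linear_zero)+
  from Ck_on_add[OF assms(1) Ck_on_bounded_linear[OF assms(1) this(1) assms(2)]
      Ck_on_bounded_linear[OF assms(1) this(2) assms(3)]]
  show ?thesis by simp
qed

lemma Ck_on_id: "open S \<Longrightarrow> Ck_on n S (\<lambda>x. x)"
proof (cases n)
  case (Suc m)
  assume "open S"
  then show ?thesis unfolding Suc
    by (intro Ck_on_SucI[where F="\<lambda>x v. v"]) (auto intro: Ck_on_const)
qed auto

lemma linear_basis_expand: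
  fixes L :: "'a::euclidean_space \<Rightarrow> 'b::real_vector"
  assumes "linear L"
  shows "L v = (\<Sum>b\<in>Basis. (v \<bullet> b) *\<^sub>R L b)"
proof -
  have "L v = L (\<Sum>b\<in>Basis. (v \<bullet> b) *\<^sub>R b)" by (simp add: euclidean_representation)
  also have "\<dots> = (\<Sum>b\<in>Basis. (v \<bullet> b) *\<^sub>R L b)"
    using assms by (simp add: linear_sum linear_scale)
  finally show ?thesis .
qed

text \<open>The chain rule applies the derivative of \<open>g\<close> to a vector that moves with
  \<open>x\<close>, while \<open>Ck_on\<close> controls derivatives in fixed directions. Expanding
  that vector in the basis leaves products of scalar functions with fixed directional derivatives of
  \<open>g\<close>, composed with \<open>f\<close>.\<close>

lemma Ck_on_compose:
  fixes f :: "'a::euclidean_space \<Rightarrow> 'b::euclidean_space"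
  assumes "open S" "open T" "f ` S \<subseteq> T"
  shows "Ck_on n S f \<Longrightarrow> Ck_on n T g \<Longrightarrow> Ck_on n S (\<lambda>x. g (f x))"
proof (induction n arbitrary: g)
  case 0
  then show ?case using continuous_on_compose2[OF _ _ assms(3)] by simp
next
  case (Suc n)
  let ?f = "\<lambda>x. frechet_derivative f (at x)" and ?g = "\<lambda>x. frechet_derivative g (at x)"
  show ?case
  proof (rule Ck_on_SucI[OF assms(1)])
    fix x assume x: "x \<in> S"
    have g: "(g has_derivative ?g (f x)) (at (f x))"
      using Ck_on_SucD(1)[OF Suc.prems(2)] x assms(3) by blast
    have "((\<lambda>x. g (f x)) has_derivative (\<lambda>v. ?g (f x) (?f x v))) (at x)"
      using diff_chain_at[OF Ck_on_SucD(1)[OF Suc.prems(1) x] g] by (simp add: o_def)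
    moreover have "?g (f x) (?f x v) = (\<Sum>b\<in>Basis. (?f x v \<bullet> b) *\<^sub>R ?g (f x) b)" for v
      using has_derivative_linear[OF g] linear_basis_expand by blast
    ultimately show "((\<lambda>x. g (f x)) has_derivative (\<lambda>v. \<Sum>b\<in>Basis. (?f x v \<bullet> b) *\<^sub>R ?g (f x) b)) (at x)"
      by simp
  next
    show "Ck_on n S (\<lambda>x. \<Sum>b\<in>Basis. (?f x v \<bullet> b) *\<^sub>R ?g (f x) b)" for v
      by (intro Ck_on_sum Ck_on_scaleR Ck_on_inner_const assms(1) Suc.IH Ck_on_SucD(2) Suc.prems Ck_on_Suc_lower)
  qed
qed

lemma smooth_on_has_derivative:
  assumes "smooth_on S f" "x \<in> S"
  shows "(f has_derivative frechet_derivative f (at x)) (at x)"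
  using assms Ck_on_SucD(1) unfolding smooth_on_def by blast

lemma smooth_on_frechet_derivative:
  "smooth_on S f \<Longrightarrow> smooth_on S (\<lambda>x. frechet_derivative f (at x) v)"
  using Ck_on_SucD(2) unfolding smooth_on_def by blast

lemma smooth_on_compose:
  fixes f :: "'a::euclidean_space \<Rightarrow> 'b::euclidean_space"
  assumes "open S" "open T" "f ` S \<subseteq> T" "smooth_on S f" "smooth_on T g"
  shows "smooth_on S (\<lambda>x. g (f x))"
  using assms Ck_on_compose unfolding smooth_on_def by blast

lemma smooth_on_subset: "smooth_on S f \<Longrightarrow> T \<subseteq> S \<Longrightarrow> smooth_on T f"
  unfolding smooth_on_def by (blast intro: Ck_on_subset)

section \<open>Smooth solutions of linear systems\<close>

lemma Ck_on_le: "m \<le> n \<Longrightarrow> Ck_on n S f \<Longrightarrow> Ck_on m S f"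
proof (induction n rule: dec_induct)
  case (step n)
  show ?case by (rule step.IH[OF Ck_on_Suc_lower[OF step.prems]])
qed

text \<open>A common interface for the metric on a tangent space and for its coefficient form in a
  chart.\<close>

definition pos_def_form :: "('a::euclidean_space \<Rightarrow> 'a \<Rightarrow> real) \<Rightarrow> bool" where
  "pos_def_form G \<longleftrightarrow> bilinear G \<and> (\<forall>v w. G v w = G w v) \<and> (\<forall>v. v \<noteq> 0 \<longrightarrow> G v v > 0)"

context
  fixes G :: "'a::euclidean_space \<Rightarrow> 'a \<Rightarrow> real"
  assumes G: "pos_def_form G"
begin

lemma form_linear: "linear (G v)" "linear (\<lambda>v. G v w)"
  using G by (auto simp: pos_def_form_def bilinear_def)

lemma form_sym: "G v w = G w v"
  using G by (simp add: pos_def_form_def)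

lemma form_simps:
  "G (u + v) w = G u w + G v w" "G w (u + v) = G w u + G w v"
  "G (u - v) w = G u w - G v w" "G w (u - v) = G w u - G w v"
  "G (c *\<^sub>R v) w = c * G v w" "G w (c *\<^sub>R v) = c * G w v"
  "G 0 w = 0" "G w 0 = 0" "G (- v) w = - G v w" "G w (- v) = - G w v"
  using G unfolding pos_def_form_def
  by (simp_all add: bilinear_ladd bilinear_radd bilinear_lsub bilinear_rsub bilinear_lmul bilinear_rmul
      bilinear_lzero bilinear_rzero bilinear_lneg bilinear_rneg)

lemma form_eq_0_iff [simp]: "G v v = 0 \<longleftrightarrow> v = 0"
  using G form_simps(7) by (force simp: pos_def_form_def)

lemma form_nonneg: "G v v \<ge> 0"
  using G form_simps(7) by (cases "v = 0") (auto simp: pos_def_form_def intro: less_imp_le)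

lemma form_pos: "v \<noteq> 0 \<Longrightarrow> G v v > 0"
  using G by (auto simp: pos_def_form_def)

lemma form_eqI: "(\<And>w. G v w = G v' w) \<Longrightarrow> v = v'"
  using form_eq_0_iff[of "v - v'"] by (simp add: form_simps)

lemma form_expand: "G v w = (\<Sum>j\<in>Basis. (v \<bullet> j) * G j w)"
  using linear_basis_expand[OF form_linear(2), of v w] unfolding real_scaleR_def .

lemma form_basis_linear: "linear (\<lambda>v. \<Sum>b\<in>Basis. G v b *\<^sub>R b)"
  by (intro linearI) (simp_all add: form_simps scaleR_add_left sum.distrib scaleR_sum_right)

lemma form_basis_inj: "inj (\<lambda>v. \<Sum>b\<in>Basis. G v b *\<^sub>R b)"
proof (rule injI)
  fix v v' assume eq: "(\<Sum>b\<in>Basis. G v b *\<^sub>R b) = (\<Sum>b\<in>Basis. G v' b *\<^sub>R b)"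
  have "G v b = G v' b" if "b \<in> Basis" for b
    using arg_cong[OF eq, of "\<lambda>z. z \<bullet> b"] that by simp
  then have "G v w = G v' w" for w
    using linear_basis_expand[OF form_linear(1)[of v], of w] linear_basis_expand[OF form_linear(1)[of v'], of w]
    by simp
  then show "v = v'" by (rule form_eqI)
qed

text \<open>Finite-dimensional Riesz representation: the Gram map is injective by definiteness,
  hence surjective, and agreement on \<open>Basis\<close> extends by linearity.\<close>

lemma form_representation:
  assumes "linear \<beta>"
  obtains y where "\<And>w. G y w = \<beta> w"
proof -
  obtain y where y: "(\<Sum>b\<in>Basis. \<beta> b *\<^sub>R b) = (\<Sum>b\<in>Basis. G y b *\<^sub>R b)"
    using surjD[OF linear_injective_imp_surjective[OF form_basis_linear form_basis_inj refl]] by (rule exE)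
  have "G y b = \<beta> b" if "b \<in> Basis" for b
    using arg_cong[OF y, of "\<lambda>z. z \<bullet> b"] that by simp
  then have "G y w = \<beta> w" for w
    using linear_basis_expand[OF form_linear(1)[of y], of w] linear_basis_expand[OF assms, of w] by simp
  then show thesis by (rule that)
qed

text \<open>The \<open>e b\<close> are the images of the standard basis under a left inverse of the
  Gram map. They turn bounds and formulas for the pairings \<open>G y b\<close> into bounds and
  formulas for \<open>y\<close> itself.\<close>

lemma form_dual_basis: "\<exists>e. \<forall>y. y = (\<Sum>b\<in>Basis. G y b *\<^sub>R e b)"
proof -
  obtain g where g: "linear g" "g \<circ> (\<lambda>v. \<Sum>b\<in>Basis. G v b *\<^sub>R b) = id"
    using linear_injective_left_inverse[OF form_basis_linear form_basis_inj] by blast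
  have "y = (\<Sum>b\<in>Basis. G y b *\<^sub>R g b)" for y
    using fun_cong[OF g(2), of y] g(1) by (simp add: linear_sum linear_scale)
  then show ?thesis by (intro exI allI)
qed

end

text \<open>Continuity of \<open>c\<close> is enough: \<open>a\<close> is of first order at
  \<open>x\<close>, and a factor tending to 0 makes the product of higher order. In the
  differentiability proof below, \<open>c\<close> is a component of \<open>y x - y x0\<close>, so
  far known only to be continuous.\<close>

lemma has_derivative_mult_vanishing:
  fixes a :: "'a::real_normed_vector \<Rightarrow> real"
  assumes "(a has_derivative a') (at x)" "a x = 0" "isCont c x" "c x = 0"
  shows "((\<lambda>y. c y * a y) has_derivative (\<lambda>_. 0)) (at x)"
proof -
  interpret bounded_linear a' by (rule has_derivative_bounded_linear[OF assms(1)])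
  obtain K where K: "\<And>h. norm (a' h) \<le> norm h * K" using bounded by blast
  have 1: "(\<lambda>h. norm (a (x + h) - a x - a' h) / norm h) \<midarrow>0\<rightarrow> 0"
    using assms(1) by (simp add: has_derivative_at)
  have 2: "(\<lambda>h. \<bar>c (x + h)\<bar>) \<midarrow>0\<rightarrow> 0"
    using assms(3,4) by (simp add: isCont_iff tendsto_rabs_zero)
  have "(\<lambda>h. \<bar>c (x + h)\<bar> * (norm (a (x + h) - a x - a' h) / norm h + K)) \<midarrow>0\<rightarrow> 0 * (0 + K)"
    by (intro tendsto_intros 1 2)
  then have 3: "(\<lambda>h. \<bar>c (x + h)\<bar> * (norm (a (x + h) - a x - a' h) / norm h + K)) \<midarrow>0\<rightarrow> 0" by simp
  have "(\<lambda>h. norm (c (x + h) * a (x + h)) / norm h) \<midarrow>0\<rightarrow> 0"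
  proof (rule Lim_null_comparison[OF _ 3], rule always_eventually, rule allI)
    fix h
    show "norm (norm (c (x + h) * a (x + h)) / norm h) \<le> \<bar>c (x + h)\<bar> * (norm (a (x + h) - a x - a' h) / norm h + K)"
    proof (cases "h = 0")
      case True
      then show ?thesis using assms(4) by simp
    next
      case False
      have "\<bar>a (x + h)\<bar> \<le> norm (a (x + h) - a x - a' h) + norm h * K"
        using K[of h] assms(2) by simp
      then have "\<bar>a (x + h)\<bar> / norm h \<le> norm (a (x + h) - a x - a' h) / norm h + K"
        using False by (simp add: field_simps)
      from mult_left_mono[OF this, of "\<bar>c (x + h)\<bar>"] show ?thesis
        by (simp add: abs_mult)
    qed
  qed
  then show ?thesis using assms(2,4) by (simp add: has_derivative_at)
qed

context
  fixes G :: "'a::euclidean_space \<Rightarrow> 'b::euclidean_space \<Rightarrow> 'b \<Rightarrow> real" and S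
  assumes S: "open S" and G: "\<And>x. x \<in> S \<Longrightarrow> pos_def_form (G x)"
    and G_smooth: "\<And>v w. smooth_on S (\<lambda>x. G x v w)"
begin

text \<open>Frozen coefficients: at \<open>x0\<close> the pairings of \<open>y x - y x0\<close> are
  bounded by a small residual plus a small multiple of \<open>norm (y x - y x0)\<close>, and near
  \<open>x0\<close> this multiple is absorbed on the left.\<close>

lemma solution_isCont:
  assumes y: "\<And>x w. x \<in> S \<Longrightarrow> G x (y x) w = \<beta> x w" and \<beta>: "\<And>w. continuous_on S (\<lambda>x. \<beta> x w)"
    and x0: "x0 \<in> S"
  shows "isCont y x0"
proof -
  obtain e where "\<forall>z. z = (\<Sum>b\<in>Basis. G x0 z b *\<^sub>R e b)"
    using form_dual_basis[OF G[OF x0]] by (rule exE)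
  note e = spec[OF this]
  define K where "K = (\<Sum>b\<in>Basis. norm (e b))"
  have K0: "K \<ge> 0" by (simp add: K_def sum_nonneg)
  have K: "norm z \<le> K * (\<Sum>b\<in>Basis. \<bar>G x0 z b\<bar>)" for z
  proof -
    have "norm z \<le> (\<Sum>b\<in>Basis. norm (G x0 z b *\<^sub>R e b))"
      by (subst e) (rule norm_sum)
    also have "\<dots> \<le> (\<Sum>b\<in>Basis. (\<Sum>b\<in>Basis. \<bar>G x0 z b\<bar>) * norm (e b))"
      by (intro sum_mono) (auto intro!: mult_right_mono member_le_sum)
    finally show ?thesis by (simp only: K_def sum_distrib_left[symmetric] sum_distrib_right[symmetric] mult.commute)
  qed
  \<comment> \<open>\<open>E\<close> measures the oscillation of the coefficients around
    \<open>x0\<close>, \<open>R\<close> the residual of the old solution \<open>y x0\<close> in the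
    system at \<open>x\<close>; \<open>K\<close> converts pairings into norms.\<close>
  define E where "E x = K * (\<Sum>b\<in>Basis. \<Sum>j\<in>Basis. \<bar>G x j b - G x0 j b\<bar>)" for x
  define R where "R x = K * (\<Sum>b\<in>Basis. \<bar>\<beta> x b - G x (y x0) b\<bar>)" for x
  have cG: "isCont (\<lambda>x. G x v w) x0" for v w
    using smooth_on_has_derivative[OF G_smooth x0] has_derivative_continuous by blast
  have c\<beta>: "isCont (\<lambda>x. \<beta> x w) x0" for w
    using \<beta> S x0 by (simp add: continuous_on_eq_continuous_at)
  have "isCont E x0" "isCont R x0"
    unfolding E_def R_def by (intro continuous_intros cG c\<beta>)+
  moreover have "E x0 = 0" "R x0 = 0" using y[OF x0] by (simp_all add: E_def R_def)
  ultimately have E: "E \<midarrow>x0\<rightarrow> 0" and R: "R \<midarrow>x0\<rightarrow> 0" by (simp_all add: isCont_def)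
  have bound: "norm (y x - y x0) \<le> R x + E x * norm (y x - y x0)" if x: "x \<in> S" for x
  proof -
    let ?d = "y x - y x0"
    have "\<bar>G x0 ?d b\<bar> \<le> \<bar>\<beta> x b - G x (y x0) b\<bar> + norm ?d * (\<Sum>j\<in>Basis. \<bar>G x j b - G x0 j b\<bar>)" for b
    proof -
      have "G x0 ?d b = (\<beta> x b - G x (y x0) b) - (G x ?d b - G x0 ?d b)"
        using y[OF x] by (simp add: form_simps[OF G[OF x]])
      also have "G x ?d b - G x0 ?d b = (\<Sum>j\<in>Basis. (?d \<bullet> j) * (G x j b - G x0 j b))"
        by (simp add: form_expand[OF G[OF x], of ?d] form_expand[OF G[OF x0], of ?d]
            sum_subtractf right_diff_distrib)
      finally have "\<bar>G x0 ?d b\<bar> \<le> \<bar>\<beta> x b - G x (y x0) b\<bar> + \<bar>\<Sum>j\<in>Basis. (?d \<bullet> j) * (G x j b - G x0 j b)\<bar>"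
        by linarith
      moreover have "\<bar>\<Sum>j\<in>Basis. (?d \<bullet> j) * (G x j b - G x0 j b)\<bar> \<le> (\<Sum>j\<in>Basis. norm ?d * \<bar>G x j b - G x0 j b\<bar>)"
        by (rule order_trans[OF sum_abs]) (auto simp: abs_mult intro!: sum_mono mult_right_mono Basis_le_norm)
      ultimately show ?thesis by (simp add: sum_distrib_left)
    qed
    then have "(\<Sum>b\<in>Basis. \<bar>G x0 ?d b\<bar>) \<le>
        (\<Sum>b\<in>Basis. \<bar>\<beta> x b - G x (y x0) b\<bar> + norm ?d * (\<Sum>j\<in>Basis. \<bar>G x j b - G x0 j b\<bar>))"
      by (intro sum_mono)
    then have "K * (\<Sum>b\<in>Basis. \<bar>G x0 ?d b\<bar>) \<le> R x + E x * norm ?d"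
      using mult_left_mono[OF _ K0] by (fastforce simp: R_def E_def sum.distrib sum_distrib_left algebra_simps)
    with K[of ?d] show ?thesis by simp
  qed
  have "(\<lambda>x. y x - y x0) \<midarrow>x0\<rightarrow> 0"
  proof (rule Lim_null_comparison)
    show "(\<lambda>x. 2 * R x) \<midarrow>x0\<rightarrow> 0" using tendsto_mult_right_zero[OF R] by simp
    have "eventually (\<lambda>x. E x < 1/2) (at x0)" using E by (rule order_tendstoD) simp
    moreover have "eventually (\<lambda>x. x \<in> S) (at x0)" using S x0 by (rule eventually_at_in_open')
    ultimately show "eventually (\<lambda>x. norm (y x - y x0) \<le> 2 * R x) (at x0)"
    proof eventually_elim
      case (elim x)
      have "E x * norm (y x - y x0) \<le> 1/2 * norm (y x - y x0)"
        using elim(1) by (intro mult_right_mono) auto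
      with bound[OF elim(2)] show ?case by simp
    qed
  qed
  then show ?thesis using LIM_zero_cancel by (auto simp: isCont_def)
qed

text \<open>The system frozen at \<open>x0\<close> expresses \<open>y\<close> through differentiable
  data and the error terms \<open>?p\<close>, products of components of \<open>y x - y x0\<close>
  with coefficient increments. Such products have derivative 0 at \<open>x0\<close> by mere
  continuity of \<open>y\<close>.\<close>

lemma solution_differentiable:
  assumes y: "\<And>x w. x \<in> S \<Longrightarrow> G x (y x) w = \<beta> x w" and \<beta>: "\<And>w. Ck_on 1 S (\<lambda>x. \<beta> x w)"
    and x0: "x0 \<in> S"
  shows "y differentiable (at x0)"
proof -
  obtain e where "\<forall>z. z = (\<Sum>b\<in>Basis. G x0 z b *\<^sub>R e b)"
    using form_dual_basis[OF G[OF x0]] by (rule exE)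
  note e = spec[OF this]
  have c: "continuous_on S (\<lambda>x. \<beta> x w)" for w
    using Ck_on_le[OF le0 \<beta>, of w] unfolding Ck_on.simps(1) .
  have cy: "isCont y x0" by (rule solution_isCont[where \<beta> = \<beta>, OF y c x0])
  let ?p = "\<lambda>b j x. ((y x - y x0) \<bullet> j) * (G x j b - G x0 j b)"
  let ?q = "\<lambda>x. y x0 + (\<Sum>b\<in>Basis. (\<beta> x b - G x (y x0) b - (\<Sum>j\<in>Basis. ?p b j x)) *\<^sub>R e b)"
  have eq: "?q x = y x" if x: "x \<in> S" for x
  proof -
    let ?d = "y x - y x0"
    have "\<beta> x b - G x (y x0) b - (\<Sum>j\<in>Basis. ?p b j x) = G x0 ?d b" for b
    proof -
      have "(\<Sum>j\<in>Basis. ?p b j x) = G x ?d b - G x0 ?d b"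
        by (simp add: form_expand[OF G[OF x], of ?d] form_expand[OF G[OF x0], of ?d]
            sum_subtractf right_diff_distrib)
      then show ?thesis using y[OF x] by (simp add: form_simps[OF G[OF x]])
    qed
    then show ?thesis using e[of ?d] by simp
  qed
  have G': "((\<lambda>x. G x v w) has_derivative frechet_derivative (\<lambda>x. G x v w) (at x0)) (at x0)" for v w
    by (rule smooth_on_has_derivative[OF G_smooth x0])
  have p: "?p b j differentiable (at x0)" for b j
  proof -
    have "((\<lambda>x. G x j b - G x0 j b) has_derivative frechet_derivative (\<lambda>x. G x j b) (at x0)) (at x0)"
      by (rule derivative_eq_intros G' | simp)+
    moreover have "isCont (\<lambda>x. (y x - y x0) \<bullet> j) x0" by (intro continuous_intros cy)
    ultimately show ?thesis
      using has_derivative_mult_vanishing by (fastforce simp: differentiable_def)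
  qed
  have "\<And>b. (\<lambda>x. \<beta> x b) differentiable (at x0)" using \<beta> x0 by simp
  moreover have "\<And>v w. (\<lambda>x. G x v w) differentiable (at x0)" using G' by (auto simp: differentiable_def)
  ultimately have "?q differentiable (at x0)" using p
    by (intro derivative_intros differentiable_add differentiable_sum differentiable_diff differentiable_scaleR) auto
  then obtain D where "(?q has_derivative D) (at x0)" unfolding differentiable_def by (rule exE)
  then have "(y has_derivative D) (at x0)"
    by (rule has_derivative_transform_within_open[OF _ S x0 eq])
  then show ?thesis by (rule differentiableI)
qed

text \<open>Bootstrapping: differentiating the equation shows that the derivative of
  \<open>y\<close> solves a system with the same left-hand side, whose right-hand side contains
  \<open>y\<close> undifferentiated. The induction hypothesis is used for \<open>y\<close> and then
  for its derivative.\<close>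

lemma Ck_on_solution:
  assumes "\<And>x w. x \<in> S \<Longrightarrow> G x (y x) w = \<beta> x w" "\<And>w. Ck_on n S (\<lambda>x. \<beta> x w)"
  shows "Ck_on n S y"
  using assms
proof (induction n arbitrary: y \<beta>)
  case 0
  have "isCont y x" if "x \<in> S" for x
    by (rule solution_isCont[where \<beta> = \<beta>, OF 0(1) 0(2)[unfolded Ck_on.simps(1)] that])
  then show ?case by (simp add: continuous_at_imp_continuous_on)
next
  case (Suc n)
  let ?G' = "\<lambda>j w x. frechet_derivative (\<lambda>x. G x j w) (at x)"
  let ?\<beta>' = "\<lambda>w x. frechet_derivative (\<lambda>x. \<beta> x w) (at x)"
  let ?y' = "\<lambda>x. frechet_derivative y (at x)"
  have \<beta>1: "Ck_on 1 S (\<lambda>x. \<beta> x w)" for w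
    by (rule Ck_on_le[OF _ Suc.prems(2)]) simp
  have dy: "(y has_derivative ?y' x) (at x)" if "x \<in> S" for x
    using solution_differentiable[OF Suc.prems(1) \<beta>1 that] by (simp add: frechet_derivative_works)
  have yn: "Ck_on n S y" by (rule Suc.IH[OF Suc.prems(1) Ck_on_Suc_lower[OF Suc.prems(2)]])
  have eq: "G x (?y' x v) w = ?\<beta>' w x v - (\<Sum>j\<in>Basis. (y x \<bullet> j) * ?G' j w x v)" if x: "x \<in> S" for x v w
  proof -
    have "((\<lambda>x. \<Sum>j\<in>Basis. (y x \<bullet> j) * G x j w) has_derivative
        (\<lambda>v. \<Sum>j\<in>Basis. (y x \<bullet> j) * ?G' j w x v + (?y' x v \<bullet> j) * G x j w)) (at x)"
      by (intro has_derivative_sum has_derivative_mult has_derivative_inner_left dy[OF x]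
          smooth_on_has_derivative[OF G_smooth x])
    moreover have "((\<lambda>x. \<Sum>j\<in>Basis. (y x \<bullet> j) * G x j w) has_derivative ?\<beta>' w x) (at x)"
      by (rule has_derivative_transform_within_open[OF Ck_on_SucD(1)[OF Suc.prems(2) x] S x])
        (simp only: form_expand[OF G, symmetric] Suc.prems(1))
    ultimately have "(\<lambda>v. \<Sum>j\<in>Basis. (y x \<bullet> j) * ?G' j w x v + (?y' x v \<bullet> j) * G x j w) = ?\<beta>' w x"
      by (rule has_derivative_unique)
    from fun_cong[OF this, of v] have "?\<beta>' w x v = (\<Sum>j\<in>Basis. (y x \<bullet> j) * ?G' j w x v + (?y' x v \<bullet> j) * G x j w)" ..
    then show ?thesis by (simp add: sum.distrib form_expand[OF G[OF x], of "?y' x v"])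
  qed
  show ?case
  proof (rule Ck_on_SucI[OF S dy])
    fix v
    show "Ck_on n S (\<lambda>x. ?y' x v)"
    proof (rule Suc.IH)
      show "G x (?y' x v) w = ?\<beta>' w x v - (\<Sum>j\<in>Basis. (y x \<bullet> j) * ?G' j w x v)" if "x \<in> S" for x w
        by (rule eq[OF that])
      show "Ck_on n S (\<lambda>x. ?\<beta>' w x v - (\<Sum>j\<in>Basis. (y x \<bullet> j) * ?G' j w x v))" for w
        using smooth_on_frechet_derivative[OF G_smooth]
        by (intro Ck_on_diff Ck_on_sum Ck_on_mult Ck_on_inner_const S yn Ck_on_SucD(2)[OF Suc.prems(2)])
          (simp add: smooth_on_def)
    qed
  qed
qed

lemma smooth_on_solution:
  assumes "\<And>x w. x \<in> S \<Longrightarrow> G x (y x) w = \<beta> x w" "\<And>w. smooth_on S (\<lambda>x. \<beta> x w)"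
  shows "smooth_on S y"
  using Ck_on_solution[OF assms(1)] assms(2) by (auto simp: smooth_on_def)

end

section \<open>Ordinary differential equations, second derivatives, bump functions\<close>

lemma smooth_on_local_lipschitz:
  fixes f :: "'a::euclidean_space \<Rightarrow> 'b::euclidean_space"
  assumes "convex K" "compact K" "K \<subseteq> S" "smooth_on S f"
  obtains L where "L \<ge> 0" "\<And>x y. x \<in> K \<Longrightarrow> y \<in> K \<Longrightarrow> norm (f x - f y) \<le> L * norm (x - y)"
proof -
  let ?f = "\<lambda>x. frechet_derivative f (at x)"
  have d: "(f has_derivative ?f x) (at x within K)" if "x \<in> K" for x
    using smooth_on_has_derivative[OF assms(4)] that assms(3) has_derivative_at_withinI by blast
  have "continuous_on S (\<lambda>x. ?f x b)" for b
    using smooth_on_frechet_derivative[OF assms(4)] Ck_on.simps(1) unfolding smooth_on_def by blast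
  then have "continuous_on K (\<lambda>x. \<Sum>b\<in>Basis. norm (?f x b))"
    using assms(3) by (intro continuous_intros) (blast intro: continuous_on_subset)
  then have "bounded ((\<lambda>x. \<Sum>b\<in>Basis. norm (?f x b)) ` K)"
    by (rule compact_imp_bounded[OF compact_continuous_image[OF _ assms(2)]])
  then obtain L where "\<forall>y\<in>(\<lambda>x. \<Sum>b\<in>Basis. norm (?f x b)) ` K. norm y \<le> L"
    unfolding bounded_iff by (rule exE)
  then have L: "norm (\<Sum>b\<in>Basis. norm (?f x b)) \<le> L" if "x \<in> K" for x
    using imageI[OF that] by (rule bspec)
  have L': "onorm (?f x) \<le> max L 0" if "x \<in> K" for x
  proof (rule onorm_le)
    fix v
    have "?f x v = (\<Sum>b\<in>Basis. (v \<bullet> b) *\<^sub>R ?f x b)"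
      by (rule linear_basis_expand[OF has_derivative_linear[OF d[OF that]]])
    then have "norm (?f x v) \<le> (\<Sum>b\<in>Basis. norm v * norm (?f x b))"
      by (auto intro!: sum_norm_le mult_right_mono Basis_le_norm)
    also have "\<dots> = norm v * (\<Sum>b\<in>Basis. norm (?f x b))" by (simp add: sum_distrib_left)
    also have "\<dots> \<le> norm v * max L 0" using L[OF that] by (intro mult_left_mono) auto
    finally show "norm (?f x v) \<le> max L 0 * norm v" by (simp add: mult.commute)
  qed
  show thesis
    by (rule that[of "max L 0"]) (use differentiable_bound[OF assms(1) d L'] in auto)
qed

text \<open>The vector field is precomposed with the nearest-point retraction onto a small ball, which makes
  it globally Lipschitz and bounded; the Picard operator then is a contraction of the whole space of
  bounded continuous curves.\<close>

lemma ode_local_solution: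
  fixes f :: "'a::euclidean_space \<Rightarrow> 'a"
  assumes "open S" "z0 \<in> S" "smooth_on S f"
  obtains e z where "e > 0" "z 0 = z0"
    "\<And>t. t \<in> {-e<..<e} \<Longrightarrow> z t \<in> S \<and> (z has_vector_derivative f (z t)) (at t)"
proof -
  obtain r where r: "r > 0" "cball z0 r \<subseteq> S"
    using assms(1,2) open_contains_cball by blast
  let ?K = "cball z0 r"
  obtain L where L: "L \<ge> 0" "\<And>x y. x \<in> ?K \<Longrightarrow> y \<in> ?K \<Longrightarrow> norm (f x - f y) \<le> L * norm (x - y)"
    using smooth_on_local_lipschitz[OF convex_cball compact_cball r(2) assms(3)] by blast
  define F where "F x = f (closest_point ?K x)" for x
  have cpK: "closest_point ?K x \<in> ?K" for x using r(1) by (intro closest_point_in_set) auto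
  have FL: "norm (F x - F y) \<le> L * norm (x - y)" for x y
  proof -
    have "norm (F x - F y) \<le> L * norm (closest_point ?K x - closest_point ?K y)"
      unfolding F_def by (rule L(2)[OF cpK cpK])
    also have "\<dots> \<le> L * norm (x - y)"
      using closest_point_lipschitz[of ?K x y] r(1) L(1) by (intro mult_left_mono) (auto simp: dist_norm)
    finally show ?thesis .
  qed
  define B where "B = norm (f z0) + L * r"
  have B0: "B \<ge> 0" using L(1) r(1) by (simp add: B_def)
  have FB: "norm (F x) \<le> B" for x
  proof -
    have "norm (f (closest_point ?K x) - f z0) \<le> L * norm (closest_point ?K x - z0)"
      using L(2)[OF cpK] r(1) by simp
    also have "\<dots> \<le> L * r" using cpK[of x] L(1) by (intro mult_left_mono) (auto simp: dist_norm norm_minus_commute)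
    finally show ?thesis
      using norm_triangle_sub[of "f (closest_point ?K x)" "f z0"] unfolding F_def B_def by linarith
  qed
  have contF: "continuous_on UNIV F"
    using L(1) FL by (intro lipschitz_on_continuous_on[of L] lipschitz_onI) (auto simp: dist_norm)
  \<comment> \<open>The operator below contains two integrals over intervals of length at most
    \<open>2 * e\<close>, hence the factor 4: the first bound makes it a contraction with constant
    1/2, the second keeps its fixed point within distance \<open>r\<close> of \<open>z0\<close>.
    Adding 1 to \<open>L\<close> and \<open>B\<close> avoids division by 0.\<close>
  define e where "e = min (1 / (8 * (L + 1))) (r / (4 * (B + 1)))"
  have e0: "e > 0" using L(1) B0 r(1) by (simp add: e_def)
  have eL: "4 * e * L \<le> 1/2"
  proof -
    have "e * (8 * (L + 1)) \<le> 1" using L(1) by (simp add: e_def min_le_iff_disj pos_le_divide_eq[symmetric])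
    then show ?thesis using e0 by (simp add: algebra_simps)
  qed
  have eB: "4 * e * B \<le> r"
  proof -
    have "e * (4 * (B + 1)) \<le> r" using B0 by (simp add: e_def min_le_iff_disj pos_le_divide_eq[symmetric])
    then show ?thesis using e0 by (simp add: algebra_simps)
  qed
  have zero: "0 \<in> {-e..e}" using e0 by simp
  \<comment> \<open>Bounded continuous functions live on all of \<open>real\<close>, so time is
    clamped to \<open>{-e..e}\<close>.\<close>
  define cl where "cl t = max (-e) (min e t)" for t :: real
  have cl: "cl t \<in> {-e..e}" for t using e0 by (auto simp: cl_def)
  have cl_id: "cl t = t" if "t \<in> {-e..e}" for t using that by (auto simp: cl_def)
  have contcl: "continuous_on UNIV cl" unfolding cl_def by (intro continuous_intros)
  \<comment> \<open>Integration starts at \<open>-e\<close> because the integral over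
    \<open>{a..b}\<close> is 0 when \<open>b < a\<close>; subtracting \<open>J y 0\<close> later
    moves the base point to time 0.\<close>
  define J where "J y s = integral {-e..s} (\<lambda>t. F (apply_bcontfun y t))" for y s
  have cFy: "continuous_on T (\<lambda>t. F (apply_bcontfun y t))" for T and y :: "real \<Rightarrow>\<^sub>C 'a"
    by (rule continuous_on_compose2[OF contF]) auto
  have J_bound: "norm (J y s - J w s) \<le> 2 * e * (L * dist y w)" if "s \<in> {-e..e}" for y w s
  proof -
    have "J y s - J w s = integral {-e..s} (\<lambda>t. F (apply_bcontfun y t) - F (apply_bcontfun w t))"
      unfolding J_def by (intro integral_diff[symmetric] integrable_continuous_real cFy)
    moreover have "norm (integral {-e..s} (\<lambda>t. F (apply_bcontfun y t) - F (apply_bcontfun w t))) \<le> (L * dist y w) * (s - (-e))"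
    proof (rule integral_bound)
      fix t
      have "norm (F (apply_bcontfun y t) - F (apply_bcontfun w t)) \<le> L * dist (apply_bcontfun y t) (apply_bcontfun w t)"
        using FL by (simp add: dist_norm)
      also have "\<dots> \<le> L * dist y w" by (intro mult_left_mono dist_bounded L(1))
      finally show "norm (F (apply_bcontfun y t) - F (apply_bcontfun w t)) \<le> L * dist y w" .
    qed (use that in \<open>auto intro!: continuous_intros cFy\<close>)
    moreover have "(L * dist y w) * (s - (-e)) \<le> (L * dist y w) * (2 * e)"
      using that L(1) by (intro mult_left_mono) auto
    ultimately show ?thesis by (simp add: mult_ac)
  qed
  have J_bound': "norm (J y s) \<le> 2 * e * B" if "s \<in> {-e..e}" for y s
  proof -
    have "norm (J y s) \<le> B * (s - (-e))"
      unfolding J_def by (rule integral_bound) (use that FB in \<open>auto intro!: cFy\<close>)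
    also have "\<dots> \<le> B * (2 * e)" using that B0 by (intro mult_left_mono) auto
    finally show ?thesis by (simp add: mult_ac)
  qed
  define \<Phi> where "\<Phi> y = Bcontfun (\<lambda>t. z0 + J y (cl t) - J y 0)" for y
  have \<Phi>: "apply_bcontfun (\<Phi> y) t = z0 + J y (cl t) - J y 0" for y t
  proof -
    have "continuous_on {-e..e} (J y)"
      unfolding J_def by (intro indefinite_integral_continuous_1 integrable_continuous_real cFy)
    then have c: "continuous_on UNIV (\<lambda>t. z0 + J y (cl t) - J y 0)"
      by (intro continuous_intros continuous_on_compose2[OF _ contcl]) (use cl in auto)
    moreover have "bounded (range (\<lambda>t. z0 + J y (cl t) - J y 0))"
      unfolding bounded_iff
    proof (intro exI ballI)
      fix x assume "x \<in> range (\<lambda>t. z0 + J y (cl t) - J y 0)"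
      then obtain t where x: "x = z0 + J y (cl t) - J y 0" by blast
      have "norm x \<le> norm z0 + norm (J y (cl t)) + norm (J y 0)"
        unfolding x using norm_triangle_ineq4[of "z0 + J y (cl t)" "J y 0"] norm_triangle_ineq[of z0 "J y (cl t)"] by linarith
      then show "norm x \<le> norm z0 + 2 * e * B + 2 * e * B"
        using J_bound'[OF cl, of y t] J_bound'[OF zero, of y] by linarith
    qed
    ultimately show ?thesis unfolding \<Phi>_def by (simp add: bcontfun_def Bcontfun_inverse)
  qed
  have "dist (\<Phi> y) (\<Phi> w) \<le> 1/2 * dist y w" for y w
  proof (rule dist_bound)
    fix t
    have "dist (apply_bcontfun (\<Phi> y) t) (apply_bcontfun (\<Phi> w) t) = norm ((J y (cl t) - J w (cl t)) - (J y 0 - J w 0))"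
      unfolding \<Phi> dist_norm by (simp add: algebra_simps)
    also have "\<dots> \<le> norm (J y (cl t) - J w (cl t)) + norm (J y 0 - J w 0)" by (rule norm_triangle_ineq4)
    also have "\<dots> \<le> 2 * e * (L * dist y w) + 2 * e * (L * dist y w)"
      using e0 by (intro add_mono J_bound cl) auto
    also have "\<dots> = (4 * e * L) * dist y w" by simp
    also have "\<dots> \<le> 1/2 * dist y w" using eL by (intro mult_right_mono) auto
    finally show "dist (apply_bcontfun (\<Phi> y) t) (apply_bcontfun (\<Phi> w) t) \<le> 1/2 * dist y w" .
  qed
  then obtain y where y: "\<Phi> y = y"
    using banach_fix_type[of "1/2" \<Phi>] by auto
  have yt: "apply_bcontfun y t = z0 + J y (cl t) - J y 0" for t
    using \<Phi>[of y t] y by simp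
  show thesis
  proof (rule that[OF e0])
    show "apply_bcontfun y 0 = z0" using e0 by (simp add: yt cl_id)
    fix t assume t: "t \<in> {-e<..<e}"
    have "norm (apply_bcontfun y t - z0) \<le> norm (J y (cl t)) + norm (J y 0)"
      unfolding yt[of t] using norm_triangle_ineq4[of "J y (cl t)" "J y 0"] by simp
    also have "\<dots> \<le> 2 * e * B + 2 * e * B" using e0 by (intro add_mono J_bound' cl) auto
    also have "\<dots> \<le> r" using eB by argo
    finally have yK: "apply_bcontfun y t \<in> ?K" by (simp add: dist_norm norm_minus_commute)
    then have Fy: "F (apply_bcontfun y t) = f (apply_bcontfun y t)" by (simp add: F_def closest_point_self)
    have "(J y has_vector_derivative F (apply_bcontfun y t)) (at t within {-e..e})"
      unfolding J_def by (rule integral_has_vector_derivative[OF cFy]) (use t in auto)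
    then have "(J y has_vector_derivative F (apply_bcontfun y t)) (at t)"
      using t by (simp add: at_within_Icc_at)
    then have "((\<lambda>t. z0 + J y t - J y 0) has_vector_derivative F (apply_bcontfun y t)) (at t)"
      by (auto intro!: derivative_eq_intros)
    then have "(apply_bcontfun y has_vector_derivative F (apply_bcontfun y t)) (at t)"
      by (rule has_vector_derivative_transform_within_open[OF _ open_greaterThanLessThan t]) (simp add: yt cl_id)
    then show "apply_bcontfun y t \<in> S \<and> (apply_bcontfun y has_vector_derivative f (apply_bcontfun y t)) (at t)"
      using yK r(2) Fy by auto
  qed
qed

section \<open>Symmetry of second derivatives\<close>

lemma has_real_derivative_along_line:
  fixes g :: "'a::real_normed_vector \<Rightarrow> real"
  assumes "(g has_derivative g') (at (w + s *\<^sub>R u))"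
  shows "((\<lambda>s. g (w + s *\<^sub>R u)) has_real_derivative g' u) (at s)"
proof -
  have l: "((\<lambda>s. w + s *\<^sub>R u) has_derivative (\<lambda>h. h *\<^sub>R u)) (at s)"
    by (auto intro!: derivative_eq_intros)
  have "((\<lambda>s. g (w + s *\<^sub>R u)) has_derivative (\<lambda>h. g' (h *\<^sub>R u))) (at s)"
    by (rule has_derivative_compose[OF l assms])
  then show ?thesis
    using linear_scale[OF has_derivative_linear[OF assms], of _ u] by (simp add: has_field_derivative_def mult_commute_abs)
qed

text \<open>The mean value theorem, applied in direction \<open>u\<close> to a difference in
  direction \<open>v\<close> and then in direction \<open>v\<close>, turns the second difference
  into one mixed derivative at an intermediate point.\<close>

lemma second_difference_mvt:
  fixes g :: "'a::euclidean_space \<Rightarrow> real"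
  assumes g: "Ck_on 2 S g" and h: "h > 0"
    and S: "\<And>s t. 0 \<le> s \<Longrightarrow> s \<le> h \<Longrightarrow> 0 \<le> t \<Longrightarrow> t \<le> h \<Longrightarrow> x + s *\<^sub>R u + t *\<^sub>R v \<in> S"
  obtains s t where "0 < s" "s < h" "0 < t" "t < h"
    "g (x + h *\<^sub>R u + h *\<^sub>R v) - g (x + h *\<^sub>R u) - g (x + h *\<^sub>R v) + g x =
      h\<^sup>2 * frechet_derivative (\<lambda>y. frechet_derivative g (at y) u) (at (x + s *\<^sub>R u + t *\<^sub>R v)) v"
proof -
  have g2: "Ck_on (Suc (Suc 0)) S g" using g by (simp add: numeral_2_eq_2)
  let ?g = "\<lambda>y. frechet_derivative g (at y) u"
  have d1: "((\<lambda>s. g (x + s *\<^sub>R u + t *\<^sub>R v)) has_real_derivative ?g (x + s *\<^sub>R u + t *\<^sub>R v)) (at s)"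
    if "0 \<le> s" "s \<le> h" "0 \<le> t" "t \<le> h" for s t
    using has_real_derivative_along_line[of g _ "x + t *\<^sub>R v" s u] Ck_on_SucD(1)[OF g2 S[OF that]]
    by (simp add: add_ac)
  have d2: "((\<lambda>t. ?g (x + s *\<^sub>R u + t *\<^sub>R v)) has_real_derivative
      frechet_derivative ?g (at (x + s *\<^sub>R u + t *\<^sub>R v)) v) (at t)"
    if "0 \<le> s" "s \<le> h" "0 \<le> t" "t \<le> h" for s t
    by (rule has_real_derivative_along_line[OF Ck_on_SucD(1)[OF Ck_on_SucD(2)[OF g2] S[OF that]]])
  have "((\<lambda>s. g (x + s *\<^sub>R u + h *\<^sub>R v) - g (x + s *\<^sub>R u)) has_real_derivative
      (?g (x + s *\<^sub>R u + h *\<^sub>R v) - ?g (x + s *\<^sub>R u))) (at s)" if "0 \<le> s" "s \<le> h" for s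
    using DERIV_diff[OF d1[OF that, of h] d1[OF that, of 0]] h by simp
  then obtain s where s: "0 < s" "s < h"
    "(g (x + h *\<^sub>R u + h *\<^sub>R v) - g (x + h *\<^sub>R u)) - (g (x + h *\<^sub>R v) - g x) =
       h * (?g (x + s *\<^sub>R u + h *\<^sub>R v) - ?g (x + s *\<^sub>R u))"
    using MVT2[OF h, of "\<lambda>s. g (x + s *\<^sub>R u + h *\<^sub>R v) - g (x + s *\<^sub>R u)"
        "\<lambda>s. ?g (x + s *\<^sub>R u + h *\<^sub>R v) - ?g (x + s *\<^sub>R u)"] by auto
  obtain t where t: "0 < t" "t < h"
    "?g (x + s *\<^sub>R u + h *\<^sub>R v) - ?g (x + s *\<^sub>R u) = h * frechet_derivative ?g (at (x + s *\<^sub>R u + t *\<^sub>R v)) v"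
    using MVT2[OF h d2[of s]] s(1,2) by auto
  show thesis
    by (rule that[OF s(1,2) t(1,2)]) (use s(3) t(3) in \<open>simp add: power2_eq_square algebra_simps\<close>)
qed

lemma frechet_derivative_inner:
  assumes "f differentiable (at x)"
  shows "frechet_derivative (\<lambda>x. f x \<bullet> b) (at x) v = frechet_derivative f (at x) v \<bullet> b"
proof -
  have "((\<lambda>x. f x \<bullet> b) has_derivative (\<lambda>v. frechet_derivative f (at x) v \<bullet> b)) (at x)"
    using assms by (intro has_derivative_inner_left) (simp add: frechet_derivative_works)
  from frechet_derivative_at[OF this] show ?thesis by metis
qed

text \<open>The second difference does not change when \<open>u\<close> and \<open>v\<close> are
  exchanged, so the two mixed derivatives take a common value at points arbitrarily close to
  \<open>x\<close>; continuity carries this to \<open>x\<close>.\<close>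

lemma second_derivative_symmetric_real:
  fixes g :: "'a::euclidean_space \<Rightarrow> real"
  assumes S: "open S" "x \<in> S" and g: "Ck_on 2 S g"
  shows "frechet_derivative (\<lambda>y. frechet_derivative g (at y) u) (at x) v =
    frechet_derivative (\<lambda>y. frechet_derivative g (at y) v) (at x) u" (is "?A x = ?B x")
proof (rule ccontr)
  assume ne: "?A x \<noteq> ?B x"
  have g2: "Ck_on (Suc (Suc 0)) S g" using g by (simp add: numeral_2_eq_2)
  define e where "e = \<bar>?A x - ?B x\<bar> / 2"
  have e: "e > 0" using ne by (simp add: e_def)
  have cont: "isCont (\<lambda>x. frechet_derivative (\<lambda>y. frechet_derivative g (at y) u) (at x) v) x" for u v
    using Ck_on_SucD(2)[OF Ck_on_SucD(2)[OF g2]] S by (auto simp: continuous_on_eq_continuous_at)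
  obtain d1 where d1: "d1 > 0" "\<And>y. dist y x < d1 \<Longrightarrow> dist (?A y) (?A x) < e"
    using cont[of u v] e unfolding continuous_at_eps_delta by blast
  obtain d2 where d2: "d2 > 0" "\<And>y. dist y x < d2 \<Longrightarrow> dist (?B y) (?B x) < e"
    using cont[of v u] e unfolding continuous_at_eps_delta by blast
  obtain d3 where d3: "d3 > 0" "\<And>y. dist y x < d3 \<Longrightarrow> y \<in> S"
    using S open_dist by blast
  define d where "d = min d1 (min d2 d3)"
  have d0: "d > 0" using d1 d2 d3 by (simp add: d_def)
  \<comment> \<open>Chosen so that the parallelogram spanned by \<open>h *\<^sub>R u\<close> and
    \<open>h *\<^sub>R v\<close> at \<open>x\<close> stays within distance \<open>d\<close>; the 1
    covers \<open>u = v = 0\<close>.\<close>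
  define h where "h = d / (2 * (norm u + norm v + 1))"
  have nuv: "norm u + norm v + 1 > 0" by (simp add: add_nonneg_pos)
  have h: "h > 0" using d0 nuv by (simp add: h_def)
  have close: "dist (x + s *\<^sub>R u + t *\<^sub>R v) x < d" if "0 \<le> s" "s \<le> h" "0 \<le> t" "t \<le> h" for s t
  proof -
    have "dist (x + s *\<^sub>R u + t *\<^sub>R v) x = norm (s *\<^sub>R u + t *\<^sub>R v)" by (simp add: dist_norm)
    also have "\<dots> \<le> s * norm u + t * norm v" using norm_triangle_ineq[of "s *\<^sub>R u" "t *\<^sub>R v"] that by simp
    also have "\<dots> \<le> h * norm u + h * norm v" using that by (intro add_mono mult_right_mono) auto
    also have "\<dots> < h * (2 * (norm u + norm v + 1))" using h nuv by (simp add: algebra_simps add_nonneg_pos add_strict_increasing)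
    also have "\<dots> = d" using nuv by (simp add: h_def)
    finally show ?thesis .
  qed
  have "x + s *\<^sub>R u + t *\<^sub>R v \<in> S" if "0 \<le> s" "s \<le> h" "0 \<le> t" "t \<le> h" for s t
    using close[OF that] by (intro d3(2)) (simp add: d_def)
  then obtain s t where st: "0 < s" "s < h" "0 < t" "t < h"
    "g (x + h *\<^sub>R u + h *\<^sub>R v) - g (x + h *\<^sub>R u) - g (x + h *\<^sub>R v) + g x = h\<^sup>2 * ?A (x + s *\<^sub>R u + t *\<^sub>R v)"
    using second_difference_mvt[OF g h] by blast
  have "x + s *\<^sub>R v + t *\<^sub>R u \<in> S" if "0 \<le> s" "s \<le> h" "0 \<le> t" "t \<le> h" for s t
    using close[OF that(3,4,1,2)] by (intro d3(2)) (simp add: d_def add_ac)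
  then obtain s' t' where st': "0 < s'" "s' < h" "0 < t'" "t' < h"
    "g (x + h *\<^sub>R v + h *\<^sub>R u) - g (x + h *\<^sub>R v) - g (x + h *\<^sub>R u) + g x = h\<^sup>2 * ?B (x + s' *\<^sub>R v + t' *\<^sub>R u)"
    using second_difference_mvt[OF g h] by blast
  have "h\<^sup>2 * ?A (x + s *\<^sub>R u + t *\<^sub>R v) = h\<^sup>2 * ?B (x + s' *\<^sub>R v + t' *\<^sub>R u)"
    using st(5) st'(5) by (simp add: algebra_simps)
  then have eq: "?A (x + s *\<^sub>R u + t *\<^sub>R v) = ?B (x + s' *\<^sub>R v + t' *\<^sub>R u)" using h by simp
  have "dist (?A (x + s *\<^sub>R u + t *\<^sub>R v)) (?A x) < e"
    using close[of s t] st by (intro d1(2)) (simp add: d_def)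
  moreover have "dist (?B (x + s' *\<^sub>R v + t' *\<^sub>R u)) (?B x) < e"
    using close[of t' s'] st' by (intro d2(2)) (simp add: d_def add_ac)
  ultimately have "dist (?A x) (?B x) < 2 * e"
    using dist_triangle3[of "?A x" "?B x" "?B (x + s' *\<^sub>R v + t' *\<^sub>R u)"] unfolding eq by linarith
  then show False by (simp add: e_def dist_real_def)
qed

lemma second_derivative_symmetric:
  fixes f :: "'a::euclidean_space \<Rightarrow> 'b::euclidean_space"
  assumes S: "open S" "x \<in> S" and f: "smooth_on S f"
  shows "frechet_derivative (\<lambda>y. frechet_derivative f (at y) u) (at x) v =
    frechet_derivative (\<lambda>y. frechet_derivative f (at y) v) (at x) u"
proof (rule euclidean_eqI)
  fix b :: 'b
  have d1: "f differentiable (at y)" if "y \<in> S" for y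
    using smooth_on_has_derivative[OF f that] by (rule differentiableI)
  have d2: "(\<lambda>y. frechet_derivative f (at y) u) differentiable (at x)" for u
    using smooth_on_has_derivative[OF smooth_on_frechet_derivative[OF f] S(2)] by (rule differentiableI)
  have *: "frechet_derivative (\<lambda>y. frechet_derivative (\<lambda>x. f x \<bullet> b) (at y) u) (at x) v =
      frechet_derivative (\<lambda>y. frechet_derivative f (at y) u) (at x) v \<bullet> b" for u v
  proof -
    have "((\<lambda>y. frechet_derivative f (at y) u \<bullet> b) has_derivative
        (\<lambda>v. frechet_derivative (\<lambda>y. frechet_derivative f (at y) u) (at x) v \<bullet> b)) (at x)"
      using d2 by (intro has_derivative_inner_left) (simp add: frechet_derivative_works)
    then have "((\<lambda>y. frechet_derivative (\<lambda>x. f x \<bullet> b) (at y) u) has_derivative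
        (\<lambda>v. frechet_derivative (\<lambda>y. frechet_derivative f (at y) u) (at x) v \<bullet> b)) (at x)"
      by (rule has_derivative_transform_within_open[OF _ S]) (simp add: frechet_derivative_inner d1)
    from frechet_derivative_at[OF this] show ?thesis by metis
  qed
  have "Ck_on 2 S (\<lambda>x. f x \<bullet> b)" using f by (intro Ck_on_inner_const S) (simp add: smooth_on_def)
  from second_derivative_symmetric_real[OF S this, of u v]
  show "frechet_derivative (\<lambda>y. frechet_derivative f (at y) u) (at x) v \<bullet> b =
    frechet_derivative (\<lambda>y. frechet_derivative f (at y) v) (at x) u \<bullet> b" unfolding * .
qed

section \<open>Flat exponentials and bump functions\<close>

definition flat_exp :: "nat \<Rightarrow> real \<Rightarrow> real" where
  "flat_exp k t = (if t > 0 then exp (- 1 / t) / t ^ k else 0)"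

text \<open>The powers of \<open>t\<close> in the denominator close the family under differentiation
  up to linear combinations, so one induction for all \<open>k\<close> gives smoothness. The only
  limit to be computed is at 0, from the right.\<close>

lemma flat_exp_derivative:
  "(flat_exp k has_real_derivative flat_exp (k + 2) t - real k * flat_exp (k + 1) t) (at t)"
proof (cases t "0 :: real" rule: linorder_cases)
  case less
  have "((\<lambda>t. 0) has_real_derivative 0) (at t)" by simp
  then have "(flat_exp k has_real_derivative 0) (at t)"
    by (rule has_field_derivative_transform_within_open[of _ _ _ "{..<0}"]) (use less in \<open>auto simp: flat_exp_def\<close>)
  then show ?thesis using less by (simp add: flat_exp_def)
next
  case greater
  have "((\<lambda>t. exp (- 1 / t) / t ^ k) has_real_derivative
      exp (- 1 / t) / t ^ (k + 2) - real k * (exp (- 1 / t) / t ^ (k + 1))) (at t)"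
    using greater by (auto intro!: derivative_eq_intros simp: field_simps power_add power2_eq_square)
      (cases k; simp add: field_simps)+
  then have "(flat_exp k has_real_derivative
      exp (- 1 / t) / t ^ (k + 2) - real k * (exp (- 1 / t) / t ^ (k + 1))) (at t)"
    by (rule has_field_derivative_transform_within_open[of _ _ _ "{0<..}"]) (use greater in \<open>auto simp: flat_exp_def\<close>)
  then show ?thesis using greater by (simp add: flat_exp_def)
next
  case equal
  \<comment> \<open>With \<open>s = inverse h\<close> the difference quotient at 0 is
    \<open>s ^ (k + 1) / exp s\<close>, and the exponential dominates the power.\<close>
  have "((\<lambda>h. (inverse h) ^ (k + 1) / exp (inverse h)) \<longlongrightarrow> (0::real)) (at_right 0)"
    by (rule filterlim_compose[OF tendsto_power_div_exp_0 filterlim_inverse_at_top_right])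
  moreover have "eventually (\<lambda>h. (inverse h) ^ (k + 1) / exp (inverse h) = (flat_exp k (0 + h) - flat_exp k 0) / h) (at_right (0::real))"
    unfolding eventually_at_right_field
    by (rule exI[of _ 1]) (auto simp: flat_exp_def field_simps exp_minus)
  ultimately have "((\<lambda>h. (flat_exp k (0 + h) - flat_exp k 0) / h) \<longlongrightarrow> 0) (at_right 0)"
    by (rule Lim_transform_eventually)
  moreover have "((\<lambda>h. (flat_exp k (0 + h) - flat_exp k 0) / h) \<longlongrightarrow> 0) (at_left 0)"
    by (rule tendsto_eventually) (auto simp: eventually_at_left_field flat_exp_def intro!: exI[of _ "-1"])
  ultimately have "(flat_exp k has_real_derivative 0) (at 0)"
    unfolding DERIV_def by (rule filterlim_split_at[rotated])
  then show ?thesis using equal by (simp add: flat_exp_def)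
qed

lemma flat_exp_Ck: "Ck_on n UNIV (flat_exp k)"
proof (induction n arbitrary: k)
  case 0
  show ?case
    using DERIV_isCont[OF flat_exp_derivative] by (simp add: continuous_at_imp_continuous_on)
next
  case (Suc n)
  show ?case
  proof (rule Ck_on_SucI[OF open_UNIV])
    show "(flat_exp k has_derivative (\<lambda>v. (flat_exp (k + 2) t - real k * flat_exp (k + 1) t) * v)) (at t)" for t
      using flat_exp_derivative by (simp add: has_field_derivative_def)
    show "Ck_on n UNIV (\<lambda>t. (flat_exp (k + 2) t - real k * flat_exp (k + 1) t) * v)" for v
      by (intro Ck_on_mult Ck_on_diff Ck_on_const Suc.IH open_UNIV)
  qed
qed

text \<open>\<open>flat_exp 0\<close> of \<open>r\<^sup>2\<close> minus the squared distance
  vanishes off the ball; dividing by its value at the centre normalises it.\<close>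

lemma smooth_bump:
  fixes x0 :: "'a::euclidean_space"
  assumes "r > 0"
  obtains \<rho> :: "'a \<Rightarrow> real" where "smooth_on UNIV \<rho>" "\<rho> x0 = 1" "\<And>x. x \<notin> cball x0 r \<Longrightarrow> \<rho> x = 0"
proof -
  let ?q = "\<lambda>x. r\<^sup>2 - (x - x0) \<bullet> (x - x0)"
  have "Ck_on n UNIV ?q" for n
    by (intro Ck_on_diff Ck_on_const Ck_on_bilinear[OF _ bounded_bilinear_inner] Ck_on_id open_UNIV)
  then have "Ck_on n UNIV (\<lambda>x. flat_exp 0 (?q x) / exp (- 1 / r\<^sup>2))" for n
    unfolding divide_inverse
    by (intro Ck_on_mult Ck_on_const Ck_on_compose[OF _ _ _ _ flat_exp_Ck] open_UNIV) auto
  then have "smooth_on UNIV (\<lambda>x. flat_exp 0 (?q x) / exp (- 1 / r\<^sup>2))" by (simp add: smooth_on_def)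
  moreover have "flat_exp 0 (?q x0) / exp (- 1 / r\<^sup>2) = 1" using assms by (simp add: flat_exp_def)
  moreover have "flat_exp 0 (?q x) / exp (- 1 / r\<^sup>2) = 0" if "x \<notin> cball x0 r" for x
  proof -
    have "r < norm (x - x0)" using that by (simp add: dist_norm norm_minus_commute)
    then have "r\<^sup>2 \<le> (norm (x - x0))\<^sup>2" using assms by (intro power_mono) auto
    then show ?thesis by (simp add: flat_exp_def power2_norm_eq_inner)
  qed
  ultimately show thesis by (rule that)
qed

section \<open>Charts and Christoffel symbols\<close>

locale manifold_setup =
  fixes M :: "('m::{t2_space,second_countable_topology}, 'a::euclidean_space) manifold"
  assumes smooth_manifold: "smooth_manifold M"
begin

abbreviation cimg :: "('m, 'a) chart \<Rightarrow> 'a set" where "cimg c \<equiv> cmap c ` cdom c"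

lemma chart_at: "chart_at M p \<in> atlas M" "p \<in> cdom (chart_at M p)"
  using smooth_manifold by (auto simp: smooth_manifold_def)

lemma chart_homeomorphism:
  assumes "c \<in> atlas M"
  shows "open (cdom c)" "open (cimg c)" "homeomorphism (cdom c) (cimg c) (cmap c) (cinv c)"
  using assms smooth_manifold by (auto simp: smooth_manifold_def)

lemma cinv_cmap: "c \<in> atlas M \<Longrightarrow> q \<in> cdom c \<Longrightarrow> cinv c (cmap c q) = q"
  using homeomorphism_apply1[OF chart_homeomorphism(3)] .

lemma cinv_in: "c \<in> atlas M \<Longrightarrow> x \<in> cimg c \<Longrightarrow> cinv c x \<in> cdom c"
  by (auto simp: cinv_cmap)

lemma cmap_cinv: "c \<in> atlas M \<Longrightarrow> x \<in> cimg c \<Longrightarrow> cmap c (cinv c x) = x"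
  using homeomorphism_apply2[OF chart_homeomorphism(3)] .

lemma open_chart_image:
  assumes "c \<in> atlas M" "open U"
  shows "open (cmap c ` (cdom c \<inter> U))"
proof -
  have "openin (top_of_set (cdom c)) (cdom c \<inter> U)" using assms(2) by (rule openin_open_Int)
  from homeomorphism_imp_open_map[OF chart_homeomorphism(3)[OF assms(1)] this]
  show ?thesis using chart_homeomorphism(2)[OF assms(1)] by (rule openin_open_trans)
qed

lemma chart_image_iff:
  "c \<in> atlas M \<Longrightarrow> x \<in> cmap c ` (cdom c \<inter> U) \<longleftrightarrow> x \<in> cimg c \<and> cinv c x \<in> U"
  by (auto simp: cinv_cmap)

lemma transition_smooth:
  "c \<in> atlas M \<Longrightarrow> d \<in> atlas M \<Longrightarrow> smooth_on (cmap c ` (cdom c \<inter> cdom d)) (cmap d \<circ> cinv c)"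
  using smooth_manifold by (auto simp: smooth_manifold_def)

definition jac :: "('m, 'a) chart \<Rightarrow> ('m, 'a) chart \<Rightarrow> 'm \<Rightarrow> 'a \<Rightarrow> 'a" where
  "jac c d q = frechet_derivative (cmap d \<circ> cinv c) (at (cmap c q))"

lemma comps_jac: "comps M c q = jac (chart_at M q) c q"
  and of_comps_jac: "of_comps M c q = jac c (chart_at M q) q"
  by (simp_all add: comps_def of_comps_def jac_def)

lemma jac_has_derivative:
  assumes "c \<in> atlas M" "d \<in> atlas M" "q \<in> cdom c" "q \<in> cdom d"
  shows "((cmap d \<circ> cinv c) has_derivative jac c d q) (at (cmap c q))"
  unfolding jac_def by (rule smooth_on_has_derivative[OF transition_smooth[OF assms(1,2)]]) (use assms in blast)

lemma jac_linear: "c \<in> atlas M \<Longrightarrow> d \<in> atlas M \<Longrightarrow> q \<in> cdom c \<Longrightarrow> q \<in> cdom d \<Longrightarrow> linear (jac c d q)"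
  using has_derivative_linear[OF jac_has_derivative] .

text \<open>Chain rule for transition maps. As \<open>comps\<close> and \<open>of_comps\<close> are
  Jacobians from and to the preferred chart, changes of components reduce to this cocycle identity
  and \<open>jac_self\<close>.\<close>

lemma jac_jac:
  assumes c: "c \<in> atlas M" "q \<in> cdom c" and d: "d \<in> atlas M" "q \<in> cdom d" and e: "e \<in> atlas M" "q \<in> cdom e"
  shows "jac d e q (jac c d q v) = jac c e q v"
proof -
  have q: "cmap d q = (cmap d \<circ> cinv c) (cmap c q)" using c by (simp add: cinv_cmap)
  have "((cmap e \<circ> cinv d) \<circ> (cmap d \<circ> cinv c) has_derivative (jac d e q \<circ> jac c d q)) (at (cmap c q))"
    using diff_chain_at[OF jac_has_derivative[OF c(1) d(1) c(2) d(2)]] jac_has_derivative[OF d(1) e(1) d(2) e(2)] q by metis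
  then have "((cmap e \<circ> cinv c) has_derivative (jac d e q \<circ> jac c d q)) (at (cmap c q))"
  proof (rule has_derivative_transform_within_open)
    show "open (cmap c ` (cdom c \<inter> cdom d))"
      by (rule open_chart_image[OF c(1) chart_homeomorphism(1)[OF d(1)]])
    show "cmap c q \<in> cmap c ` (cdom c \<inter> cdom d)" using c d by blast
  qed (auto simp: cinv_cmap c d)
  from has_derivative_unique[OF this jac_has_derivative[OF c(1) e(1) c(2) e(2)]]
  show ?thesis by (metis o_apply)
qed

lemma jac_self:
  assumes "c \<in> atlas M" "q \<in> cdom c"
  shows "jac c c q v = v"
proof -
  have "((\<lambda>x. x) has_derivative (\<lambda>v. v)) (at (cmap c q))" by (rule has_derivative_ident)
  then have "((cmap c \<circ> cinv c) has_derivative (\<lambda>v. v)) (at (cmap c q))"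
    by (rule has_derivative_transform_within_open[OF _ chart_homeomorphism(2)[OF assms(1)]])
      (use assms in \<open>auto simp: cinv_cmap\<close>)
  from has_derivative_unique[OF this jac_has_derivative[OF assms(1) assms(1) assms(2) assms(2)]]
  show ?thesis by metis
qed

lemma comps_of_comps:
  assumes "c \<in> atlas M" "q \<in> cdom c"
  shows "comps M c q (of_comps M c q v) = v"
  unfolding comps_jac of_comps_jac
  by (simp add: jac_jac[OF assms chart_at assms] jac_self[OF assms])

lemma of_comps_comps:
  assumes "c \<in> atlas M" "q \<in> cdom c"
  shows "of_comps M c q (comps M c q v) = v"
  unfolding comps_jac of_comps_jac
  by (simp add: jac_jac[OF chart_at assms chart_at] jac_self[OF chart_at])

lemma comps_of_comps_jac:
  assumes "c \<in> atlas M" "q \<in> cdom c" "d \<in> atlas M" "q \<in> cdom d"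
  shows "comps M d q (of_comps M c q v) = jac c d q v"
  unfolding comps_jac of_comps_jac by (rule jac_jac[OF assms(1,2) chart_at assms(3,4)])

lemma jac_comps:
  assumes "c \<in> atlas M" "q \<in> cdom c" "d \<in> atlas M" "q \<in> cdom d"
  shows "jac c d q (comps M c q v) = comps M d q v"
  unfolding comps_jac by (rule jac_jac[OF chart_at assms])

lemma comps_linear: "c \<in> atlas M \<Longrightarrow> q \<in> cdom c \<Longrightarrow> linear (comps M c q)"
  unfolding comps_jac by (rule jac_linear) (use chart_at in auto)

lemma of_comps_linear: "c \<in> atlas M \<Longrightarrow> q \<in> cdom c \<Longrightarrow> linear (of_comps M c q)"
  unfolding of_comps_jac by (rule jac_linear) (use chart_at in auto)

lemma comps_chart_at: "comps M (chart_at M p) p v = v" "of_comps M (chart_at M p) p v = v"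
  unfolding comps_jac of_comps_jac by (simp_all add: jac_self[OF chart_at])

lemma jac_smooth:
  assumes "c \<in> atlas M" "d \<in> atlas M"
  shows "smooth_on (cmap c ` (cdom c \<inter> cdom d)) (\<lambda>x. frechet_derivative (cmap d \<circ> cinv c) (at x) v)"
  by (rule smooth_on_frechet_derivative[OF transition_smooth[OF assms]])

lemma jac_at_cinv:
  "c \<in> atlas M \<Longrightarrow> x \<in> cimg c \<Longrightarrow> jac c d (cinv c x) = frechet_derivative (cmap d \<circ> cinv c) (at x)"
  by (simp add: jac_def cmap_cinv)

lemma smooth_curve_open:
  assumes "smooth_curve M J \<gamma>" "open U"
  shows "open (J \<inter> \<gamma> -` U)"
  using assms continuous_open_preimage unfolding smooth_curve_def by blast

lemma smooth_curve_smooth: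
  "smooth_curve M J \<gamma> \<Longrightarrow> c \<in> atlas M \<Longrightarrow> smooth_on (J \<inter> \<gamma> -` cdom c) (cmap c \<circ> \<gamma>)"
  unfolding smooth_curve_def by blast

lemma smooth_curve_velocity:
  assumes \<gamma>: "smooth_curve M J \<gamma>" and t: "t \<in> J" and c: "c \<in> atlas M" "\<gamma> t \<in> cdom c"
  shows "((cmap c \<circ> \<gamma>) has_vector_derivative comps M c (\<gamma> t) (velocity M \<gamma> t)) (at t)"
proof -
  let ?e = "chart_at M (\<gamma> t)" and ?x = "cmap (chart_at M (\<gamma> t)) \<circ> \<gamma>"
  let ?J = "J \<inter> \<gamma> -` cdom ?e"
  have J: "open ?J" "t \<in> ?J"
    using smooth_curve_open[OF \<gamma> chart_homeomorphism(1)[OF chart_at(1)]] t chart_at by auto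
  have "?x differentiable (at t)"
    using smooth_on_has_derivative[OF smooth_curve_smooth[OF \<gamma> chart_at(1)] J(2)] by (rule differentiableI)
  then have x: "(?x has_vector_derivative velocity M \<gamma> t) (at t)"
    unfolding velocity_def by (simp add: vector_derivative_works)
  have "((cmap c \<circ> cinv ?e) has_derivative jac ?e c (\<gamma> t)) (at (?x t))"
    using jac_has_derivative[OF chart_at(1) c(1) chart_at(2) c(2)] by simp
  from vector_derivative_diff_chain_within[OF x has_derivative_at_withinI[OF this]]
  have "((cmap c \<circ> cinv ?e) \<circ> ?x has_vector_derivative jac ?e c (\<gamma> t) (velocity M \<gamma> t)) (at t)" .
  then show ?thesis unfolding comps_jac
    by (rule has_vector_derivative_transform_within_open[OF _ J]) (use chart_at in \<open>auto simp: cinv_cmap\<close>)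
qed

end

locale riemannian_setup =
  fixes M :: "('m::{t2_space,second_countable_topology}, 'a::euclidean_space) manifold"
  assumes riemannian: "riemannian_manifold M"

sublocale riemannian_setup \<subseteq> manifold_setup M
  using riemannian by unfold_locales (simp add: riemannian_manifold_def)

context riemannian_setup
begin

abbreviation mc :: "('m, 'a) chart \<Rightarrow> 'a \<Rightarrow> 'a \<Rightarrow> 'a \<Rightarrow> real" where "mc \<equiv> metric_comps M"

lemma metric_form: "pos_def_form (metric M p)"
  using riemannian by (simp add: riemannian_manifold_def pos_def_form_def)

lemma mc_smooth: "c \<in> atlas M \<Longrightarrow> smooth_on (cimg c) (\<lambda>x. mc c x v w)"
  using riemannian by (simp add: riemannian_manifold_def)

lemma mc_form:
  assumes "c \<in> atlas M" "x \<in> cimg c"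
  shows "pos_def_form (mc c x)"
proof -
  let ?o = "of_comps M c (cinv c x)"
  have q: "cinv c x \<in> cdom c" by (rule cinv_in[OF assms])
  have l: "linear ?o" by (rule of_comps_linear[OF assms(1) q])
  have ne: "?o v \<noteq> 0" if "v \<noteq> 0" for v
    using comps_of_comps[OF assms(1) q, of v] linear_0[OF comps_linear[OF assms(1) q]] that by auto
  have "bilinear (mc c x)"
    unfolding bilinear_def metric_comps_def
    using linear_compose[OF l form_linear(1)[OF metric_form]] linear_compose[OF l form_linear(2)[OF metric_form]]
    by (simp add: o_def)
  then show ?thesis
    unfolding pos_def_form_def metric_comps_def using form_sym[OF metric_form] form_pos[OF metric_form ne] by blast
qed

lemma metric_mc:
  assumes "c \<in> atlas M" "q \<in> cdom c"
  shows "metric M q v w = mc c (cmap c q) (comps M c q v) (comps M c q w)"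
  unfolding metric_comps_def by (simp add: cinv_cmap[OF assms] of_comps_comps[OF assms])

lemma mc_chart_at: "mc (chart_at M p) (cmap (chart_at M p) p) = metric M p"
  by (intro ext) (simp add: metric_comps_def cinv_cmap[OF chart_at] comps_chart_at)

section \<open>Derivatives of the metric coefficients and the Levi-Civita connection in a
  chart\<close>

definition dmc :: "('m, 'a) chart \<Rightarrow> 'a \<Rightarrow> 'a \<Rightarrow> 'a \<Rightarrow> 'a \<Rightarrow> real" where
  "dmc c x u v w = frechet_derivative (\<lambda>y. mc c y v w) (at x) u"

lemma mc_has_derivative:
  "c \<in> atlas M \<Longrightarrow> x \<in> cimg c \<Longrightarrow> ((\<lambda>y. mc c y v w) has_derivative (\<lambda>u. dmc c x u v w)) (at x)"
  unfolding dmc_def by (rule smooth_on_has_derivative[OF mc_smooth])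

text \<open>Separates the dependence on the base point from that on the two vectors, so that a
  product rule with all three varying follows from the scalar one.\<close>

lemma mc_expand:
  assumes "c \<in> atlas M" "x \<in> cimg c"
  shows "mc c x v w = (\<Sum>i\<in>Basis. \<Sum>j\<in>Basis. (v \<bullet> i) * (w \<bullet> j) * mc c x i j)"
proof -
  have "mc c x v w = (\<Sum>i\<in>Basis. (v \<bullet> i) * mc c x i w)" by (rule form_expand[OF mc_form[OF assms]])
  also have "\<dots> = (\<Sum>i\<in>Basis. (v \<bullet> i) * (\<Sum>j\<in>Basis. (w \<bullet> j) * mc c x j i))"
    by (intro sum.cong refl arg_cong2[of _ _ _ _ "(*)"])
      (subst form_sym[OF mc_form[OF assms]], rule form_expand[OF mc_form[OF assms]])
  finally show ?thesis
    by (simp add: sum_distrib_left mult.assoc form_sym[OF mc_form[OF assms]])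
qed

lemma dmc_linear:
  assumes c: "c \<in> atlas M" and x: "x \<in> cimg c"
  shows "linear (\<lambda>u. dmc c x u v w)" "linear (\<lambda>v. dmc c x u v w)" "linear (\<lambda>w. dmc c x u v w)"
    "dmc c x u v w = dmc c x u w v"
proof -
  note d = mc_has_derivative[OF c x] and o = chart_homeomorphism(2)[OF c]
  show "linear (\<lambda>u. dmc c x u v w)" by (rule has_derivative_linear[OF d])
  have sym: "dmc c x u v w = dmc c x u w v" for u v w
  proof -
    have "((\<lambda>y. mc c y v w) has_derivative (\<lambda>u. dmc c x u w v)) (at x)"
      by (rule has_derivative_transform_within_open[OF d o x]) (rule form_sym[OF mc_form[OF c]])
    from has_derivative_unique[OF d this] show ?thesis by metis
  qed
  have add: "dmc c x u (v + v') w = dmc c x u v w + dmc c x u v' w" for u v v' w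
  proof -
    have "((\<lambda>y. mc c y (v + v') w) has_derivative (\<lambda>u. dmc c x u v w + dmc c x u v' w)) (at x)"
      by (rule has_derivative_transform_within_open[OF has_derivative_add[OF d d] o x])
        (simp add: form_simps[OF mc_form[OF c]])
    from has_derivative_unique[OF d this] show ?thesis by metis
  qed
  have scale: "dmc c x u (r *\<^sub>R v) w = r *\<^sub>R dmc c x u v w" for u r v w
  proof -
    have "((\<lambda>y. mc c y (r *\<^sub>R v) w) has_derivative (\<lambda>u. r *\<^sub>R dmc c x u v w)) (at x)"
      by (rule has_derivative_transform_within_open[OF has_derivative_scaleR_right[OF d] o x])
        (simp add: form_simps[OF mc_form[OF c]])
    from has_derivative_unique[OF d this] show ?thesis by metis
  qed
  show "linear (\<lambda>v. dmc c x u v w)" by (intro linearI add scale)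
  then show "linear (\<lambda>w. dmc c x u v w)" unfolding sym[of u v] by (intro linearI add scale)
  show "dmc c x u v w = dmc c x u w v" by (rule sym)
qed

lemma dmc_expand:
  assumes "c \<in> atlas M" "x \<in> cimg c"
  shows "dmc c x u v w = (\<Sum>i\<in>Basis. \<Sum>j\<in>Basis. (v \<bullet> i) * (w \<bullet> j) * dmc c x u i j)"
proof -
  have "dmc c x u v w = (\<Sum>i\<in>Basis. (v \<bullet> i) *\<^sub>R dmc c x u i w)"
    by (rule linear_basis_expand[OF dmc_linear(2)[OF assms]])
  also have "\<dots> = (\<Sum>i\<in>Basis. (v \<bullet> i) *\<^sub>R (\<Sum>j\<in>Basis. (w \<bullet> j) *\<^sub>R dmc c x u i j))"
    by (intro sum.cong refl arg_cong2[of _ _ _ _ scaleR] linear_basis_expand[OF dmc_linear(3)[OF assms]])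
  finally show ?thesis by (simp add: sum_distrib_left mult.assoc)
qed

text \<open>The parameter space is left general: the rule is applied along curves and to the
  pullback of the metric under a transition map.\<close>

lemma mc_product_rule:
  fixes \<xi> A B :: "'z::real_normed_vector \<Rightarrow> 'a"
  assumes c: "c \<in> atlas M" and z: "open Z" "z \<in> Z" and Z: "\<And>y. y \<in> Z \<Longrightarrow> \<xi> y \<in> cimg c"
    and \<xi>: "(\<xi> has_derivative \<xi>') (at z)" and A: "(A has_derivative A') (at z)" and B: "(B has_derivative B') (at z)"
  shows "((\<lambda>y. mc c (\<xi> y) (A y) (B y)) has_derivative
    (\<lambda>h. dmc c (\<xi> z) (\<xi>' h) (A z) (B z) + mc c (\<xi> z) (A' h) (B z) + mc c (\<xi> z) (A z) (B' h))) (at z)"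
proof -
  have x: "\<xi> z \<in> cimg c" using Z z by blast
  have G: "((\<lambda>y. mc c (\<xi> y) i j) has_derivative (\<lambda>h. dmc c (\<xi> z) (\<xi>' h) i j)) (at z)" for i j
    by (rule has_derivative_compose[OF \<xi> mc_has_derivative[OF c x]])
  have "((\<lambda>y. \<Sum>i\<in>Basis. \<Sum>j\<in>Basis. (A y \<bullet> i) * (B y \<bullet> j) * mc c (\<xi> y) i j) has_derivative
    (\<lambda>h. \<Sum>i\<in>Basis. \<Sum>j\<in>Basis. (A z \<bullet> i) * (B z \<bullet> j) * dmc c (\<xi> z) (\<xi>' h) i j +
       ((A z \<bullet> i) * (B' h \<bullet> j) + (A' h \<bullet> i) * (B z \<bullet> j)) * mc c (\<xi> z) i j)) (at z)"
    by (intro has_derivative_sum has_derivative_mult has_derivative_inner_left A B G)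
  then have "((\<lambda>y. mc c (\<xi> y) (A y) (B y)) has_derivative
    (\<lambda>h. \<Sum>i\<in>Basis. \<Sum>j\<in>Basis. (A z \<bullet> i) * (B z \<bullet> j) * dmc c (\<xi> z) (\<xi>' h) i j +
       ((A z \<bullet> i) * (B' h \<bullet> j) + (A' h \<bullet> i) * (B z \<bullet> j)) * mc c (\<xi> z) i j)) (at z)"
    by (rule has_derivative_transform_within_open[OF _ z]) (rule mc_expand[OF c Z, symmetric])
  moreover have "(\<Sum>i\<in>Basis. \<Sum>j\<in>Basis. (A z \<bullet> i) * (B z \<bullet> j) * dmc c (\<xi> z) (\<xi>' h) i j +
       ((A z \<bullet> i) * (B' h \<bullet> j) + (A' h \<bullet> i) * (B z \<bullet> j)) * mc c (\<xi> z) i j) =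
     dmc c (\<xi> z) (\<xi>' h) (A z) (B z) + mc c (\<xi> z) (A' h) (B z) + mc c (\<xi> z) (A z) (B' h)" for h
    unfolding dmc_expand[OF c x, of _ "A z" "B z"] mc_expand[OF c x, of "A' h" "B z"] mc_expand[OF c x, of "A z" "B' h"]
    by (simp add: sum.distrib[symmetric] algebra_simps)
  ultimately show ?thesis by simp
qed

text \<open>The Koszul formula for coordinate fields, whose brackets vanish: the Christoffel symbols
  with lowered index.\<close>

definition koszul :: "('m, 'a) chart \<Rightarrow> 'a \<Rightarrow> 'a \<Rightarrow> 'a \<Rightarrow> 'a \<Rightarrow> real" where
  "koszul c x u v w = (dmc c x u v w + dmc c x v u w - dmc c x w u v) / 2"

text \<open>Justifies the definite description: symmetry and compatibility force the Koszul formula,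
  which by definiteness has at most one solution, and Riesz representation provides one.\<close>

lemma christoffel:
  assumes c: "c \<in> atlas M" and x: "x \<in> cimg c"
  shows "bilinear (christoffel M c x)" "christoffel M c x v w = christoffel M c x w v"
    "dmc c x u v w = mc c x (christoffel M c x u v) w + mc c x v (christoffel M c x u w)"
    "mc c x (christoffel M c x u v) w = koszul c x u v w"
proof -
  note form = mc_form[OF c x] and lin = dmc_linear[OF c x]
  note dl = linear_add[OF lin(1)] linear_add[OF lin(2)] linear_add[OF lin(3)]
    linear_scale[OF lin(1)] linear_scale[OF lin(2)] linear_scale[OF lin(3)]
  have "linear (koszul c x u v)" for u v
    unfolding koszul_def by (intro linearI) (simp_all add: dl field_simps)
  then have "\<exists>y. \<forall>w. mc c x y w = koszul c x u v w" for u v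
    using form_representation[OF form] by blast
  then obtain \<Gamma> where "\<forall>u v w. mc c x (\<Gamma> u v) w = koszul c x u v w" by metis
  then have \<Gamma>: "mc c x (\<Gamma> u v) w = koszul c x u v w" for u v w by blast
  let ?P = "\<lambda>\<Gamma>. bilinear \<Gamma> \<and> (\<forall>v w. \<Gamma> v w = \<Gamma> w v) \<and>
     (\<forall>u v w. dmc c x u v w = mc c x (\<Gamma> u v) w + mc c x v (\<Gamma> u w))"
  have "bilinear \<Gamma>"
    unfolding bilinear_def
    by (intro conjI allI linearI form_eqI[OF form])
      (simp_all add: \<Gamma> form_simps[OF form] koszul_def dl field_simps)
  moreover have "\<Gamma> v w = \<Gamma> w v" for v w
    by (rule form_eqI[OF form]) (simp add: \<Gamma> koszul_def lin(4)[of _ v w])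
  moreover have "dmc c x u v w = mc c x (\<Gamma> u v) w + mc c x v (\<Gamma> u w)" for u v w
    unfolding form_sym[OF form, of v] \<Gamma> koszul_def lin(4)[of u w v] lin(4)[of v w u] lin(4)[of w v u] by (simp add: field_simps)
  ultimately have P: "?P \<Gamma>" by blast
  have koszul: "mc c x (\<Delta> u v) w = koszul c x u v w" if "?P \<Delta>" for \<Delta> u v w
  proof -
    have sym: "\<Delta> a b = \<Delta> b a" and d: "dmc c x a b e = mc c x (\<Delta> a b) e + mc c x b (\<Delta> a e)" for a b e
      using that by blast+
    show ?thesis unfolding koszul_def d sym[of v u] sym[of w u] sym[of w v]
        form_sym[OF form, of v] form_sym[OF form, of u] by simp
  qed
  have unique: "\<Delta> = \<Gamma>" if "?P \<Delta>" for \<Delta>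
    by (intro ext form_eqI[OF form]) (simp only: koszul[OF that] \<Gamma>)
  have eq: "christoffel M c x = \<Gamma>"
    unfolding christoffel_def dmc_def[symmetric] by (rule the_equality[where P = ?P, OF P unique])
  show "bilinear (christoffel M c x)" "christoffel M c x v w = christoffel M c x w v"
    "dmc c x u v w = mc c x (christoffel M c x u v) w + mc c x v (christoffel M c x u w)"
    "mc c x (christoffel M c x u v) w = koszul c x u v w"
    unfolding eq using P \<Gamma> by (blast, blast, blast, blast)
qed

lemma christoffel_smooth:
  assumes "c \<in> atlas M"
  shows "smooth_on (cimg c) (\<lambda>x. christoffel M c x u v)"
proof (rule smooth_on_solution[OF chart_homeomorphism(2)[OF assms] mc_form[OF assms] mc_smooth[OF assms]
      christoffel(4)[OF assms]])
  show "smooth_on (cimg c) (\<lambda>x. koszul c x u v w)" for w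
    unfolding koszul_def dmc_def smooth_on_def divide_inverse
    using smooth_on_frechet_derivative[OF mc_smooth[OF assms]]
    by (intro allI Ck_on_mult Ck_on_diff Ck_on_add Ck_on_const chart_homeomorphism(2)[OF assms])
      (auto simp: smooth_on_def)
qed

text \<open>Only the diagonal part of the transformation law of the Christoffel symbols is needed to see that the geodesic
  equation does not depend on the chart.\<close>

lemma christoffel_transition:
  assumes c: "c \<in> atlas M" "q \<in> cdom c" and d: "d \<in> atlas M" "q \<in> cdom d"
  shows "christoffel M d (cmap d q) (jac c d q u) (jac c d q u) =
    jac c d q (christoffel M c (cmap c q) u u) -
      frechet_derivative (\<lambda>x. frechet_derivative (cmap d \<circ> cinv c) (at x) u) (at (cmap c q)) u"
proof -
  let ?x = "cmap c q" and ?y = "cmap d q" and ?\<sigma> = "cmap d \<circ> cinv c" and ?J = "jac c d q"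
  let ?D = "\<lambda>x. frechet_derivative (cmap d \<circ> cinv c) (at x)"
  define H where "H v w = frechet_derivative (\<lambda>x. ?D x v) (at ?x) w" for v w
  define Z where "Z = cmap c ` (cdom c \<inter> cdom d)"
  have Z: "open Z" "?x \<in> Z"
    unfolding Z_def using open_chart_image[OF c(1) chart_homeomorphism(1)[OF d(1)]] c d by auto
  have Zc: "z \<in> cimg c" "cinv c z \<in> cdom c" "cinv c z \<in> cdom d" "?\<sigma> z \<in> cimg d" "?\<sigma> z = cmap d (cinv c z)"
    if "z \<in> Z" for z
    using that by (auto simp: Z_def chart_image_iff[OF c(1)] cinv_cmap[OF c(1)])
  have x: "?x \<in> cimg c" and y: "?y \<in> cimg d" using c d by auto
  have \<sigma>x: "?\<sigma> ?x = ?y" by (simp add: cinv_cmap[OF c])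
  have Dx: "?D ?x = ?J" by (simp add: jac_def)
  have H_sym: "H v w = H w v" for v w
    unfolding H_def by (rule second_derivative_symmetric[OF Z transition_smooth[OF c(1) d(1), folded Z_def]])
  have H: "((\<lambda>x. ?D x v) has_derivative H v) (at ?x)" for v
    unfolding H_def by (rule smooth_on_has_derivative[OF jac_smooth[OF c(1) d(1), folded Z_def] Z(2)])
  \<comment> \<open>The metric in chart \<open>c\<close> is the pullback, under the transition map,
    of the metric in chart \<open>d\<close>; this identity is differentiated, and \<open>H\<close>
    is the second derivative of the map.\<close>
  have dmc: "dmc c ?x w a b = dmc d ?y (?J w) (?J a) (?J b) + mc d ?y (H a w) (?J b) + mc d ?y (?J a) (H b w)" for w a b
  proof -
    have "((\<lambda>z. mc d (?\<sigma> z) (?D z a) (?D z b)) has_derivative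
      (\<lambda>h. dmc d (?\<sigma> ?x) (?J h) (?D ?x a) (?D ?x b) + mc d (?\<sigma> ?x) (H a h) (?D ?x b) + mc d (?\<sigma> ?x) (?D ?x a) (H b h))) (at ?x)"
      by (rule mc_product_rule[OF d(1) Z Zc(4) jac_has_derivative[OF c(1) d(1) c(2) d(2)] H H])
    then have "((\<lambda>z. mc c z a b) has_derivative
      (\<lambda>h. dmc d (?\<sigma> ?x) (?J h) (?D ?x a) (?D ?x b) + mc d (?\<sigma> ?x) (H a h) (?D ?x b) + mc d (?\<sigma> ?x) (?D ?x a) (H b h))) (at ?x)"
    proof (rule has_derivative_transform_within_open[OF _ Z])
      fix z assume z: "z \<in> Z"
      have "mc c z a b = metric M (cinv c z) (of_comps M c (cinv c z) a) (of_comps M c (cinv c z) b)"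
        by (simp add: metric_comps_def)
      also have "\<dots> = mc d (?\<sigma> z) (?D z a) (?D z b)"
        unfolding metric_mc[OF d(1) Zc(3)[OF z]] comps_of_comps_jac[OF c(1) Zc(2)[OF z] d(1) Zc(3)[OF z]]
          jac_at_cinv[OF c(1) Zc(1)[OF z]] by simp
      finally show "mc d (?\<sigma> z) (?D z a) (?D z b) = mc c z a b" by simp
    qed
    from has_derivative_unique[OF mc_has_derivative[OF c(1) x] this]
    show ?thesis unfolding \<sigma>x Dx by metis
  qed
  note fd = mc_form[OF d(1) y]
  \<comment> \<open>In the Koszul combination, symmetry of \<open>H\<close> cancels the second-order
    terms except \<open>H u u\<close>. Testing against \<open>?J w\<close> suffices because
    \<open>?J\<close> is onto.\<close>
  have eq: "mc d ?y (christoffel M d ?y (?J u) (?J u)) (?J w) = mc d ?y (?J (christoffel M c ?x u u) - H u u) (?J w)" for w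
  proof -
    have "mc d ?y (christoffel M d ?y (?J u) (?J u)) (?J w) = koszul c ?x u u w - mc d ?y (H u u) (?J w)"
      unfolding christoffel(4)[OF d(1) y] koszul_def dmc
      by (simp add: H_sym[of w u] form_sym[OF fd, of "H u w"] dmc_linear(4)[OF d(1) y] field_simps)
    also have "koszul c ?x u u w = mc c ?x (christoffel M c ?x u u) w" by (rule christoffel(4)[OF c(1) x, symmetric])
    also have "\<dots> = mc d ?y (?J (christoffel M c ?x u u)) (?J w)"
      using metric_mc[OF d, of "of_comps M c q (christoffel M c ?x u u)" "of_comps M c q w"]
      unfolding comps_of_comps_jac[OF c d] by (simp add: metric_comps_def cinv_cmap[OF c])
    finally show ?thesis by (simp add: form_simps[OF fd])
  qed
  have "christoffel M d ?y (?J u) (?J u) = ?J (christoffel M c ?x u u) - H u u"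
  proof (rule form_eqI[OF fd])
    fix w
    have "?J (jac d c q w) = w" by (simp add: jac_jac[OF d c d] jac_self[OF d])
    then show "mc d ?y (christoffel M d ?y (?J u) (?J u)) w = mc d ?y (?J (christoffel M c ?x u u) - H u u) w"
      using eq[of "jac d c q w"] by simp
  qed
  then show ?thesis by (simp add: H_def)
qed

end

section \<open>Curves and geodesics\<close>

text \<open>\<open>A\<close> is a field of linear maps, smooth for each fixed vector; expansion in
  the basis gives the derivative when base point and vector both move. Jacobians, the horizontal
  projection and \<phi> are differentiated by this rule.\<close>

lemma linear_field_product_rule:
  fixes A :: "'a::euclidean_space \<Rightarrow> 'b::euclidean_space \<Rightarrow> 'c::real_normed_vector"
    and \<xi> :: "'z::real_normed_vector \<Rightarrow> 'a"
  assumes S: "open S" and A: "\<And>b. smooth_on S (\<lambda>x. A x b)" and lin: "\<And>x. x \<in> S \<Longrightarrow> linear (A x)"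
    and Z: "open Z" "z \<in> Z" "\<And>y. y \<in> Z \<Longrightarrow> \<xi> y \<in> S"
    and \<xi>: "(\<xi> has_derivative \<xi>') (at z)" and v: "(v has_derivative v') (at z)"
  shows "((\<lambda>y. A (\<xi> y) (v y)) has_derivative
    (\<lambda>h. frechet_derivative (\<lambda>x. A x (v z)) (at (\<xi> z)) (\<xi>' h) + A (\<xi> z) (v' h))) (at z)"
proof -
  let ?dA = "\<lambda>b. frechet_derivative (\<lambda>x. A x b) (at (\<xi> z))"
  have x: "\<xi> z \<in> S" using Z by blast
  have dA: "((\<lambda>x. A x b) has_derivative ?dA b) (at (\<xi> z))" for b
    by (rule smooth_on_has_derivative[OF A x])
  have "((\<lambda>x. \<Sum>b\<in>Basis. (v z \<bullet> b) *\<^sub>R A x b) has_derivative (\<lambda>u. \<Sum>b\<in>Basis. (v z \<bullet> b) *\<^sub>R ?dA b u)) (at (\<xi> z))"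
    by (intro has_derivative_sum has_derivative_scaleR_right dA)
  then have "((\<lambda>x. A x (v z)) has_derivative (\<lambda>u. \<Sum>b\<in>Basis. (v z \<bullet> b) *\<^sub>R ?dA b u)) (at (\<xi> z))"
    by (rule has_derivative_transform_within_open[OF _ S x]) (rule linear_basis_expand[OF lin, symmetric])
  from fun_cong[OF has_derivative_unique[OF this dA[of "v z"]]]
  have 1: "?dA (v z) u = (\<Sum>b\<in>Basis. (v z \<bullet> b) *\<^sub>R ?dA b u)" for u by (rule sym)
  have "((\<lambda>y. \<Sum>b\<in>Basis. (v y \<bullet> b) *\<^sub>R A (\<xi> y) b) has_derivative
      (\<lambda>h. \<Sum>b\<in>Basis. (v z \<bullet> b) *\<^sub>R ?dA b (\<xi>' h) + (v' h \<bullet> b) *\<^sub>R A (\<xi> z) b)) (at z)"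
    by (intro has_derivative_sum has_derivative_scaleR has_derivative_inner_left v
        has_derivative_compose[OF \<xi> dA])
  then have 2: "((\<lambda>y. A (\<xi> y) (v y)) has_derivative
      (\<lambda>h. \<Sum>b\<in>Basis. (v z \<bullet> b) *\<^sub>R ?dA b (\<xi>' h) + (v' h \<bullet> b) *\<^sub>R A (\<xi> z) b)) (at z)"
    by (rule has_derivative_transform_within_open[OF _ Z(1,2)]) (rule linear_basis_expand[OF lin[OF Z(3)], symmetric])
  have "(\<Sum>b\<in>Basis. (v z \<bullet> b) *\<^sub>R ?dA b (\<xi>' h) + (v' h \<bullet> b) *\<^sub>R A (\<xi> z) b) =
      ?dA (v z) (\<xi>' h) + A (\<xi> z) (v' h)" for h
    unfolding 1 linear_basis_expand[OF lin[OF x], of "v' h"] by (rule sum.distrib)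
  with 2 show ?thesis by simp
qed

lemma linear_field_along_curve:
  fixes A :: "'a::euclidean_space \<Rightarrow> 'b::euclidean_space \<Rightarrow> 'c::real_normed_vector"
  assumes S: "open S" and A: "\<And>b. smooth_on S (\<lambda>x. A x b)" and lin: "\<And>x. x \<in> S \<Longrightarrow> linear (A x)"
    and I: "open I" "t \<in> I" "\<And>r. r \<in> I \<Longrightarrow> x r \<in> S"
    and x: "(x has_vector_derivative x') (at t)" and v: "(v has_vector_derivative v') (at t)"
  shows "((\<lambda>r. A (x r) (v r)) has_vector_derivative
    (frechet_derivative (\<lambda>x. A x (v t)) (at (x t)) x' + A (x t) v')) (at t)"
proof -
  have "linear (frechet_derivative (\<lambda>x. A x (v t)) (at (x t)))"
    using has_derivative_linear[OF smooth_on_has_derivative[OF A I(3)[OF I(2)]]] .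
  with linear_field_product_rule[OF S A lin I x[unfolded has_vector_derivative_def] v[unfolded has_vector_derivative_def]]
  show ?thesis unfolding has_vector_derivative_def
    by (simp add: linear_scale lin[OF I(3)[OF I(2)]] scaleR_add_right)
qed

lemma ode_solution_smooth:
  fixes f :: "'a::euclidean_space \<Rightarrow> 'a"
  assumes I: "open I" and S: "open S" and f: "smooth_on S f"
    and z: "\<And>t. t \<in> I \<Longrightarrow> z t \<in> S \<and> (z has_vector_derivative f (z t)) (at t)"
  shows "smooth_on I z"
proof -
  have "Ck_on n I z" for n
  proof (induction n)
    case 0
    have "isCont z t" if "t \<in> I" for t using z[OF that] has_vector_derivative_continuous by blast
    then show ?case by (simp add: continuous_at_imp_continuous_on)
  next
    case (Suc n)
    show ?case
    proof (rule Ck_on_SucI[OF I])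
      show "(z has_derivative (\<lambda>v. v *\<^sub>R f (z t))) (at t)" if "t \<in> I" for t
        using z[OF that] by (simp add: has_vector_derivative_def)
      have "Ck_on n I (\<lambda>t. f (z t))"
        by (rule Ck_on_compose[OF I S _ Suc.IH]) (use z f in \<open>auto simp: smooth_on_def\<close>)
      then show "Ck_on n I (\<lambda>t. v *\<^sub>R f (z t))" for v by (intro Ck_on_scaleR I Ck_on_const)
    qed
  qed
  then show ?thesis by (simp add: smooth_on_def)
qed

context riemannian_setup
begin

lemma smooth_curve_near:
  assumes \<gamma>: "smooth_curve M J \<gamma>" and t: "t \<in> J" and c: "c \<in> atlas M" "\<gamma> t \<in> cdom c"
  shows "open (J \<inter> \<gamma> -` cdom c)" "t \<in> J \<inter> \<gamma> -` cdom c"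
  using smooth_curve_open[OF \<gamma> chart_homeomorphism(1)[OF c(1)]] t c by auto

text \<open>The chart is kept fixed while \<open>r\<close> varies: there the components of the
  velocity are the derivative of a smooth coordinate curve. In the preferred charts of the points
  \<open>\<gamma> r\<close> they need not even be continuous.\<close>

lemma velocity_derivative:
  assumes \<gamma>: "smooth_curve M J \<gamma>" and t: "t \<in> J" and c: "c \<in> atlas M" "\<gamma> t \<in> cdom c"
  obtains W' where "((\<lambda>r. comps M c (\<gamma> r) (velocity M \<gamma> r)) has_vector_derivative W') (at t)"
proof -
  let ?J = "J \<inter> \<gamma> -` cdom c"
  note J = smooth_curve_near[OF \<gamma> t c]
  note s = smooth_curve_smooth[OF \<gamma> c(1)]
  have eq: "frechet_derivative (cmap c \<circ> \<gamma>) (at r) 1 = comps M c (\<gamma> r) (velocity M \<gamma> r)" if "r \<in> ?J" for r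
  proof -
    have "((cmap c \<circ> \<gamma>) has_derivative (\<lambda>h. h *\<^sub>R comps M c (\<gamma> r) (velocity M \<gamma> r))) (at r)"
      using smooth_curve_velocity[OF \<gamma> _ c(1)] that by (auto simp: has_vector_derivative_def)
    from has_derivative_unique[OF smooth_on_has_derivative[OF s that] this] show ?thesis by simp
  qed
  have "(\<lambda>r. frechet_derivative (cmap c \<circ> \<gamma>) (at r) 1) differentiable (at t)"
    using smooth_on_has_derivative[OF smooth_on_frechet_derivative[OF s] J(2)] by (rule differentiableI)
  then have "((\<lambda>r. frechet_derivative (cmap c \<circ> \<gamma>) (at r) 1) has_vector_derivative
      vector_derivative (\<lambda>r. frechet_derivative (cmap c \<circ> \<gamma>) (at r) 1) (at t)) (at t)"
    by (simp add: vector_derivative_works)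
  then show thesis
    by (rule that[OF has_vector_derivative_transform_within_open[OF _ J]]) (rule eq)
qed

lemma nabla_along_eq:
  assumes "((\<lambda>r. comps M (chart_at M (\<gamma> t)) (\<gamma> r) (Y r)) has_vector_derivative Y') (at t)"
  shows "nabla_along M \<gamma> Y t = Y' + christoffel M (chart_at M (\<gamma> t)) (cmap (chart_at M (\<gamma> t)) (\<gamma> t)) (velocity M \<gamma> t) (Y t)"
  unfolding nabla_along_def Let_def vector_derivative_at[OF assms] ..

text \<open>Compatibility makes the derivative of the metric coefficients the sum of the two
  Christoffel terms, which complete the component derivatives to covariant ones.\<close>

lemma metric_along_curve:
  assumes \<gamma>: "smooth_curve M J \<gamma>" and t: "t \<in> J"
    and Y: "((\<lambda>r. comps M (chart_at M (\<gamma> t)) (\<gamma> r) (Y r)) has_vector_derivative Y') (at t)"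
    and Z: "((\<lambda>r. comps M (chart_at M (\<gamma> t)) (\<gamma> r) (Z r)) has_vector_derivative Z') (at t)"
  shows "((\<lambda>r. metric M (\<gamma> r) (Y r) (Z r)) has_real_derivative
    metric M (\<gamma> t) (nabla_along M \<gamma> Y t) (Z t) + metric M (\<gamma> t) (Y t) (nabla_along M \<gamma> Z t)) (at t)"
proof -
  let ?c = "chart_at M (\<gamma> t)" and ?W = "velocity M \<gamma> t"
  let ?x = "cmap ?c \<circ> \<gamma>" and ?Y = "\<lambda>r. comps M ?c (\<gamma> r) (Y r)" and ?Z = "\<lambda>r. comps M ?c (\<gamma> r) (Z r)"
  let ?\<Gamma> = "christoffel M ?c (?x t)"
  note c = chart_at[of "\<gamma> t"]
  note J = smooth_curve_near[OF \<gamma> t c]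
  have x: "?x t \<in> cimg ?c" using c by auto
  have dx: "(?x has_vector_derivative ?W) (at t)"
    using smooth_curve_velocity[OF \<gamma> t c] by (simp only: comps_chart_at)
  have form: "pos_def_form (mc ?c (cmap ?c (\<gamma> t)))" using mc_form[OF c(1) x] by simp
  have Jx: "?x r \<in> cimg ?c" if "r \<in> J \<inter> \<gamma> -` cdom ?c" for r using that by auto
  have "((\<lambda>r. mc ?c (?x r) (?Y r) (?Z r)) has_derivative
    (\<lambda>h. dmc ?c (?x t) (h *\<^sub>R ?W) (?Y t) (?Z t) + mc ?c (?x t) (h *\<^sub>R Y') (?Z t) + mc ?c (?x t) (?Y t) (h *\<^sub>R Z'))) (at t)"
    by (rule mc_product_rule[OF c(1) J Jx dx[unfolded has_vector_derivative_def]
          Y[unfolded has_vector_derivative_def] Z[unfolded has_vector_derivative_def]])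
  then have "((\<lambda>r. metric M (\<gamma> r) (Y r) (Z r)) has_derivative
    (\<lambda>h. dmc ?c (?x t) (h *\<^sub>R ?W) (?Y t) (?Z t) + mc ?c (?x t) (h *\<^sub>R Y') (?Z t) + mc ?c (?x t) (?Y t) (h *\<^sub>R Z'))) (at t)"
    by (rule has_derivative_transform_within_open[OF _ J]) (simp add: metric_mc[OF c(1)])
  moreover have "dmc ?c (?x t) (h *\<^sub>R ?W) (?Y t) (?Z t) + mc ?c (?x t) (h *\<^sub>R Y') (?Z t) + mc ?c (?x t) (?Y t) (h *\<^sub>R Z') =
      (metric M (\<gamma> t) (nabla_along M \<gamma> Y t) (Z t) + metric M (\<gamma> t) (Y t) (nabla_along M \<gamma> Z t)) * h" for h
  proof -
    have "metric M (\<gamma> t) = mc ?c (?x t)" by (simp add: mc_chart_at)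
    moreover have "nabla_along M \<gamma> Y t = Y' + ?\<Gamma> ?W (Y t)" "nabla_along M \<gamma> Z t = Z' + ?\<Gamma> ?W (Z t)"
      using nabla_along_eq[OF Y] nabla_along_eq[OF Z] by simp_all
    moreover have "dmc ?c (?x t) (h *\<^sub>R ?W) (Y t) (Z t) = h * (mc ?c (?x t) (?\<Gamma> ?W (Y t)) (Z t) + mc ?c (?x t) (Y t) (?\<Gamma> ?W (Z t)))"
      using christoffel(3)[OF c(1) x] linear_scale[OF dmc_linear(1)[OF c(1) x]] by simp
    ultimately show ?thesis by (simp add: comps_chart_at form_simps[OF form] algebra_simps)
  qed
  ultimately show ?thesis by (simp add: has_field_derivative_def)
qed

lemma metric_grad:
  assumes f: "smooth_fun M f"
  shows "metric M p (grad M f p) w = frechet_derivative (f \<circ> cinv (chart_at M p)) (at (cmap (chart_at M p) p)) w"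
proof -
  let ?c = "chart_at M p"
  let ?D = "frechet_derivative (f \<circ> cinv ?c) (at (cmap ?c p))"
  have "smooth_on (cimg ?c) (f \<circ> cinv ?c)" using f chart_at by (auto simp: smooth_fun_def)
  then have "linear ?D" using has_derivative_linear[OF smooth_on_has_derivative] chart_at by blast
  then obtain v where v: "\<forall>w. metric M p v w = ?D w" using form_representation[OF metric_form] by blast
  have "grad M f p = v"
    unfolding grad_def
    by (rule the_equality[where P = "\<lambda>v. \<forall>w. metric M p v w = ?D w", OF v]) (rule form_eqI[OF metric_form[of p]], use v in simp)
  with v show ?thesis by blast
qed

lemma function_along_curve:
  assumes f: "smooth_fun M f" and \<gamma>: "smooth_curve M J \<gamma>" and t: "t \<in> J"
  shows "((\<lambda>r. f (\<gamma> r)) has_real_derivative metric M (\<gamma> t) (grad M f (\<gamma> t)) (velocity M \<gamma> t)) (at t)"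
proof -
  let ?c = "chart_at M (\<gamma> t)"
  note c = chart_at[of "\<gamma> t"]
  note J = smooth_curve_near[OF \<gamma> t c]
  have x: "((cmap ?c \<circ> \<gamma>) has_vector_derivative velocity M \<gamma> t) (at t)"
    using smooth_curve_velocity[OF \<gamma> t c] by (simp only: comps_chart_at)
  have "smooth_on (cimg ?c) (f \<circ> cinv ?c)" using f c by (auto simp: smooth_fun_def)
  then have "((f \<circ> cinv ?c) has_derivative frechet_derivative (f \<circ> cinv ?c) (at ((cmap ?c \<circ> \<gamma>) t))) (at ((cmap ?c \<circ> \<gamma>) t))"
    using c by (intro smooth_on_has_derivative) auto
  from vector_derivative_diff_chain_within[OF x has_derivative_at_withinI[OF this]]
  have "((\<lambda>r. f (\<gamma> r)) has_vector_derivative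
      frechet_derivative (f \<circ> cinv ?c) (at ((cmap ?c \<circ> \<gamma>) t)) (velocity M \<gamma> t)) (at t)"
    by (rule has_vector_derivative_transform_within_open[OF _ J]) (use c in \<open>auto simp: cinv_cmap\<close>)
  then show ?thesis
    unfolding metric_grad[OF f] by (simp add: has_real_derivative_iff_has_vector_derivative)
qed

text \<open>The geodesic equation is a first-order autonomous system for position and velocity in
  the preferred chart of \<open>p\<close>; its solution is then shown to satisfy the equation in
  each preferred chart it meets.\<close>

lemma geodesic_exists:
  obtains e \<gamma> where "e > 0" "geodesic M {-e<..<e} \<gamma>" "\<gamma> 0 = p" "velocity M \<gamma> 0 = W"
proof -
  let ?c = "chart_at M p"
  note c = chart_at[of p]
  let ?\<Gamma> = "christoffel M ?c"
  let ?F = "\<lambda>z::'a \<times> 'a. (snd z, - ?\<Gamma> (fst z) (snd z) (snd z))"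
  let ?S = "cimg ?c \<times> (UNIV :: 'a set)"
  have S: "open ?S" by (intro open_Times chart_homeomorphism c open_UNIV)
  \<comment> \<open>Smoothness of the Christoffel symbols is known for fixed arguments, so the
    quadratic dependence on the velocity is written out in the basis.\<close>
  have \<Gamma>_expand: "?\<Gamma> x v v = (\<Sum>i\<in>Basis. (v \<bullet> i) *\<^sub>R (\<Sum>j\<in>Basis. (v \<bullet> j) *\<^sub>R ?\<Gamma> x i j))"
    if "x \<in> cimg ?c" for x v
  proof -
    have l: "linear (\<lambda>u. ?\<Gamma> x u w)" "linear (?\<Gamma> x w)" for w
      using christoffel(1)[OF c(1) that] by (auto simp: bilinear_def)
    have "?\<Gamma> x v v = (\<Sum>i\<in>Basis. (v \<bullet> i) *\<^sub>R ?\<Gamma> x i v)" by (rule linear_basis_expand[OF l(1)])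
    also have "\<dots> = (\<Sum>i\<in>Basis. (v \<bullet> i) *\<^sub>R (\<Sum>j\<in>Basis. (v \<bullet> j) *\<^sub>R ?\<Gamma> x i j))"
      by (intro sum.cong refl arg_cong2[of _ _ _ _ scaleR] linear_basis_expand l)
    finally show ?thesis .
  qed
  have fst: "Ck_on n ?S fst" and snd: "Ck_on n ?S snd" for n
    using Ck_on_bounded_linear[OF S bounded_linear_fst Ck_on_id[OF S]] Ck_on_bounded_linear[OF S bounded_linear_snd Ck_on_id[OF S]] by auto
  have "Ck_on n ?S (\<lambda>z. \<Sum>i\<in>Basis. (snd z \<bullet> i) *\<^sub>R (\<Sum>j\<in>Basis. (snd z \<bullet> j) *\<^sub>R ?\<Gamma> (fst z) i j))" for n
    using christoffel_smooth[OF c(1)]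
    by (intro Ck_on_sum Ck_on_scaleR Ck_on_inner_const S snd
        Ck_on_compose[OF S chart_homeomorphism(2)[OF c(1)] _ fst]) (auto simp: smooth_on_def)
  then have "Ck_on n ?S (\<lambda>z. ?\<Gamma> (fst z) (snd z) (snd z))" for n
    by (rule Ck_on_cong[OF S, rotated]) (auto simp: \<Gamma>_expand)
  then have F: "smooth_on ?S ?F"
    unfolding smooth_on_def
    by (intro allI Ck_on_Pair S snd Ck_on_bounded_linear[OF S bounded_linear_minus[OF bounded_linear_ident]])
  have "(cmap ?c p, W) \<in> ?S" using c by auto
  from ode_local_solution[OF S this F] obtain e z where e: "e > 0" and z0: "z 0 = (cmap ?c p, W)"
    and z: "\<And>t. t \<in> {-e<..<e} \<Longrightarrow> z t \<in> ?S \<and> (z has_vector_derivative ?F (z t)) (at t)"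
    by blast
  let ?I = "{-e<..<e}"
  define x where "x = (\<lambda>t. fst (z t))"
  define v where "v = (\<lambda>t. snd (z t))"
  have zs: "smooth_on ?I z" by (rule ode_solution_smooth[OF open_greaterThanLessThan S F z])
  have xs: "smooth_on ?I x"
    using zs unfolding x_def smooth_on_def
    by (intro allI Ck_on_bounded_linear[OF open_greaterThanLessThan bounded_linear_fst]) blast
  have x: "x t \<in> cimg ?c" "(x has_vector_derivative v t) (at t)"
    "(v has_vector_derivative - ?\<Gamma> (x t) (v t) (v t)) (at t)" if "t \<in> ?I" for t
    using z[OF that] bounded_linear.has_vector_derivative[OF bounded_linear_fst, of z "?F (z t)" "at t"]
      bounded_linear.has_vector_derivative[OF bounded_linear_snd, of z "?F (z t)" "at t"]
    by (auto simp: x_def v_def)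
  define \<gamma> where "\<gamma> t = cinv ?c (x t)" for t
  have \<gamma>c: "\<gamma> t \<in> cdom ?c" "cmap ?c (\<gamma> t) = x t" if "t \<in> ?I" for t
    using cinv_in[OF c(1) x(1)[OF that]] cmap_cinv[OF c(1) x(1)[OF that]] by (simp_all add: \<gamma>_def)
  have curve: "smooth_curve M ?I \<gamma>"
    unfolding smooth_curve_def
  proof (intro conjI ballI)
    have "continuous_on ?I x" using xs Ck_on.simps(1) unfolding smooth_on_def by blast
    moreover have "continuous_on (cimg ?c) (cinv ?c)"
      using chart_homeomorphism(3)[OF c(1)] by (simp add: homeomorphism_def)
    ultimately show cont: "continuous_on ?I \<gamma>"
      unfolding \<gamma>_def using x(1) by (intro continuous_on_compose2[of "cimg ?c" "cinv ?c" ?I x]) auto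
    fix d assume d: "d \<in> atlas M"
    have o: "open (?I \<inter> \<gamma> -` cdom d)"
      by (rule continuous_open_preimage[OF cont open_greaterThanLessThan chart_homeomorphism(1)[OF d]])
    have "smooth_on (?I \<inter> \<gamma> -` cdom d) (\<lambda>t. (cmap d \<circ> cinv ?c) (x t))"
    proof (rule smooth_on_compose[OF o open_chart_image[OF c(1) chart_homeomorphism(1)[OF d]] _ _ transition_smooth[OF c(1) d]])
      show "x ` (?I \<inter> \<gamma> -` cdom d) \<subseteq> cmap ?c ` (cdom ?c \<inter> cdom d)"
        using x(1) by (auto simp: chart_image_iff[OF c(1)] \<gamma>_def)
      show "smooth_on (?I \<inter> \<gamma> -` cdom d) x" by (rule smooth_on_subset[OF xs]) blast
    qed
    then show "smooth_on (?I \<inter> \<gamma> -` cdom d) (cmap d \<circ> \<gamma>)" by (simp add: \<gamma>_def o_def)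
  qed (use e in \<open>auto simp: is_interval_def intro: dual_order.strict_trans1 dual_order.strict_trans2\<close>)
  have vel: "comps M ?c (\<gamma> t) (velocity M \<gamma> t) = v t" if t: "t \<in> ?I" for t
  proof -
    have "(x has_vector_derivative comps M ?c (\<gamma> t) (velocity M \<gamma> t)) (at t)"
      by (rule has_vector_derivative_transform_within_open[OF smooth_curve_velocity[OF curve t c(1) \<gamma>c(1)[OF t]] open_greaterThanLessThan t])
        (simp add: \<gamma>c(2))
    from vector_derivative_unique_at[OF this x(2)[OF t]] show ?thesis .
  qed
  \<comment> \<open>\<open>nabla_along\<close> is formed in the preferred chart of
    \<open>\<gamma> t\<close>, which may differ from that of \<open>p\<close>. Differentiating the
    transformed velocity produces a second derivative of the transition map, and the transformation
    law of the symbols cancels it.\<close>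
  have "nabla_along M \<gamma> (velocity M \<gamma>) t = 0" if t: "t \<in> ?I" for t
  proof -
    let ?e = "chart_at M (\<gamma> t)"
    let ?\<sigma> = "cmap ?e \<circ> cinv ?c"
    let ?D = "\<lambda>x. frechet_derivative ?\<sigma> (at x)"
    let ?Z = "cmap ?c ` (cdom ?c \<inter> cdom ?e)"
    note d = chart_at[of "\<gamma> t"] and ct = c(1) \<gamma>c(1)[OF t]
    let ?I' = "?I \<inter> \<gamma> -` cdom ?e"
    note I' = smooth_curve_near[OF curve t d]
    have Z: "x r \<in> ?Z" if "r \<in> ?I'" for r
      using that x(1) by (auto simp: chart_image_iff[OF c(1)] \<gamma>_def)
    have "((\<lambda>r. ?D (x r) (v r)) has_vector_derivative
      frechet_derivative (\<lambda>x. ?D x (v t)) (at (x t)) (v t) + ?D (x t) (- ?\<Gamma> (x t) (v t) (v t))) (at t)"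
      by (rule linear_field_along_curve[OF open_chart_image[OF c(1) chart_homeomorphism(1)[OF d(1)]]
            jac_smooth[OF c(1) d(1)] _ I' Z x(2,3)[OF t]])
        (rule has_derivative_linear[OF smooth_on_has_derivative[OF transition_smooth[OF c(1) d(1)]]])
    then have "((\<lambda>r. comps M ?e (\<gamma> r) (velocity M \<gamma> r)) has_vector_derivative
      frechet_derivative (\<lambda>x. ?D x (v t)) (at (x t)) (v t) + ?D (x t) (- ?\<Gamma> (x t) (v t) (v t))) (at t)"
    proof (rule has_vector_derivative_transform_within_open[OF _ I'])
      fix r assume r: "r \<in> ?I'"
      then have "comps M ?e (\<gamma> r) (velocity M \<gamma> r) = jac ?c ?e (\<gamma> r) (v r)"
        using jac_comps[OF c(1) \<gamma>c(1) d(1), of r "velocity M \<gamma> r"] vel[of r] by auto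
      then show "?D (x r) (v r) = comps M ?e (\<gamma> r) (velocity M \<gamma> r)" using r \<gamma>c(2) by (simp add: jac_def)
    qed
    from nabla_along_eq[OF this]
    have 1: "nabla_along M \<gamma> (velocity M \<gamma>) t =
      frechet_derivative (\<lambda>x. ?D x (v t)) (at (x t)) (v t) + jac ?c ?e (\<gamma> t) (- ?\<Gamma> (x t) (v t) (v t)) +
      christoffel M ?e (cmap ?e (\<gamma> t)) (velocity M \<gamma> t) (velocity M \<gamma> t)"
      using \<gamma>c(2)[OF t] by (simp add: jac_def)
    have 2: "velocity M \<gamma> t = jac ?c ?e (\<gamma> t) (v t)"
      using jac_comps[OF ct d, of "velocity M \<gamma> t"] vel[OF t] by (simp add: comps_chart_at)
    show ?thesis
      unfolding 1 unfolding 2 christoffel_transition[OF ct d] \<gamma>c(2)[OF t]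
      by (simp add: linear_neg[OF jac_linear[OF c(1) d(1) ct(2) d(2)]])
  qed
  then have "geodesic M ?I \<gamma>" using curve by (simp add: geodesic_def)
  moreover have \<gamma>0: "\<gamma> 0 = p" using z0 by (simp add: \<gamma>_def x_def cinv_cmap[OF c])
  moreover have "velocity M \<gamma> 0 = W"
    using vel[of 0] e z0 by (simp add: \<gamma>0 comps_chart_at v_def)
  ultimately show thesis using that e by blast
qed

end

section \<open>Horizontal projection of a Riemannian submersion\<close>

context manifold_setup
begin

text \<open>The nearly Kaehler condition quantifies over globally smooth fields; a field with
  constant components in the preferred chart of \<open>p\<close>, cut off by a bump function, brings
  it to bear on a single tangent vector.\<close>

lemma global_field_exists:
  obtains E where "smooth_vector_field M E" "E p = W"
proof -
  let ?c = "chart_at M p"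
  note c = chart_at[of p]
  have "cmap ?c p \<in> cimg ?c" using c by blast
  then obtain r where r: "r > 0" "cball (cmap ?c p) r \<subseteq> cimg ?c"
    using chart_homeomorphism(2)[OF c(1)] open_contains_cball by blast
  from smooth_bump[OF r(1)] obtain \<rho> :: "'a \<Rightarrow> real" where \<rho>: "smooth_on UNIV \<rho>" "\<rho> (cmap ?c p) = 1"
    "\<And>x. x \<notin> cball (cmap ?c p) r \<Longrightarrow> \<rho> x = 0" by blast
  let ?K = "cinv ?c ` cball (cmap ?c p) r"
  have "continuous_on (cball (cmap ?c p) r) (cinv ?c)"
    using chart_homeomorphism(3)[OF c(1)] r(2) continuous_on_subset by (auto simp: homeomorphism_def)
  \<comment> \<open>\<open>?K\<close> is compact and hence closed by the Hausdorff property, so the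
    field vanishes on an open set containing all points outside the chart.\<close>
  then have K: "open (- ?K)"
    by (intro open_Compl compact_imp_closed compact_continuous_image compact_cball)
  define E where "E q = (if q \<in> cdom ?c then \<rho> (cmap ?c q) *\<^sub>R of_comps M ?c q W else 0)" for q
  have E0: "E q = 0" if "q \<notin> ?K" for q
  proof (cases "q \<in> cdom ?c")
    case True
    then have "cmap ?c q \<notin> cball (cmap ?c p) r" using that cinv_cmap[OF c(1) True] by (metis imageI)
    then show ?thesis using \<rho>(3) by (simp add: E_def)
  qed (simp add: E_def)
  have "Ck_on n (cimg d) (\<lambda>x. comps M d (cinv d x) (E (cinv d x)))" if d: "d \<in> atlas M" for d n
  proof (rule Ck_on_local)
    fix x assume x: "x \<in> cimg d"
    show "\<exists>T. open T \<and> x \<in> T \<and> Ck_on n T (\<lambda>x. comps M d (cinv d x) (E (cinv d x)))"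
    proof (cases "cinv d x \<in> cdom ?c")
      case True
      let ?T = "cmap d ` (cdom d \<inter> cdom ?c)" and ?T' = "cmap ?c ` (cdom ?c \<inter> cdom d)"
      let ?\<tau> = "cmap ?c \<circ> cinv d"
      have T: "open ?T" by (rule open_chart_image[OF d chart_homeomorphism(1)[OF c(1)]])
      have T': "open ?T'" by (rule open_chart_image[OF c(1) chart_homeomorphism(1)[OF d]])
      have \<tau>T: "?\<tau> ` ?T \<subseteq> ?T'" by (auto simp: cinv_cmap[OF d])
      have \<tau>: "Ck_on n ?T ?\<tau>" using transition_smooth[OF d c(1)] by (simp add: smooth_on_def)
      have "Ck_on n ?T (\<lambda>x. \<rho> (?\<tau> x) *\<^sub>R frechet_derivative (cmap d \<circ> cinv ?c) (at (?\<tau> x)) W)"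
      proof (intro Ck_on_scaleR T)
        show "Ck_on n ?T (\<lambda>x. \<rho> (?\<tau> x))"
          by (rule Ck_on_compose[OF T open_UNIV _ \<tau>]) (use \<rho>(1) in \<open>auto simp: smooth_on_def\<close>)
        show "Ck_on n ?T (\<lambda>x. frechet_derivative (cmap d \<circ> cinv ?c) (at (?\<tau> x)) W)"
          by (rule Ck_on_compose[OF T T' \<tau>T \<tau>]) (rule jac_smooth[OF c(1) d, unfolded smooth_on_def, rule_format])
      qed
      then have "Ck_on n ?T (\<lambda>x. comps M d (cinv d x) (E (cinv d x)))"
      proof (rule Ck_on_cong[OF T, rotated])
        fix y assume y: "y \<in> ?T"
        then have q: "cinv d y \<in> cdom d" "cinv d y \<in> cdom ?c" by (auto simp: cinv_cmap[OF d])
        show "\<rho> (?\<tau> y) *\<^sub>R frechet_derivative (cmap d \<circ> cinv ?c) (at (?\<tau> y)) W = comps M d (cinv d y) (E (cinv d y))"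
          using comps_of_comps_jac[OF c(1) q(2) d q(1)] q linear_scale[OF comps_linear[OF d q(1)]]
          by (simp add: E_def jac_def)
      qed
      moreover have "x \<in> ?T" using True x by (simp only: chart_image_iff[OF d])
      ultimately show ?thesis using T by blast
    next
      case False
      let ?T = "cmap d ` (cdom d \<inter> - ?K)"
      have T: "open ?T" by (rule open_chart_image[OF d K])
      have "cinv d x \<in> - ?K"
      proof (rule ComplI)
        assume "cinv d x \<in> ?K"
        then obtain y where "cinv d x = cinv ?c y" "y \<in> cball (cmap ?c p) r" by (rule imageE)
        with False cinv_in[OF c(1), of y] subsetD[OF r(2), of y] show False by simp
      qed
      with x have "x \<in> ?T" unfolding chart_image_iff[OF d] by (rule conjI)
      moreover have "Ck_on n ?T (\<lambda>x. comps M d (cinv d x) (E (cinv d x)))"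
      proof (rule Ck_on_cong[OF T _ Ck_on_const[of _ _ 0]])
        fix y assume "y \<in> ?T"
        then have "cinv d y \<in> cdom d" "cinv d y \<notin> ?K" by (auto simp: cinv_cmap[OF d])
        then show "0 = comps M d (cinv d y) (E (cinv d y))"
          using E0 linear_0[OF comps_linear[OF d]] by simp
      qed
      ultimately show ?thesis using T by blast
    qed
  qed
  then have "smooth_vector_field M E" by (simp add: smooth_vector_field_def smooth_on_def)
  moreover have "E p = W" using c \<rho>(2) by (simp add: E_def comps_chart_at)
  ultimately show thesis by (rule that)
qed

end

locale submersion_setup =
  fixes M :: "('m::{t2_space,second_countable_topology}, 'a::euclidean_space) manifold"
    and N :: "('n::{t2_space,second_countable_topology}, 'b::euclidean_space) manifold"
    and \<pi> :: "'m \<Rightarrow> 'n"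
  assumes submersion: "riemannian_submersion M N \<pi>"

sublocale submersion_setup \<subseteq> riemannian_setup M
  using submersion by unfold_locales (simp add: riemannian_submersion_def)

sublocale submersion_setup \<subseteq> N: riemannian_setup N
  using submersion by unfold_locales (simp add: riemannian_submersion_def)

context submersion_setup
begin

abbreviation hs where "hs \<equiv> horizontal_space M N \<pi>"
abbreviation vs where "vs \<equiv> vertical_space M N \<pi>"
abbreviation hh where "hh \<equiv> hor M N \<pi>"
abbreviation vv where "vv \<equiv> ver M N \<pi>"
abbreviation L where "L \<equiv> differential M N \<pi>"

abbreviation Floc where "Floc c d \<equiv> cmap d \<circ> \<pi> \<circ> cinv c"

lemma pi_smooth:
  "c \<in> atlas M \<Longrightarrow> d \<in> atlas N \<Longrightarrow> smooth_on (cmap c ` (cdom c \<inter> \<pi> -` cdom d)) (Floc c d)"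
  "continuous_on UNIV \<pi>"
  using submersion by (auto simp: riemannian_submersion_def smooth_map_def)

lemma open_pi_vimage: "open U \<Longrightarrow> open (\<pi> -` U)"
  using continuous_open_vimage pi_smooth(2) by (simp add: continuous_on_eq_continuous_at open_vimage)

lemma Floc_has_derivative:
  assumes "c \<in> atlas M" "q \<in> cdom c" "d \<in> atlas N" "\<pi> q \<in> cdom d"
  shows "(Floc c d has_derivative frechet_derivative (Floc c d) (at (cmap c q))) (at (cmap c q))"
  by (rule smooth_on_has_derivative[OF pi_smooth(1)[OF assms(1,3)]]) (use assms in blast)

lemma differential_linear: "linear (L p)"
  unfolding differential_def
  by (rule has_derivative_linear[OF Floc_has_derivative]) (use chart_at N.chart_at in auto)

lemma differential_comps:
  assumes c: "c \<in> atlas M" "q \<in> cdom c" and d: "d \<in> atlas N" "\<pi> q \<in> cdom d"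
  shows "comps N d (\<pi> q) (L q v) = frechet_derivative (Floc c d) (at (cmap c q)) (comps M c q v)"
proof -
  let ?e = "chart_at M q" and ?e' = "chart_at N (\<pi> q)"
  note e = chart_at[of q] and e' = N.chart_at[of "\<pi> q"]
  let ?x = "cmap ?e q"
  let ?U = "cdom c \<inter> \<pi> -` (cdom d \<inter> cdom ?e')"
  let ?T = "cmap ?e ` (cdom ?e \<inter> ?U)"
  have T: "open ?T" "?x \<in> ?T"
    using open_chart_image[OF e(1), of ?U] chart_homeomorphism(1)[OF c(1)]
      open_pi_vimage[OF open_Int[OF N.chart_homeomorphism(1)[OF d(1)] N.chart_homeomorphism(1)[OF e'(1)]]] c d e e'
    by auto
  have 1: "(Floc c d \<circ> (cmap c \<circ> cinv ?e) has_derivative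
      (frechet_derivative (Floc c d) (at (cmap c q)) \<circ> jac ?e c q)) (at ?x)"
    by (rule diff_chain_at[OF jac_has_derivative[OF e(1) c(1) e(2) c(2)]])
      (simp add: cinv_cmap[OF e] Floc_has_derivative[OF c d])
  have 2: "((cmap d \<circ> cinv ?e') \<circ> Floc ?e ?e' has_derivative (N.jac ?e' d (\<pi> q) \<circ> L q)) (at ?x)"
    unfolding differential_def
    by (rule diff_chain_at[OF Floc_has_derivative[OF e e']])
      (simp add: cinv_cmap[OF e] N.jac_has_derivative[OF e'(1) d(1) e'(2) d(2)])
  have "(Floc c d \<circ> (cmap c \<circ> cinv ?e) has_derivative (N.jac ?e' d (\<pi> q) \<circ> L q)) (at ?x)"
    by (rule has_derivative_transform_within_open[OF 2 T])
      (auto simp: cinv_cmap[OF e(1)] cinv_cmap[OF c(1)] N.cinv_cmap[OF e'(1)])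
  from fun_cong[OF has_derivative_unique[OF this 1], of v] show ?thesis
    by (simp add: comps_jac N.comps_jac)
qed

lemma horizontal_linear:
  assumes "x \<in> hs p" "y \<in> hs p"
  shows "x + y \<in> hs p" "x - y \<in> hs p" "r *\<^sub>R x \<in> hs p" "0 \<in> hs p"
  using assms by (auto simp: horizontal_space_def form_simps[OF metric_form])

lemma vertical_linear:
  assumes "x \<in> vs p" "y \<in> vs p"
  shows "x + y \<in> vs p" "x - y \<in> vs p" "r *\<^sub>R x \<in> vs p" "0 \<in> vs p"
  using assms linear_add[OF differential_linear] linear_diff[OF differential_linear]
    linear_scale[OF differential_linear] linear_0[OF differential_linear]
  by (auto simp: vertical_space_def)

lemma differential_isometry:
  assumes "x \<in> hs p" "y \<in> hs p"
  shows "metric N (\<pi> p) (L p x) (L p y) = metric M p x y"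
proof -
  have sq: "metric N (\<pi> p) (L p x) (L p x) = metric M p x x" if "x \<in> hs p" for x
    using submersion that by (auto simp: riemannian_submersion_def gnorm_def)
  have "metric N (\<pi> p) (L p x + L p y) (L p x + L p y) = metric M p (x + y) (x + y)"
    using sq[OF horizontal_linear(1)[OF assms]] by (simp add: linear_add[OF differential_linear])
  then show ?thesis
    unfolding form_simps(1,2)[OF metric_form] form_simps(1,2)[OF N.metric_form]
      form_sym[OF metric_form, of _ y x] form_sym[OF N.metric_form, of _ "L p y" "L p x"] sq[OF assms(1)] sq[OF assms(2)]
    by simp
qed

lemma horizontal_part_unique:
  assumes "x \<in> hs p" "w - x \<in> vs p" "x' \<in> hs p" "w - x' \<in> vs p"
  shows "x = x'"
proof -
  have "x - x' \<in> hs p" by (rule horizontal_linear(2)[OF assms(1,3)])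
  moreover have "x - x' \<in> vs p" using vertical_linear(2)[OF assms(4,2)] by simp
  ultimately have "metric M p (x - x') (x - x') = 0" by (simp add: horizontal_space_def)
  then show ?thesis by (simp add: form_eq_0_iff[OF metric_form])
qed

text \<open>The horizontal part of \<open>w\<close> is the vector that represents the pulled back functional
  \<open>h(d\<pi> w, d\<pi> \<cdot>)\<close>. This gives existence without dimension counting, and the smooth dependence on the
  base point.\<close>

lemma horizontal_part_exists:
  obtains x where "x \<in> hs p" "w - x \<in> vs p" "\<And>w'. metric M p x w' = metric N (\<pi> p) (L p w) (L p w')"
proof -
  have rep: "\<exists>x. \<forall>w'. metric M p x w' = metric N (\<pi> p) y (L p w')" for y
    using form_representation[OF metric_form linear_compose[OF differential_linear form_linear(1)[OF N.metric_form]], of p "\<pi> p" y p]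
    by (metis o_apply)
  have hs: "x \<in> hs p" if "\<forall>w'. metric M p x w' = metric N (\<pi> p) y (L p w')" for x y
    using that by (simp add: horizontal_space_def vertical_space_def form_simps[OF N.metric_form])
  obtain x where x: "\<forall>w'. metric M p x w' = metric N (\<pi> p) (L p w) (L p w')" using rep by blast
  \<comment> \<open>\<open>z\<close> represents what \<open>x\<close> misses. Both are horizontal,
    so the isometry property gives \<open>metric M p z z = 0\<close>; surjectivity of the
    differential then turns the vanishing pairings into \<open>L p w = L p x\<close>.\<close>
  obtain z where z: "\<forall>w'. metric M p z w' = metric N (\<pi> p) (L p w - L p x) (L p w')" using rep by blast
  have "metric M p z z = metric N (\<pi> p) (L p w) (L p z) - metric N (\<pi> p) (L p x) (L p z)"
    using z by (simp add: form_simps[OF N.metric_form])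
  also have "\<dots> = 0" using x differential_isometry[OF hs[OF x] hs[OF z]] by simp
  finally have "z = 0" by (simp add: form_eq_0_iff[OF metric_form])
  then have *: "metric N (\<pi> p) (L p w - L p x) (L p w') = 0" for w'
    using z form_simps(7)[OF metric_form] by metis
  have "surj (L p)" using submersion by (simp add: riemannian_submersion_def)
  then obtain w' where "L p w - L p x = L p w'" by (metis surjD)
  with *[of w'] have "L p (w - x) = 0"
    by (simp add: form_eq_0_iff[OF N.metric_form] linear_diff[OF differential_linear])
  then show thesis using that[OF hs[OF x]] x by (simp add: vertical_space_def)
qed

lemma hor:
  shows "hh p w \<in> hs p" "w - hh p w \<in> vs p" "metric M p (hh p w) w' = metric N (\<pi> p) (L p w) (L p w')"
proof -
  obtain x where x: "x \<in> hs p" "w - x \<in> vs p" "\<And>w'. metric M p x w' = metric N (\<pi> p) (L p w) (L p w')"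
    using horizontal_part_exists by blast
  have "hh p w = x" unfolding hor_def
    by (rule the_equality) (use x horizontal_part_unique in blast)+
  with x show "hh p w \<in> hs p" "w - hh p w \<in> vs p" "metric M p (hh p w) w' = metric N (\<pi> p) (L p w) (L p w')"
    by simp_all
qed

lemma hor_eqI: "x \<in> hs p \<Longrightarrow> w - x \<in> vs p \<Longrightarrow> hh p w = x"
  using horizontal_part_unique hor by blast

lemma ver_eq: "vv p w = w - hh p w"
  unfolding ver_def
proof (rule the_equality)
  show "w - hh p w \<in> vs p \<and> w - (w - hh p w) \<in> hs p" using hor by simp
  show "u = w - hh p w" if "u \<in> vs p \<and> w - u \<in> hs p" for u
    using hor_eqI[of "w - u" p w] that by simp
qed

lemma ver_in: "vv p w \<in> vs p"
  by (simp add: ver_eq hor)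

lemma hor_horizontal: "x \<in> hs p \<Longrightarrow> hh p x = x"
  by (rule hor_eqI) (simp_all add: vertical_linear(4)[OF ver_in ver_in])

lemma hor_linear: "linear (hh p)"
  by (intro linearI form_eqI[OF metric_form[of p]])
    (simp_all add: form_simps[OF metric_form] form_simps[OF N.metric_form] hor(3)
      linear_add[OF differential_linear] linear_scale[OF differential_linear])

lemma hor_selfadjoint: "metric M p (hh p v) w = metric M p v (hh p w)"
  using hor(3)[of p v w] hor(3)[of p w v] form_sym[OF metric_form] form_sym[OF N.metric_form] by metis

lemma metric_hor_ver: "x \<in> hs p \<Longrightarrow> u \<in> vs p \<Longrightarrow> metric M p x u = 0" "x \<in> hs p \<Longrightarrow> u \<in> vs p \<Longrightarrow> metric M p u x = 0"
  using form_sym[OF metric_form] by (auto simp: horizontal_space_def)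

section \<open>Smoothness of the horizontal projection\<close>

definition Phor :: "('m, 'a) chart \<Rightarrow> 'a \<Rightarrow> 'a \<Rightarrow> 'a" where
  "Phor c x v = comps M c (cinv c x) (hh (cinv c x) (of_comps M c (cinv c x) v))"

lemma Phor_comps:
  "c \<in> atlas M \<Longrightarrow> q \<in> cdom c \<Longrightarrow> comps M c q (hh q w) = Phor c (cmap c q) (comps M c q w)"
  by (simp add: Phor_def cinv_cmap of_comps_comps)

lemma Phor_linear: "c \<in> atlas M \<Longrightarrow> x \<in> cimg c \<Longrightarrow> linear (Phor c x)"
  unfolding Phor_def
  using linear_compose[OF linear_compose[OF of_comps_linear hor_linear] comps_linear] cinv_in
  by (simp add: o_def)

text \<open>By \<open>hor\<close>, the projection of a fixed vector solves a linear system with the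
  metric of \<open>M\<close> as coefficients and the pulled back metric of \<open>N\<close> on the
  right-hand side. The argument is local, as a chart of \<open>N\<close> may cover only part of the
  image.\<close>

lemma Phor_smooth:
  assumes c: "c \<in> atlas M"
  shows "smooth_on (cimg c) (\<lambda>x. Phor c x v)"
proof -
  have "Ck_on n (cimg c) (\<lambda>x. Phor c x v)" for n
  proof (rule Ck_on_local)
    fix x assume x: "x \<in> cimg c"
    let ?d = "chart_at N (\<pi> (cinv c x))"
    note d = N.chart_at[of "\<pi> (cinv c x)"]
    let ?S = "cmap c ` (cdom c \<inter> \<pi> -` cdom ?d)"
    let ?F = "Floc c ?d"
    let ?D = "\<lambda>x. frechet_derivative ?F (at x)"
    have S: "open ?S" by (rule open_chart_image[OF c open_pi_vimage[OF N.chart_homeomorphism(1)[OF d(1)]]])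
    have Sc: "?S \<subseteq> cimg c" by blast
    have F: "Ck_on n ?S ?F" for n using pi_smooth(1)[OF c d(1)] by (simp add: smooth_on_def)
    have D: "Ck_on n ?S (\<lambda>x. ?D x v)" for n v
      using smooth_on_frechet_derivative[OF pi_smooth(1)[OF c d(1)]] by (simp add: smooth_on_def)
    have FS: "?F ` ?S \<subseteq> N.cimg ?d" by (auto simp: cinv_cmap[OF c])
    let ?\<beta> = "\<lambda>x w. N.mc ?d (?F x) (?D x v) (?D x w)"
    have sol: "mc c y (Phor c y v) w = ?\<beta> y w" if y: "y \<in> ?S" for y w
    proof -
      let ?q = "cinv c y"
      have q: "?q \<in> cdom c" "\<pi> ?q \<in> cdom ?d" "cmap c ?q = y" using y by (auto simp: cinv_cmap[OF c])
      have "mc c y (Phor c y v) w = metric M ?q (hh ?q (of_comps M c ?q v)) (of_comps M c ?q w)"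
        using metric_mc[OF c q(1)] by (simp add: q(3) comps_of_comps[OF c q(1)] Phor_def)
      also have "\<dots> = ?\<beta> y w"
        unfolding hor(3) N.metric_mc[OF d(1) q(2)] differential_comps[OF c q(1) d(1) q(2)] comps_of_comps[OF c q(1)] q(3)
        by simp
      finally show ?thesis .
    qed
    have \<beta>: "Ck_on n ?S (\<lambda>x. ?\<beta> x w)" for w n
    proof -
      have "Ck_on n ?S (\<lambda>x. \<Sum>i\<in>Basis. \<Sum>j\<in>Basis. (?D x v \<bullet> i) * (?D x w \<bullet> j) * N.mc ?d (?F x) i j)"
        using N.mc_smooth[OF d(1)]
        by (intro Ck_on_sum Ck_on_mult Ck_on_inner_const S D Ck_on_compose[OF S N.chart_homeomorphism(2)[OF d(1)] FS F])
          (simp add: smooth_on_def)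
      then show ?thesis
        by (rule Ck_on_cong[OF S, rotated]) (rule N.mc_expand[OF d(1), symmetric], use FS in blast)
    qed
    have "Ck_on n ?S (\<lambda>x. Phor c x v)"
    proof (rule Ck_on_solution[where G = "mc c" and \<beta> = ?\<beta>, OF S _ _ sol \<beta>])
      show "pos_def_form (mc c y)" if "y \<in> ?S" for y using mc_form[OF c] that Sc by blast
      show "smooth_on ?S (\<lambda>x. mc c x v w)" for v w by (rule smooth_on_subset[OF mc_smooth[OF c] Sc])
    qed
    moreover have "x \<in> ?S" using x d(2) by (simp add: chart_image_iff[OF c])
    ultimately show "\<exists>T. open T \<and> x \<in> T \<and> Ck_on n T (\<lambda>x. Phor c x v)" using S by blast
  qed
  then show ?thesis by (simp add: smooth_on_def)
qed

end

section \<open>Nearly Kaehler structure and the covariant derivative of the horizontal velocity\<close>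

context riemannian_setup
begin

section \<open>Covariant derivatives of (1,1)-tensors in components\<close>

definition tensor_comps :: "('m \<Rightarrow> 'a \<Rightarrow> 'a) \<Rightarrow> ('m, 'a) chart \<Rightarrow> 'a \<Rightarrow> 'a \<Rightarrow> 'a" where
  "tensor_comps \<phi> c x v = comps M c (cinv c x) (\<phi> (cinv c x) (of_comps M c (cinv c x) v))"

lemma tensor_comps_comps:
  "c \<in> atlas M \<Longrightarrow> q \<in> cdom c \<Longrightarrow> comps M c q (\<phi> q w) = tensor_comps \<phi> c (cmap c q) (comps M c q w)"
  by (simp add: tensor_comps_def cinv_cmap of_comps_comps)

lemma tensor_comps_chart_at: "tensor_comps \<phi> (chart_at M p) (cmap (chart_at M p) p) v = \<phi> p v"
  by (simp add: tensor_comps_def cinv_cmap[OF chart_at] comps_chart_at)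

lemma tensor_comps_linear:
  assumes "smooth_tensor11 M \<phi>" "c \<in> atlas M" "x \<in> cimg c"
  shows "linear (tensor_comps \<phi> c x)"
proof -
  have "linear (\<phi> (cinv c x))" using assms(1) by (simp add: smooth_tensor11_def)
  from linear_compose[OF linear_compose[OF of_comps_linear[OF assms(2) cinv_in[OF assms(2,3)]] this]
      comps_linear[OF assms(2) cinv_in[OF assms(2,3)]]]
  show ?thesis by (simp add: o_def tensor_comps_def[abs_def])
qed

lemma tensor_comps_smooth:
  "smooth_tensor11 M \<phi> \<Longrightarrow> c \<in> atlas M \<Longrightarrow> smooth_on (cimg c) (\<lambda>x. tensor_comps \<phi> c x v)"
  by (simp add: smooth_tensor11_def tensor_comps_def)

lemma nabla_eq:
  assumes "((\<lambda>x. comps M (chart_at M p) (cinv (chart_at M p) x) (F (cinv (chart_at M p) x))) has_derivative D)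
    (at (cmap (chart_at M p) p))"
  shows "nabla M p v F = D v + christoffel M (chart_at M p) (cmap (chart_at M p) p) v (F p)"
  unfolding nabla_def Let_def frechet_derivative_at[OF assms, symmetric] ..

text \<open>The derivative \<open>E'\<close> of the field cancels between the two terms of
  \<open>nabla_tensor\<close>. The value depends on \<open>E p\<close> alone, so global fields and
  \<open>extend\<close> give the same result.\<close>

lemma nabla_tensor_eq:
  assumes \<phi>: "smooth_tensor11 M \<phi>"
    and E: "((\<lambda>x. comps M (chart_at M p) (cinv (chart_at M p) x) (E (cinv (chart_at M p) x))) has_derivative E')
      (at (cmap (chart_at M p) p))"
  shows "nabla_tensor M \<phi> p v E =
    frechet_derivative (\<lambda>x. tensor_comps \<phi> (chart_at M p) x (E p)) (at (cmap (chart_at M p) p)) v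
    + christoffel M (chart_at M p) (cmap (chart_at M p) p) v (\<phi> p (E p))
    - \<phi> p (christoffel M (chart_at M p) (cmap (chart_at M p) p) v (E p))"
proof -
  let ?c = "chart_at M p"
  let ?x = "cmap ?c p" and ?E = "\<lambda>x. comps M ?c (cinv ?c x) (E (cinv ?c x))"
  note c = chart_at[of p]
  have x: "?x \<in> cimg ?c" using c by blast
  have Ex: "?E ?x = E p" by (simp add: cinv_cmap[OF c] comps_chart_at)
  have "((\<lambda>y. tensor_comps \<phi> ?c y (?E y)) has_derivative
      (\<lambda>h. frechet_derivative (\<lambda>x. tensor_comps \<phi> ?c x (?E ?x)) (at ?x) h + tensor_comps \<phi> ?c ?x (E' h))) (at ?x)"
    by (rule linear_field_product_rule[OF chart_homeomorphism(2)[OF c(1)] tensor_comps_smooth[OF \<phi> c(1)]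
          tensor_comps_linear[OF \<phi> c(1)] chart_homeomorphism(2)[OF c(1)] x _ has_derivative_ident E])
  then have "((\<lambda>x. comps M ?c (cinv ?c x) (\<phi> (cinv ?c x) (E (cinv ?c x)))) has_derivative
      (\<lambda>h. frechet_derivative (\<lambda>x. tensor_comps \<phi> ?c x (E p)) (at ?x) h + \<phi> p (E' h))) (at ?x)"
    unfolding Ex tensor_comps_chart_at
    by (rule has_derivative_transform_within_open[OF _ chart_homeomorphism(2)[OF c(1)] x])
      (simp add: tensor_comps_def of_comps_comps[OF c(1) cinv_in[OF c(1)]])
  note 1 = nabla_eq[OF this, of v]
  have "linear (\<phi> p)" using \<phi> by (simp add: smooth_tensor11_def)
  then show ?thesis unfolding nabla_tensor_def 1 nabla_eq[OF E] by (simp add: linear_add)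
qed

lemma comps_extend_derivative:
  "((\<lambda>x. comps M (chart_at M p) (cinv (chart_at M p) x) (extend M p w (cinv (chart_at M p) x))) has_derivative (\<lambda>_. 0))
    (at (cmap (chart_at M p) p))"
proof (rule has_derivative_transform_within_open[OF has_derivative_const])
  show "open (cimg (chart_at M p))" "cmap (chart_at M p) p \<in> cimg (chart_at M p)"
    using chart_homeomorphism(2) chart_at by auto
  show "w = comps M (chart_at M p) (cinv (chart_at M p) x) (extend M p w (cinv (chart_at M p) x))"
    if "x \<in> cimg (chart_at M p)" for x
    using cinv_in[OF chart_at(1) that] by (simp add: extend_def comps_of_comps[OF chart_at(1)])
qed

lemma extend_at: "extend M p w p = w"
  by (simp add: extend_def chart_at comps_chart_at)

end

locale clairaut_setup =
  fixes M :: "('m::{t2_space,second_countable_topology}, 'a::euclidean_space) manifold"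
    and N :: "('n::{t2_space,second_countable_topology}, 'b::euclidean_space) manifold"
    and \<phi> :: "'m \<Rightarrow> 'a \<Rightarrow> 'a"
    and \<pi> :: "'m \<Rightarrow> 'n"
  assumes nearly_kaehler: "nearly_kaehler M \<phi>"
    and anti_invariant: "anti_invariant_submersion M \<phi> N \<pi>"

sublocale clairaut_setup \<subseteq> submersion_setup M N \<pi>
  using anti_invariant by unfold_locales (simp add: anti_invariant_submersion_def)

context clairaut_setup
begin

lemma almost_complex:
  "smooth_tensor11 M \<phi>" "linear (\<phi> p)" "\<phi> p (\<phi> p v) = - v" "metric M p (\<phi> p v) (\<phi> p w) = metric M p v w"
  using nearly_kaehler by (auto simp: nearly_kaehler_def almost_hermitian_def smooth_tensor11_def)

lemma \<phi>_vertical: "u \<in> vs p \<Longrightarrow> \<phi> p u \<in> hs p"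
  using anti_invariant by (auto simp: anti_invariant_submersion_def)

abbreviation pt :: "'m \<Rightarrow> 'a" where "pt p \<equiv> cmap (chart_at M p) p"
abbreviation Gam :: "'m \<Rightarrow> 'a \<Rightarrow> 'a \<Rightarrow> 'a" where "Gam p \<equiv> christoffel M (chart_at M p) (pt p)"

text \<open>Direction first, vector second. Chart-dependent by itself, it forms the covariant
  derivative of the projection together with \<open>Gam\<close> terms; \<open>D\<phi>\<close> plays
  the same role for \<phi>.\<close>

definition DP :: "'m \<Rightarrow> 'a \<Rightarrow> 'a \<Rightarrow> 'a" where
  "DP p w v = frechet_derivative (\<lambda>x. Phor (chart_at M p) x v) (at (pt p)) w"

definition D\<phi> :: "'m \<Rightarrow> 'a \<Rightarrow> 'a \<Rightarrow> 'a" where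
  "D\<phi> p w v = frechet_derivative (\<lambda>x. tensor_comps \<phi> (chart_at M p) x v) (at (pt p)) w"

lemma pt_in: "pt p \<in> cimg (chart_at M p)"
  using chart_at by blast

lemma Phor_chart_at: "Phor (chart_at M p) (pt p) v = hh p v"
  by (simp add: Phor_def cinv_cmap[OF chart_at] comps_chart_at)

text \<open>The nearly Kaehler condition for \<open>E = F\<close>, a global extension of
  \<open>w\<close>, written out in components.\<close>

lemma nearly_kaehler_at: "D\<phi> p w w + Gam p w (\<phi> p w) - \<phi> p (Gam p w w) = 0"
proof -
  obtain E where E: "smooth_vector_field M E" "E p = w" by (rule global_field_exists)
  have "nabla_tensor M \<phi> p (E p) E + nabla_tensor M \<phi> p (E p) E = 0"
    using nearly_kaehler E(1) by (simp add: nearly_kaehler_def)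
  then have 0: "nabla_tensor M \<phi> p w E = 0" using E(2) by (simp flip: scaleR_2)
  have "smooth_on (cimg (chart_at M p)) (\<lambda>x. comps M (chart_at M p) (cinv (chart_at M p) x) (E (cinv (chart_at M p) x)))"
    using E(1) chart_at by (simp add: smooth_vector_field_def)
  from nabla_tensor_eq[OF almost_complex(1) smooth_on_has_derivative[OF this pt_in], of w] 0 E(2)
  show ?thesis by (simp add: D\<phi>_def)
qed

lemma Gam_linear: "linear (Gam p w)" "linear (\<lambda>w. Gam p w v)"
  using christoffel(1)[OF chart_at(1) pt_in] by (auto simp: bilinear_def)

lemma DP_linear: "linear (DP p w)" "linear (\<lambda>w. DP p w v)"
proof -
  note d = smooth_on_has_derivative[OF Phor_smooth[OF chart_at(1)] pt_in[of p]]
  show "linear (\<lambda>w. DP p w v)" unfolding DP_def by (rule has_derivative_linear[OF d])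
  note o = chart_homeomorphism(2)[OF chart_at(1)] and l = Phor_linear[OF chart_at(1)]
  show "linear (DP p w)"
  proof (rule linearI)
    fix v v' and r :: real
    have "((\<lambda>x. Phor (chart_at M p) x (v + v')) has_derivative (\<lambda>w. DP p w v + DP p w v')) (at (pt p))"
      unfolding DP_def
      by (rule has_derivative_transform_within_open[OF has_derivative_add[OF d d] o pt_in]) (simp add: linear_add[OF l])
    from fun_cong[OF has_derivative_unique[OF d this], of w]
    show "DP p w (v + v') = DP p w v + DP p w v'" by (simp add: DP_def)
    have "((\<lambda>x. Phor (chart_at M p) x (r *\<^sub>R v)) has_derivative (\<lambda>w. r *\<^sub>R DP p w v)) (at (pt p))"
      unfolding DP_def
      by (rule has_derivative_transform_within_open[OF has_derivative_scaleR_right[OF d] o pt_in]) (simp add: linear_scale[OF l])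
    from fun_cong[OF has_derivative_unique[OF d this], of w]
    show "DP p w (r *\<^sub>R v) = r *\<^sub>R DP p w v" by (simp add: DP_def)
  qed
qed

lemma D\<phi>_add: "D\<phi> p w (v + v') = D\<phi> p w v + D\<phi> p w v'"
proof -
  note d = smooth_on_has_derivative[OF tensor_comps_smooth[OF almost_complex(1) chart_at(1)] pt_in[of p]]
  have "((\<lambda>x. tensor_comps \<phi> (chart_at M p) x (v + v')) has_derivative (\<lambda>w. D\<phi> p w v + D\<phi> p w v')) (at (pt p))"
    unfolding D\<phi>_def
    by (rule has_derivative_transform_within_open[OF has_derivative_add[OF d d] chart_homeomorphism(2)[OF chart_at(1)] pt_in])
      (simp add: linear_add[OF tensor_comps_linear[OF almost_complex(1) chart_at(1)]])
  from fun_cong[OF has_derivative_unique[OF d this], of w] show ?thesis by (simp add: D\<phi>_def)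
qed

text \<open>Differentiating \<open>H H = H\<close> for the field \<open>H\<close> of horizontal projections.\<close>

lemma hor_DP:
  assumes "b \<in> hs p"
  shows "hh p (DP p w b) = 0"
proof -
  let ?c = "chart_at M p"
  note o = chart_homeomorphism(2)[OF chart_at(1)[of p]]
  note d = smooth_on_has_derivative[OF Phor_smooth[OF chart_at(1)] pt_in[of p]]
  have "((\<lambda>x. Phor ?c x (Phor ?c x b)) has_derivative
      (\<lambda>w. frechet_derivative (\<lambda>x. Phor ?c x (Phor ?c (pt p) b)) (at (pt p)) w
         + Phor ?c (pt p) (frechet_derivative (\<lambda>x. Phor ?c x b) (at (pt p)) w))) (at (pt p))"
    by (rule linear_field_product_rule[OF o Phor_smooth[OF chart_at(1)] Phor_linear[OF chart_at(1)] o pt_in _ has_derivative_ident d])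
  then have "((\<lambda>x. Phor ?c x b) has_derivative
      (\<lambda>w. frechet_derivative (\<lambda>x. Phor ?c x (Phor ?c (pt p) b)) (at (pt p)) w
         + Phor ?c (pt p) (frechet_derivative (\<lambda>x. Phor ?c x b) (at (pt p)) w))) (at (pt p))"
    by (rule has_derivative_transform_within_open[OF _ o pt_in])
      (simp add: Phor_def of_comps_comps[OF chart_at(1) cinv_in[OF chart_at(1)]] hor_horizontal[OF hor(1)])
  from fun_cong[OF has_derivative_unique[OF d this], of w]
  show ?thesis using assms by (simp add: Phor_chart_at hor_horizontal DP_def)
qed

text \<open>For vertical \<open>u\<close>, \<open>\<phi> p u\<close> is horizontal, so its pairing
  with the horizontal part of \<open>\<phi> p x\<close> equals \<open>metric M p x u = 0\<close>.
  Hence that horizontal part already lies in \<open>mu_space\<close>.\<close>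

lemma beta_eq:
  assumes "x \<in> hs p"
  shows "beta M \<phi> N \<pi> p x = hh p (\<phi> p x)" "alpha M \<phi> N \<pi> p x = vv p (\<phi> p x)"
proof -
  have "metric M p (hh p (\<phi> p x)) (\<phi> p u) = 0" if "u \<in> vs p" for u
    unfolding hor_selfadjoint hor_horizontal[OF \<phi>_vertical[OF that]] almost_complex(4) by (rule metric_hor_ver[OF assms that])
  then have mu: "hh p (\<phi> p x) \<in> mu_space M \<phi> N \<pi> p" by (simp add: mu_space_def hor(1))
  show "beta M \<phi> N \<pi> p x = hh p (\<phi> p x)"
    unfolding beta_def
  proof (rule the_equality)
    show "hh p (\<phi> p x) \<in> mu_space M \<phi> N \<pi> p \<and> \<phi> p x - hh p (\<phi> p x) \<in> vs p" using mu hor(2) by blast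
    show "b = hh p (\<phi> p x)" if "b \<in> mu_space M \<phi> N \<pi> p \<and> \<phi> p x - b \<in> vs p" for b
      using hor_eqI[of b p "\<phi> p x"] that by (simp add: mu_space_def)
  qed
  show "alpha M \<phi> N \<pi> p x = vv p (\<phi> p x)"
    unfolding alpha_def
  proof (rule the_equality)
    show "vv p (\<phi> p x) \<in> vs p \<and> \<phi> p x - vv p (\<phi> p x) \<in> mu_space M \<phi> N \<pi> p"
      using mu ver_in by (simp add: ver_eq)
    show "a = vv p (\<phi> p x)" if "a \<in> vs p \<and> \<phi> p x - a \<in> mu_space M \<phi> N \<pi> p" for a
      using hor_eqI[of "\<phi> p x - a" p "\<phi> p x"] that by (simp add: mu_space_def ver_eq)
  qed
qed

text \<open>\<open>g(\<nabla>\<^sub>W X, U)\<close> for the horizontal part \<open>X\<close> and the vertical part \<open>U\<close> of the velocity of a curve: it depends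
  on the velocity \<open>W\<close> alone.\<close>

definition kappa :: "'m \<Rightarrow> 'a \<Rightarrow> real" where
  "kappa p w = metric M p (DP p w w + Gam p w (hh p w)) (vv p w)"

text \<open>The acceleration \<open>W'\<close> enters only through its horizontal projection, which
  is why it drops out of pairings with vertical vectors.\<close>

lemma horizontal_velocity_derivative:
  assumes \<gamma>: "smooth_curve M J \<gamma>" and t: "t \<in> J"
    and W': "((\<lambda>r. comps M (chart_at M (\<gamma> t)) (\<gamma> r) (velocity M \<gamma> r)) has_vector_derivative W') (at t)"
  shows "((\<lambda>r. comps M (chart_at M (\<gamma> t)) (\<gamma> r) (hh (\<gamma> r) (velocity M \<gamma> r))) has_vector_derivative
    (DP (\<gamma> t) (velocity M \<gamma> t) (velocity M \<gamma> t) + hh (\<gamma> t) W')) (at t)"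
proof -
  let ?c = "chart_at M (\<gamma> t)" and ?V = "\<lambda>r. comps M (chart_at M (\<gamma> t)) (\<gamma> r) (velocity M \<gamma> r)"
  note c = chart_at[of "\<gamma> t"]
  note J = smooth_curve_near[OF \<gamma> t c]
  have x: "((cmap ?c \<circ> \<gamma>) has_vector_derivative velocity M \<gamma> t) (at t)"
    using smooth_curve_velocity[OF \<gamma> t c] by (simp only: comps_chart_at)
  have "((\<lambda>r. Phor ?c ((cmap ?c \<circ> \<gamma>) r) (?V r)) has_vector_derivative
      (frechet_derivative (\<lambda>x. Phor ?c x (?V t)) (at ((cmap ?c \<circ> \<gamma>) t)) (velocity M \<gamma> t) + Phor ?c ((cmap ?c \<circ> \<gamma>) t) W')) (at t)"
    by (rule linear_field_along_curve[OF chart_homeomorphism(2)[OF c(1)] Phor_smooth[OF c(1)] Phor_linear[OF c(1)] J _ x W'])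
      auto
  then have "((\<lambda>r. comps M ?c (\<gamma> r) (hh (\<gamma> r) (velocity M \<gamma> r))) has_vector_derivative
      (frechet_derivative (\<lambda>x. Phor ?c x (?V t)) (at ((cmap ?c \<circ> \<gamma>) t)) (velocity M \<gamma> t) + Phor ?c ((cmap ?c \<circ> \<gamma>) t) W')) (at t)"
    by (rule has_vector_derivative_transform_within_open[OF _ J]) (simp add: Phor_comps[OF c(1)])
  then show ?thesis by (simp add: DP_def comps_chart_at Phor_chart_at)
qed

lemma nabla_horizontal_velocity:
  assumes \<gamma>: "smooth_curve M J \<gamma>" and t: "t \<in> J"
  shows "metric M (\<gamma> t) (nabla_along M \<gamma> (\<lambda>r. hh (\<gamma> r) (velocity M \<gamma> r)) t) (vv (\<gamma> t) (velocity M \<gamma> t)) =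
    kappa (\<gamma> t) (velocity M \<gamma> t)"
proof -
  obtain W' where W': "((\<lambda>r. comps M (chart_at M (\<gamma> t)) (\<gamma> r) (velocity M \<gamma> r)) has_vector_derivative W') (at t)"
    using velocity_derivative[OF \<gamma> t chart_at] by blast
  show ?thesis
    unfolding nabla_along_eq[OF horizontal_velocity_derivative[OF \<gamma> t W']] kappa_def
    by (simp add: form_simps[OF metric_form] metric_hor_ver(1)[OF hor(1) ver_in])
qed

text \<open>The extension has constant components, so only the projection is differentiated; the
  vertical one is the identity minus the horizontal one, hence the sign.\<close>

lemma nabla_ver_extend:
  "nabla M p v (\<lambda>q. vv q (extend M p a q)) = - DP p v a + Gam p v (vv p a)"
proof -
  let ?c = "chart_at M p"
  note o = chart_homeomorphism(2)[OF chart_at(1)[of p]]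
  have "((\<lambda>x. a - Phor ?c x a) has_derivative (\<lambda>w. 0 - DP p w a)) (at (pt p))"
    unfolding DP_def
    by (rule has_derivative_diff[OF has_derivative_const smooth_on_has_derivative[OF Phor_smooth[OF chart_at(1)] pt_in]])
  then have "((\<lambda>x. comps M ?c (cinv ?c x) (vv (cinv ?c x) (extend M p a (cinv ?c x)))) has_derivative (\<lambda>w. 0 - DP p w a)) (at (pt p))"
  proof (rule has_derivative_transform_within_open[OF _ o pt_in])
    fix x assume x: "x \<in> cimg ?c"
    note q = cinv_in[OF chart_at(1) x]
    show "a - Phor ?c x a = comps M ?c (cinv ?c x) (vv (cinv ?c x) (extend M p a (cinv ?c x)))"
      using q by (simp add: ver_eq extend_def Phor_def linear_diff[OF comps_linear[OF chart_at(1) q]] comps_of_comps[OF chart_at(1) q])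
  qed
  from nabla_eq[OF this, of v] show ?thesis by (simp add: extend_at)
qed

text \<open>Against a horizontal \<nu> only the first summands of \<open>oneill_A\<close> and
  \<open>oneill_T\<close> survive. Both differentiate the vertical part, in the directions
  \<open>hh p w\<close> and \<open>vv p w\<close>, and linearity in the direction adds them up to
  the derivative along \<open>w\<close>.\<close>

lemma metric_A_T:
  assumes "\<nu> \<in> hs p"
  shows "metric M p (A_at M N \<pi> p (hh p w) a + T_at M N \<pi> p (vv p w) a) \<nu> =
    metric M p (- DP p w a + Gam p w (vv p a)) \<nu>"
proof -
  have h: "metric M p (hh p z) \<nu> = metric M p z \<nu>" for z
    by (simp add: hor_selfadjoint hor_horizontal[OF assms])
  have v: "metric M p (vv p z) \<nu> = 0" for z by (rule metric_hor_ver(2)[OF assms ver_in])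
  have vv: "vv p (vv p w) = vv p w"
    using hor_eqI[of 0 p "vv p w"] horizontal_linear(4)[OF hor(1) hor(1)] ver_in by (simp add: ver_eq)
  have w: "hh p w + vv p w = w" by (simp add: ver_eq)
  have "metric M p (A_at M N \<pi> p (hh p w) a + T_at M N \<pi> p (vv p w) a) \<nu> =
      metric M p ((- DP p (hh p w) a + Gam p (hh p w) (vv p a)) + (- DP p (vv p w) a + Gam p (vv p w) (vv p a))) \<nu>"
    unfolding A_at_def T_at_def oneill_A_def oneill_T_def
    by (simp only: form_simps(1)[OF metric_form] h v extend_at hor_horizontal[OF hor(1)] vv nabla_ver_extend add_0_right)
  also have "(- DP p (hh p w) a + Gam p (hh p w) (vv p a)) + (- DP p (vv p w) a + Gam p (vv p w) (vv p a)) =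
      - DP p w a + Gam p w (vv p a)"
    using linear_add[OF DP_linear(2), of p "hh p w" "vv p w" a] linear_add[OF Gam_linear(2), of p "hh p w" "vv p w" "vv p a"]
    by (simp add: w)
  finally show ?thesis .
qed

text \<open>In components the right-hand side is a sum of \<open>DP\<close>, \<open>D\<phi>\<close>
  and \<open>Gam\<close> terms. The \<open>DP\<close> terms of the \<beta> part cancel against
  \<open>A_at\<close> and \<open>T_at\<close>, except the one produced by differentiating
  \<open>X\<close>; the \<open>D\<phi>\<close> terms are absorbed by the nearly Kaehler
  identity.\<close>

lemma clairaut_rhs:
  assumes \<gamma>: "smooth_curve M J \<gamma>" and t: "t \<in> J"
  defines "U \<equiv> \<lambda>r. vv (\<gamma> r) (velocity M \<gamma> r)" and "X \<equiv> \<lambda>r. hh (\<gamma> r) (velocity M \<gamma> r)"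
  shows "metric M (\<gamma> t)
      (hh (\<gamma> t) (nabla_along M \<gamma> (\<lambda>r. beta M \<phi> N \<pi> (\<gamma> r) (X r)) t)
       + A_at M N \<pi> (\<gamma> t) (X t) (alpha M \<phi> N \<pi> (\<gamma> t) (X t))
       + T_at M N \<pi> (\<gamma> t) (U t) (alpha M \<phi> N \<pi> (\<gamma> t) (X t))
       + P_at M \<phi> N \<pi> (\<gamma> t) (velocity M \<gamma> t) (U t))
      (\<phi> (\<gamma> t) (U t)) = kappa (\<gamma> t) (velocity M \<gamma> t)"
proof -
  let ?p = "\<gamma> t" and ?c = "chart_at M (\<gamma> t)" and ?W = "velocity M \<gamma> t"
  let ?x = "cmap ?c \<circ> \<gamma>" and ?\<phi> = "\<phi> (\<gamma> t)" and ?P = "hh (\<gamma> t)" and ?Q = "vv (\<gamma> t)"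
  let ?D = "DP ?p ?W" and ?F = "D\<phi> ?p ?W" and ?G = "Gam ?p ?W" and ?g = "metric M ?p"
  let ?\<nu> = "?\<phi> (U t)" and ?a = "?Q (?\<phi> (X t))"
  note c = chart_at[of "\<gamma> t"] and form = form_simps[OF metric_form[of ?p]]
  note J = smooth_curve_near[OF \<gamma> t c]
  have Xhs: "X r \<in> hs (\<gamma> r)" for r by (simp add: X_def hor)
  have Uvs: "U t \<in> vs ?p" by (simp add: U_def ver_in)
  have \<nu>: "?\<nu> \<in> hs ?p" by (rule \<phi>_vertical[OF Uvs])
  have W: "?W = X t + U t" by (simp add: X_def U_def ver_eq)
  have h: "?g (?P z) ?\<nu> = ?g z ?\<nu>" for z by (simp add: hor_selfadjoint hor_horizontal[OF \<nu>])
  have x: "(?x has_vector_derivative ?W) (at t)"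
    using smooth_curve_velocity[OF \<gamma> t c] by (simp only: comps_chart_at)
  have Jx: "?x r \<in> cimg ?c" if "r \<in> J \<inter> \<gamma> -` cdom ?c" for r using that by auto
  obtain W' where W': "((\<lambda>r. comps M ?c (\<gamma> r) (velocity M \<gamma> r)) has_vector_derivative W') (at t)"
    using velocity_derivative[OF \<gamma> t c] by blast
  let ?Y1 = "\<lambda>r. comps M ?c (\<gamma> r) (X r)" and ?Y2 = "\<lambda>r. comps M ?c (\<gamma> r) (\<phi> (\<gamma> r) (X r))"
  let ?Y3 = "\<lambda>r. comps M ?c (\<gamma> r) (beta M \<phi> N \<pi> (\<gamma> r) (X r))"
  \<comment> \<open>Derivatives of the components of \<open>X\<close>, \<phi>X and \<beta>X, each
    obtained from the previous one by the product rule, since \<beta>X is the horizontal part of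
    \<phi>X.\<close>
  let ?Y1' = "?D ?W + ?P W'"
  let ?Y2' = "?F (X t) + ?\<phi> ?Y1'"
  let ?Y3' = "?D (?\<phi> (X t)) + ?P ?Y2'"
  have Y1: "(?Y1 has_vector_derivative ?Y1') (at t)"
    using horizontal_velocity_derivative[OF \<gamma> t W'] by (simp add: X_def)
  have "((\<lambda>r. tensor_comps \<phi> ?c (?x r) (?Y1 r)) has_vector_derivative
      (frechet_derivative (\<lambda>x. tensor_comps \<phi> ?c x (?Y1 t)) (at (?x t)) ?W + tensor_comps \<phi> ?c (?x t) ?Y1')) (at t)"
    by (rule linear_field_along_curve[OF chart_homeomorphism(2)[OF c(1)] tensor_comps_smooth[OF almost_complex(1) c(1)]
          tensor_comps_linear[OF almost_complex(1) c(1)] J Jx x Y1])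
  then have "(?Y2 has_vector_derivative
      (frechet_derivative (\<lambda>x. tensor_comps \<phi> ?c x (?Y1 t)) (at (?x t)) ?W + tensor_comps \<phi> ?c (?x t) ?Y1')) (at t)"
    by (rule has_vector_derivative_transform_within_open[OF _ J]) (simp add: tensor_comps_comps[OF c(1)])
  then have Y2: "(?Y2 has_vector_derivative ?Y2') (at t)"
    by (simp add: D\<phi>_def comps_chart_at tensor_comps_chart_at)
  have "((\<lambda>r. Phor ?c (?x r) (?Y2 r)) has_vector_derivative
      (frechet_derivative (\<lambda>x. Phor ?c x (?Y2 t)) (at (?x t)) ?W + Phor ?c (?x t) ?Y2')) (at t)"
    by (rule linear_field_along_curve[OF chart_homeomorphism(2)[OF c(1)] Phor_smooth[OF c(1)] Phor_linear[OF c(1)] J Jx x Y2])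
  then have "(?Y3 has_vector_derivative
      (frechet_derivative (\<lambda>x. Phor ?c x (?Y2 t)) (at (?x t)) ?W + Phor ?c (?x t) ?Y2')) (at t)"
    by (rule has_vector_derivative_transform_within_open[OF _ J]) (simp add: beta_eq[OF Xhs] Phor_comps[OF c(1)])
  then have Y3: "(?Y3 has_vector_derivative ?Y3') (at t)"
    by (simp add: DP_def comps_chart_at Phor_chart_at)
  have nabla_beta: "nabla_along M \<gamma> (\<lambda>r. beta M \<phi> N \<pi> (\<gamma> r) (X r)) t = ?Y3' + ?G (?P (?\<phi> (X t)))"
    using nabla_along_eq[OF Y3] by (simp add: beta_eq[OF Xhs])
  have Pat: "P_at M \<phi> N \<pi> ?p ?W (U t) = ?P (?F (U t) + ?G ?\<nu> - ?\<phi> (?G (U t)))"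
    unfolding P_at_def P_field_def nabla_tensor_eq[OF almost_complex(1) comps_extend_derivative] by (simp add: extend_at D\<phi>_def)
  have AT: "?g (A_at M N \<pi> ?p (X t) ?a + T_at M N \<pi> ?p (U t) ?a) ?\<nu> = ?g (- ?D ?a + ?G ?a) ?\<nu>"
  proof -
    have "?Q ?a = ?a"
      using hor_eqI[of 0 ?p ?a] horizontal_linear(4)[OF hor(1) hor(1)] ver_in by (simp add: ver_eq)
    with metric_A_T[OF \<nu>, of ?W ?a] show ?thesis by (simp add: X_def U_def)
  qed
  have split: "?\<phi> (X t) = ?P (?\<phi> (X t)) + ?a" by (simp add: ver_eq)
  \<comment> \<open>By \<open>hor_DP\<close> the derivative of the projection on a horizontal vector
    has no horizontal part, so against \<open>?\<nu>\<close> only the vertical part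
    \<open>?a\<close> of \<phi>X contributes; this cancels with \<open>AT\<close>.\<close>
  have D0: "?g (?D (?\<phi> (X t))) ?\<nu> = ?g (?D ?a) ?\<nu>"
  proof -
    have "?D (?\<phi> (X t)) = ?D (?P (?\<phi> (X t))) + ?D ?a"
      by (subst split) (rule linear_add[OF DP_linear(1)])
    moreover have "?g (?D (?P (?\<phi> (X t)))) ?\<nu> = 0"
      using h[of "?D (?P (?\<phi> (X t)))"] hor_DP[OF hor(1)] by (simp add: form)
    ultimately show ?thesis by (simp add: form)
  qed
  have G1: "?G (?P (?\<phi> (X t))) + ?G ?a = ?G (?\<phi> (X t))"
    using linear_add[OF Gam_linear(1), of ?p ?W "?P (?\<phi> (X t))" ?a] split by simp
  have nk: "?F (X t) + ?F (U t) + (?G (?\<phi> (X t)) + ?G ?\<nu>) - (?\<phi> (?G (X t)) + ?\<phi> (?G (U t))) = 0"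
  proof -
    have "?F ?W = ?F (X t) + ?F (U t)" "?\<phi> ?W = ?\<phi> (X t) + ?\<phi> (U t)" "?G ?W = ?G (X t) + ?G (U t)"
      using D\<phi>_add[of ?p ?W "X t" "U t"] linear_add[OF almost_complex(2), of ?p "X t" "U t"]
        linear_add[OF Gam_linear(1), of ?p ?W "X t" "U t"] by (simp_all only: W[symmetric])
    with nearly_kaehler_at[of ?p ?W] show ?thesis
      by (simp only: linear_add[OF almost_complex(2)] linear_add[OF Gam_linear(1)])
  qed
  \<comment> \<open>The acceleration disappears here: \<phi> is an isometry, and a horizontal vector
    is paired with the vertical \<open>U t\<close>.\<close>
  have PW: "?g (?\<phi> (?P W')) ?\<nu> = 0"
    unfolding almost_complex(4) by (rule metric_hor_ver(1)[OF hor(1) Uvs])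
  have "?g (?P (?Y3' + ?G (?P (?\<phi> (X t)))) + A_at M N \<pi> ?p (X t) ?a + T_at M N \<pi> ?p (U t) ?a
      + ?P (?F (U t) + ?G ?\<nu> - ?\<phi> (?G (U t)))) ?\<nu>
    = ?g (?Y3' + ?G (?P (?\<phi> (X t)))) ?\<nu> + ?g (A_at M N \<pi> ?p (X t) ?a + T_at M N \<pi> ?p (U t) ?a) ?\<nu>
      + ?g (?F (U t) + ?G ?\<nu> - ?\<phi> (?G (U t))) ?\<nu>"
    using h by (simp only: form(1) add.assoc)
  \<comment> \<open>\<open>?\<phi> (?G (X t))\<close> is added and subtracted to complete the nearly
    Kaehler expression; together with \<open>?\<phi> (?D ?W)\<close> it makes up
    \<open>kappa\<close>.\<close>
  also have "\<dots> = ?g (?F (X t) + ?F (U t) + (?G (?\<phi> (X t)) + ?G ?\<nu>) - (?\<phi> (?G (X t)) + ?\<phi> (?G (U t)))) ?\<nu>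
      + ?g (?\<phi> (?G (X t))) ?\<nu> + ?g (?\<phi> (?D ?W)) ?\<nu>"
    unfolding AT using D0 PW h by (simp add: form linear_add[OF almost_complex(2)] flip: G1)
  also have "\<dots> = ?g (?D ?W + ?G (X t)) (U t)"
    unfolding nk almost_complex(4) by (simp add: form)
  also have "\<dots> = kappa ?p ?W" by (simp add: kappa_def X_def U_def)
  finally show ?thesis unfolding nabla_beta Pat beta_eq(2)[OF Xhs] .
qed

end

section \<open>Clairaut submersions\<close>

context submersion_setup
begin

lemma metric_pythagoras: "metric M p w w = metric M p (hh p w) (hh p w) + metric M p (vv p w) (vv p w)"
proof -
  have "metric M p w w = metric M p (hh p w + vv p w) (hh p w + vv p w)" by (simp add: ver_eq)
  then show ?thesis
    unfolding form_simps(1,2)[OF metric_form] metric_hor_ver[OF hor(1) ver_in] by simp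
qed

text \<open>The cosine is the length of the horizontal part over the length of \<open>w\<close>,
  also for vertical \<open>w\<close>, where the quotient \<open>0 / 0 = 0\<close> agrees with it.
  The zero vector gets \<open>arccos 0\<close>, hence sine 1.\<close>

lemma sin_angle_to_horizontal:
  "sin (angle_to_horizontal M N \<pi> p w) =
    (if w = 0 then 1 else sqrt (metric M p (vv p w) (vv p w) / metric M p w w))"
proof (cases "w = 0")
  case True
  then show ?thesis by (simp add: angle_to_horizontal_def form_simps[OF metric_form])
next
  case False
  let ?a = "metric M p (hh p w) (hh p w)" and ?b = "metric M p (vv p w) (vv p w)" and ?k = "metric M p w w"
  have k: "?k > 0" by (rule form_pos[OF metric_form False])
  have ab: "?a \<ge> 0" "?b \<ge> 0" "?k = ?a + ?b"
    by (rule form_nonneg[OF metric_form] metric_pythagoras)+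
  have "metric M p w (hh p w) = ?a"
    using hor_selfadjoint[of p w "hh p w"] hor_horizontal[OF hor(1)] hor_selfadjoint[of p "hh p w" w] by simp
  then have "metric M p w (hh p w) / (gnorm M p w * gnorm M p (hh p w)) = ?a / sqrt ?a / sqrt ?k"
    by (simp add: gnorm_def mult.commute)
  also have "\<dots> = sqrt ?a / sqrt ?k" by (simp only: real_div_sqrt[OF ab(1)])
  also have "\<dots> = sqrt (?a / ?k)" by (simp add: real_sqrt_divide)
  finally have eq: "sin (angle_to_horizontal M N \<pi> p w) = sin (arccos (sqrt (?a / ?k)))"
    by (simp add: angle_to_horizontal_def)
  have r: "0 \<le> ?a / ?k" "?a / ?k \<le> 1" using ab k by simp_all
  have "sin (arccos (sqrt (?a / ?k))) = sqrt (1 - (sqrt (?a / ?k))\<^sup>2)"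
    using r by (intro sin_arccos) (auto intro: order_trans[OF _ real_sqrt_ge_zero])
  also have "\<dots> = sqrt (?b / ?k)" using r k ab(3) by (simp add: field_simps)
  finally show ?thesis using False eq by simp
qed

end

context riemannian_setup
begin

lemma geodesic_speed_constant:
  assumes "geodesic M J \<gamma>"
  shows "\<exists>k. \<forall>t\<in>J. metric M (\<gamma> t) (velocity M \<gamma> t) (velocity M \<gamma> t) = k"
proof -
  have \<gamma>: "smooth_curve M J \<gamma>" and g: "\<And>t. t \<in> J \<Longrightarrow> nabla_along M \<gamma> (velocity M \<gamma>) t = 0"
    using assms by (auto simp: geodesic_def)
  let ?k = "\<lambda>t. metric M (\<gamma> t) (velocity M \<gamma> t) (velocity M \<gamma> t)"
  have "(?k has_real_derivative 0) (at t within J)" if t: "t \<in> J" for t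
  proof -
    obtain W' where W': "((\<lambda>r. comps M (chart_at M (\<gamma> t)) (\<gamma> r) (velocity M \<gamma> r)) has_vector_derivative W') (at t)"
      using velocity_derivative[OF \<gamma> t chart_at] by blast
    from metric_along_curve[OF \<gamma> t W' W'] have "(?k has_real_derivative 0) (at t)"
      by (simp add: g[OF t] form_simps[OF metric_form])
    then show ?thesis by (rule has_field_derivative_at_within)
  qed
  moreover have "convex J" using \<gamma> by (simp add: smooth_curve_def is_interval_convex_1)
  ultimately show ?thesis by (blast dest: has_field_derivative_zero_constant)
qed

end

context clairaut_setup
begin

text \<open>The square of the Clairaut quantity, up to the constant squared speed, is differentiated
  because the length of the vertical part need not be differentiable where it vanishes. Along a
  geodesic the covariant derivatives of the two parts of the velocity are opposite, whence
  \<open>- kappa\<close>.\<close>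

lemma geodesic_derivative:
  assumes \<gamma>: "geodesic M J \<gamma>" and t: "t \<in> J" and f: "smooth_fun M f" and grad: "\<And>p. grad M f p \<in> hs p"
  shows "((\<lambda>r. (exp (f (\<gamma> r)))\<^sup>2 * metric M (\<gamma> r) (vv (\<gamma> r) (velocity M \<gamma> r)) (vv (\<gamma> r) (velocity M \<gamma> r)))
    has_real_derivative 2 * (exp (f (\<gamma> t)))\<^sup>2 *
      (metric M (\<gamma> t) (grad M f (\<gamma> t)) (hh (\<gamma> t) (velocity M \<gamma> t)) *
        metric M (\<gamma> t) (vv (\<gamma> t) (velocity M \<gamma> t)) (vv (\<gamma> t) (velocity M \<gamma> t))
       - kappa (\<gamma> t) (velocity M \<gamma> t))) (at t)"
proof -
  let ?W = "velocity M \<gamma> t" and ?c = "chart_at M (\<gamma> t)"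
  let ?X = "\<lambda>r. hh (\<gamma> r) (velocity M \<gamma> r)" and ?U = "\<lambda>r. vv (\<gamma> r) (velocity M \<gamma> r)"
  let ?g = "metric M (\<gamma> t)" and ?G = "christoffel M ?c (cmap ?c (\<gamma> t)) ?W"
  have c\<gamma>: "smooth_curve M J \<gamma>" and geo: "nabla_along M \<gamma> (velocity M \<gamma>) t = 0"
    using \<gamma> t by (auto simp: geodesic_def)
  note c = chart_at[of "\<gamma> t"] and form = form_simps[OF metric_form]
  note J = smooth_curve_near[OF c\<gamma> t c]
  obtain W' where W': "((\<lambda>r. comps M ?c (\<gamma> r) (velocity M \<gamma> r)) has_vector_derivative W') (at t)"
    using velocity_derivative[OF c\<gamma> t c] by blast
  note X' = horizontal_velocity_derivative[OF c\<gamma> t W']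
  let ?X' = "DP (\<gamma> t) ?W ?W + hh (\<gamma> t) W'"
  have U': "((\<lambda>r. comps M ?c (\<gamma> r) (?U r)) has_vector_derivative (W' - ?X')) (at t)"
    by (rule has_vector_derivative_transform_within_open[OF has_vector_derivative_diff[OF W' X'] J])
      (simp add: ver_eq linear_diff[OF comps_linear[OF c(1)]])
  have "nabla_along M \<gamma> ?U t = - nabla_along M \<gamma> ?X t"
    using geo linear_diff[OF Gam_linear(1), of "\<gamma> t" ?W ?W "?X t"]
    unfolding nabla_along_eq[OF U'] nabla_along_eq[OF X'] nabla_along_eq[OF W'] by (simp add: ver_eq algebra_simps)
  then have kU: "?g (nabla_along M \<gamma> ?U t) (?U t) = - kappa (\<gamma> t) ?W"
    using nabla_horizontal_velocity[OF c\<gamma> t] by (simp add: form)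
  have u: "((\<lambda>r. metric M (\<gamma> r) (?U r) (?U r)) has_real_derivative - 2 * kappa (\<gamma> t) ?W) (at t)"
    using metric_along_curve[OF c\<gamma> t U' U'] kU form_sym[OF metric_form, of "\<gamma> t" "?U t"] by simp
  have "?g (grad M f (\<gamma> t)) ?W = ?g (grad M f (\<gamma> t)) (?X t + ?U t)" by (simp add: ver_eq)
  also have "\<dots> = ?g (grad M f (\<gamma> t)) (?X t)"
    unfolding form(2) metric_hor_ver(1)[OF grad ver_in] by simp
  finally have "((\<lambda>r. f (\<gamma> r)) has_real_derivative ?g (grad M f (\<gamma> t)) (?X t)) (at t)"
    using function_along_curve[OF f c\<gamma> t] by simp
  note d = DERIV_mult[OF DERIV_power[OF DERIV_fun_exp[OF this], of 2] u]
  show ?thesis by (rule DERIV_cong[OF d]) (simp add: power2_eq_square algebra_simps)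
qed

theorem clairaut_iff:
  fixes f :: "'m \<Rightarrow> real"
  assumes f: "smooth_fun M f" and grad: "\<And>p. grad M f p \<in> hs p"
  shows "clairaut_with M N \<pi> (\<lambda>p. exp (f p)) \<longleftrightarrow>
    (\<forall>J h. regular_curve M J h \<longrightarrow> (\<forall>s\<in>J.
      metric M (h s) (grad M f (h s)) (hh (h s) (velocity M h s)) *
        metric M (h s) (vv (h s) (velocity M h s)) (vv (h s) (velocity M h s)) = kappa (h s) (velocity M h s)))"
    (is "?C \<longleftrightarrow> (\<forall>J h. regular_curve M J h \<longrightarrow> (\<forall>s\<in>J. ?grad h s * ?u h s = ?\<kappa> h s))")
proof
  assume C: ?C
  show "\<forall>J h. regular_curve M J h \<longrightarrow> (\<forall>s\<in>J. ?grad h s * ?u h s = ?\<kappa> h s)"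
  proof (intro allI impI ballI)
    fix J h s assume h: "regular_curve M J h" and s: "s \<in> J"
    then have ne: "velocity M h s \<noteq> 0" by (simp add: regular_curve_def)
    \<comment> \<open>Both sides of the identity depend on the point and the velocity at
      \<open>s\<close> alone, so the curve may be exchanged for a geodesic with this initial
      velocity, to which the Clairaut condition applies.\<close>
    obtain e \<gamma> where e: "e > 0" and geo: "geodesic M {-e<..<e} \<gamma>" and \<gamma>0: "\<gamma> 0 = h s" "velocity M \<gamma> 0 = velocity M h s"
      by (rule geodesic_exists)
    obtain k where k: "\<And>t. t \<in> {-e<..<e} \<Longrightarrow> metric M (\<gamma> t) (velocity M \<gamma> t) (velocity M \<gamma> t) = k"
      using geodesic_speed_constant[OF geo] by blast
    have 0: "0 \<in> {-e<..<e}" using e by simp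
    have k0: "k > 0" using k[OF 0] form_pos[OF metric_form ne, of "h s"] \<gamma>0 by simp
    obtain C1 where C1: "\<And>t. t \<in> {-e<..<e} \<Longrightarrow> exp (f (\<gamma> t)) * sin (angle_to_horizontal M N \<pi> (\<gamma> t) (velocity M \<gamma> t)) = C1"
      using C geo unfolding clairaut_with_def constant_on_def by blast
    have const: "C1\<^sup>2 * k = (exp (f (\<gamma> t)))\<^sup>2 * ?u \<gamma> t" if t: "t \<in> {-e<..<e}" for t
    proof -
      have "velocity M \<gamma> t \<noteq> 0" using k[OF t] k0 form_simps(7)[OF metric_form] by (metis less_irrefl)
      then have "exp (f (\<gamma> t)) * sqrt (?u \<gamma> t / k) = C1"
        using C1[OF t] k[OF t] by (simp add: sin_angle_to_horizontal)
      then have "C1\<^sup>2 = (exp (f (\<gamma> t)))\<^sup>2 * (sqrt (?u \<gamma> t / k))\<^sup>2" by (metis power_mult_distrib)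
      also have "(sqrt (?u \<gamma> t / k))\<^sup>2 = ?u \<gamma> t / k"
        using k0 form_nonneg[OF metric_form] by (intro real_sqrt_pow2 divide_nonneg_pos)
      finally show ?thesis using k0 by (simp add: field_simps)
    qed
    have "((\<lambda>t. C1\<^sup>2 * k) has_real_derivative 0) (at 0)" by simp
    then have "((\<lambda>t. (exp (f (\<gamma> t)))\<^sup>2 * ?u \<gamma> t) has_real_derivative 0) (at 0)"
      by (rule has_field_derivative_transform_within_open[OF _ open_greaterThanLessThan 0 const])
    from DERIV_unique[OF geodesic_derivative[OF geo 0 f grad] this]
    show "?grad h s * ?u h s = ?\<kappa> h s" by (simp add: \<gamma>0)
  qed
next
  assume R: "\<forall>J h. regular_curve M J h \<longrightarrow> (\<forall>s\<in>J. ?grad h s * ?u h s = ?\<kappa> h s)"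
  show ?C
    unfolding clairaut_with_def
  proof (intro conjI allI impI submersion)
    fix J \<gamma> assume geo: "geodesic M J \<gamma>"
    then have c\<gamma>: "smooth_curve M J \<gamma>" by (simp add: geodesic_def)
    then have J: "convex J" by (simp add: smooth_curve_def is_interval_convex_1)
    obtain k where k: "\<And>t. t \<in> J \<Longrightarrow> metric M (\<gamma> t) (velocity M \<gamma> t) (velocity M \<gamma> t) = k"
      using geodesic_speed_constant[OF geo] by blast
    show "(\<lambda>t. exp (f (\<gamma> t)) * sin (angle_to_horizontal M N \<pi> (\<gamma> t) (velocity M \<gamma> t))) constant_on J"
    \<comment> \<open>A geodesic of zero speed is not regular, so the identity says nothing about
      it; there \<open>f\<close> is constant along it and the sine has the default value 1.\<close>
    proof (cases "k = 0")
      case True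
      then have v0: "velocity M \<gamma> t = 0" if "t \<in> J" for t
        using k[OF that] form_eq_0_iff[OF metric_form] by simp
      have "((\<lambda>t. f (\<gamma> t)) has_real_derivative 0) (at t within J)" if "t \<in> J" for t
        using function_along_curve[OF f c\<gamma> that] v0[OF that]
        by (simp add: form_simps[OF metric_form] has_field_derivative_at_within)
      with J obtain C0 where "\<forall>t\<in>J. f (\<gamma> t) = C0" by (blast dest: has_field_derivative_zero_constant)
      then show ?thesis unfolding constant_on_def
        by (intro exI[of _ "exp C0"]) (simp add: v0 sin_angle_to_horizontal)
    next
      case False
      then have ne: "velocity M \<gamma> t \<noteq> 0" if "t \<in> J" for t
        using k[OF that] form_simps(7)[OF metric_form] by auto
      then have "regular_curve M J \<gamma>" using c\<gamma> by (simp add: regular_curve_def)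
      with R have eq: "?grad \<gamma> t * ?u \<gamma> t = ?\<kappa> \<gamma> t" if "t \<in> J" for t using that by blast
      have "((\<lambda>t. (exp (f (\<gamma> t)))\<^sup>2 * ?u \<gamma> t) has_real_derivative 0) (at t within J)" if t: "t \<in> J" for t
        using has_field_derivative_at_within[OF geodesic_derivative[OF geo t f grad]] eq[OF t] by simp
      with J obtain C0 where C0: "\<forall>t\<in>J. (exp (f (\<gamma> t)))\<^sup>2 * ?u \<gamma> t = C0"
        by (blast dest: has_field_derivative_zero_constant)
      have "exp (f (\<gamma> t)) * sin (angle_to_horizontal M N \<pi> (\<gamma> t) (velocity M \<gamma> t)) = sqrt (C0 / k)" if t: "t \<in> J" for t
      proof -
        have "exp (f (\<gamma> t)) * sqrt (?u \<gamma> t / k) = sqrt ((exp (f (\<gamma> t)))\<^sup>2 * (?u \<gamma> t / k))"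
          unfolding real_sqrt_mult by simp
        then show ?thesis using C0 t ne[OF t] k[OF t] by (simp add: sin_angle_to_horizontal)
      qed
      then show ?thesis unfolding constant_on_def by blast
    qed
  qed simp
qed

end

theorem theorem3p2:
  fixes M :: "('m::{t2_space,second_countable_topology}, 'a::euclidean_space) manifold"
    and N :: "('n::{t2_space,second_countable_topology}, 'b::euclidean_space) manifold"
    and \<phi> :: "'m \<Rightarrow> 'a \<Rightarrow> 'a"
    and \<pi> :: "'m \<Rightarrow> 'n"
    and f :: "'m \<Rightarrow> real"
  assumes "nearly_kaehler M \<phi>"
    and "anti_invariant_submersion M \<phi> N \<pi>"
    and "smooth_fun M f"
    and grad_horizontal: "\<And>p. grad M f p \<in> horizontal_space M N \<pi> p"
  shows "clairaut_with M N \<pi> (\<lambda>p. exp (f p)) \<longleftrightarrow>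
    (\<forall>J h. regular_curve M J h \<longrightarrow>
      (let U = (\<lambda>s. ver M N \<pi> (h s) (velocity M h s));
           X = (\<lambda>s. hor M N \<pi> (h s) (velocity M h s));
           \<alpha>X = (\<lambda>s. alpha M \<phi> N \<pi> (h s) (X s));
           \<beta>X = (\<lambda>s. beta M \<phi> N \<pi> (h s) (X s))
       in \<forall>s\<in>J.
         metric M (h s) (grad M f (h s)) (X s) * metric M (h s) (U s) (U s) =
         metric M (h s)
           (hor M N \<pi> (h s) (nabla_along M h \<beta>X s)
            + A_at M N \<pi> (h s) (X s) (\<alpha>X s)
            + T_at M N \<pi> (h s) (U s) (\<alpha>X s)
            + P_at M \<phi> N \<pi> (h s) (velocity M h s) (U s))
           (\<phi> (h s) (U s))))"
proof -
  interpret clairaut_setup M N \<phi> \<pi> using assms(1,2) by unfold_locales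
  have c: "smooth_curve M J h" if "regular_curve M J h" for J h
    using that by (simp add: regular_curve_def)
  show ?thesis
    unfolding clairaut_iff[OF assms(3) grad_horizontal] Let_def
    by (intro iff_allI imp_cong ball_cong refl) (simp only: clairaut_rhs[OF c])
qed

end
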